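(* Let $1<p_1\le2\le p_2<\infty$, $1<q_1\le2\le q_2<\infty$. Then for all $m,k,n\in\mathbb N$, $$\lambda_n(B^{m,k}_{p_1,q_1},\,l^{m,k}_{p_2,q_2})\lesssim\min\Bigl\{n^{-\frac12}\,m^{\max\{\frac1{p_2},\frac1{p_1'}\}}\,k^{\max\{\frac1{q_2},\frac1{q_1'}\}},\ 1\Bigr\}.$$ Moreover, there exists $a=a(p_2,q_2)>0$ such that for all $m,k,n\in\mathbb N$ with $n\le amk$ the following holds: if $\frac1{p_1}+\frac1{p_2}\ge1$ and $\frac1{q_1}+\frac1{q_2}\ge1$, then $$\lambda_n(B^{m,k}_{p_1,q_1},\,l^{m,k}_{p_2,q_2})\gtrsim\min\{n^{-\frac12}m^{\frac1{p_2}}k^{\frac1{q_2}},\,1\};$$ if $\frac1{p_1}+\frac1{p_2}\le1$ and $\frac1{q_1}+\frac1{q_2}\le1$, then $$\lambda_n(B^{m,k}_{p_1,q_1},\,l^{m,k}_{p_2,q_2})\gtrsim\min\{n^{-\frac12}m^{\frac1{p_1'}}k^{\frac1{q_1'}},\,1\}.$$ All implied constants depend only on $p_1,p_2,q_1,q_2$.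
   Context: For $m,k\in\mathbb N$, $1\le p,q<\infty$, $l^{m,k}_{p,q}$ is the space $\mathbb R^{mk}$ with the norm $\|(x_{ij})_{1\le i\le m,\,1\le j\le k}\|_{l^{m,k}_{p,q}}=\Bigl(\sum_{j=1}^k\bigl(\sum_{i=1}^m|x_{ij}|^p\bigr)^{q/p}\Bigr)^{1/q}$, and $B^{m,k}_{p,q}$ is its unit ball. For $1<p<\infty$, $p'=\frac p{p-1}$. For a normed space $X$ and $M\subset X$, the linear $n$-width is $\lambda_n(M,X)=\inf_A\sup_{x\in M}\|x-Ax\|_X$, the infimum over continuous linear operators $A:X\to X$ of rank at most $n$. $A\lesssim B$ (equivalently $B\gtrsim A$) means $A\le CB$ with a constant $C>0$ depending only on the indicated parameters. *)

theory Defs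
  imports "HOL-Analysis.Analysis" "HOL-Analysis.Finite_Function_Topology"
begin

text \<open>
  A normed space is given by a linear subspace \<open>V\<close> of a real vector space together with a norm
  \<open>N\<close> on \<open>V\<close>; only the values of operators on \<open>V\<close> matter.  This lets the dimension of the
  space be an ordinary natural number that can be quantified over inside a formula.
\<close>

definition linear_operator_on :: "'a::real_vector set \<Rightarrow> ('a \<Rightarrow> 'a) \<Rightarrow> bool" where
  "linear_operator_on V A \<longleftrightarrow>
     A ` V \<subseteq> V \<and>
     (\<forall>x\<in>V. \<forall>y\<in>V. A (x + y) = A x + A y) \<and>
     (\<forall>c. \<forall>x\<in>V. A (c *\<^sub>R x) = c *\<^sub>R A x)"

definition norm_continuous_on :: "'a::real_vector set \<Rightarrow> ('a \<Rightarrow> real) \<Rightarrow> ('a \<Rightarrow> 'a) \<Rightarrow> bool" where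
  "norm_continuous_on V N A \<longleftrightarrow>
     (\<forall>x\<in>V. \<forall>e>0. \<exists>d>0. \<forall>y\<in>V. N (y - x) < d \<longrightarrow> N (A y - A x) < e)"

text \<open>
  The rank is bounded via an explicit finite basis of the range, because \<open>dim\<close> is \<open>0\<close> on
  infinite-dimensional subspaces.
\<close>

definition rank_at_most :: "nat \<Rightarrow> 'a::real_vector set \<Rightarrow> ('a \<Rightarrow> 'a) \<Rightarrow> bool" where
  "rank_at_most n V A \<longleftrightarrow>
     (\<exists>B. finite B \<and> card B \<le> n \<and> independent B \<and> span B = A ` V)"

text \<open>
  The width is extended-real valued, so that the infimum and supremum are always the true ones,
  also for unbounded sets of reals.
\<close>

definition linear_width ::
    "nat \<Rightarrow> 'a::real_vector set \<Rightarrow> 'a set \<Rightarrow> ('a \<Rightarrow> real) \<Rightarrow> ereal" where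
  "linear_width n M V N =
     (INF A \<in> {A. linear_operator_on V A \<and> norm_continuous_on V N A \<and> rank_at_most n V A}.
        SUP x\<in>M. ereal (N (x - A x)))"

text \<open>
  \<open>\<real>\<^bsup>mk\<^esup>\<close> is the space of finitely supported families indexed by pairs of naturals whose
  support lies in \<open>{1..m} \<times> {1..k}\<close>.
\<close>

definition lmk_space :: "nat \<Rightarrow> nat \<Rightarrow> ((nat \<times> nat) \<Rightarrow>\<^sub>0 real) set" where
  "lmk_space m k = {x. Poly_Mapping.keys x \<subseteq> {1..m} \<times> {1..k}}"

definition lmk_norm ::
    "real \<Rightarrow> real \<Rightarrow> nat \<Rightarrow> nat \<Rightarrow> ((nat \<times> nat) \<Rightarrow>\<^sub>0 real) \<Rightarrow> real" where
  "lmk_norm p q m k x =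
     (\<Sum>j=1..k. (\<Sum>i=1..m. \<bar>Poly_Mapping.lookup x (i, j)\<bar> powr p) powr (q / p)) powr (1 / q)"

definition lmk_ball ::
    "real \<Rightarrow> real \<Rightarrow> nat \<Rightarrow> nat \<Rightarrow> ((nat \<times> nat) \<Rightarrow>\<^sub>0 real) set" where
  "lmk_ball p q m k = {x \<in> lmk_space m k. lmk_norm p q m k x \<le> 1}"

definition lmk_width ::
    "nat \<Rightarrow> real \<Rightarrow> real \<Rightarrow> real \<Rightarrow> real \<Rightarrow> nat \<Rightarrow> nat \<Rightarrow> ereal" where
  "lmk_width n p\<^sub>1 q\<^sub>1 p\<^sub>2 q\<^sub>2 m k =
     linear_width n (lmk_ball p\<^sub>1 q\<^sub>1 m k) (lmk_space m k) (lmk_norm p\<^sub>2 q\<^sub>2 m k)"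

definition conj_exponent :: "real \<Rightarrow> real" where
  "conj_exponent p = p / (p - 1)"

end

theory Submission
  imports Defs
begin

text \<open>
  Upper bound. Lowering \<open>p\<^sub>2\<close> or raising \<open>p\<^sub>1\<close> (and likewise \<open>q\<^sub>2\<close>, \<open>q\<^sub>1\<close>) does not change the
  right-hand side, so the two exponents may be taken conjugate to each other.  Approximate by
  \<open>A = (1/n) (\<Sum>s<n. \<epsilon>\<^sub>s \<otimes> \<epsilon>\<^sub>s)\<close> with random sign vectors \<open>\<epsilon>\<^sub>s\<close>.  The diagonal of \<open>A - 1\<close> vanishes, and
  the error is the supremum over the ball of the off-diagonal bilinear form.  The ball is dominated
  by sums of atoms taken from finite classes \<open>T\<^sub>a\<close> with \<open>l\<^sub>2\<close>-radius \<open>\<sigma>\<^sub>a\<close> and entropy \<open>h\<^sub>a\<close>, and after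
  decoupling the mean of the maximum of the form over \<open>T\<^sub>a \<times> T\<^sub>b\<close> is at most a constant times
  \<open>\<sigma>\<^sub>a \<sigma>\<^sub>b (sqrt n (sqrt h\<^sub>a + sqrt h\<^sub>b) + sqrt (h\<^sub>a h\<^sub>b))\<close>.  For the mixed norms the classes are
  products of one-dimensional ones, and \<open>\<Sum>\<sigma>\<^sub>a\<close> is bounded while
  \<open>\<Sum>\<sigma>\<^sub>a sqrt h\<^sub>a\<close> is of order \<open>D = m\<^bsup>1/p\<^esup> k\<^bsup>1/q\<^esup>\<close>; for \<open>D \<le> sqrt n\<close> this gives an error of order
  \<open>D / sqrt n\<close>, and otherwise \<open>A = 0\<close> suffices.

  Lower bound. If the error is below \<open>1/4\<close>, then \<open>A\<close> has diagonal entries at least \<open>1/2\<close>, so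
  \<open>m k / 2 \<le> tr A \<le> sqrt n * \<parallel>A\<parallel>\<^sub>H\<^sub>S\<close>.  Testing on unit vectors bounds the columns of \<open>1 - A\<close> in
  \<open>l\<^sub>2\<close>, testing on the rows of \<open>1 - A\<close> bounds its rows, and either gives the matching estimate.
\<close>


subsection \<open>Rademacher averages\<close>

text \<open>Conjugate exponents are what makes one decomposition enough: by duality the error norm
  is tested on the same body that is being approximated, so the error is 1/n times a bilinear form
  with both arguments in one ball. Signs square to 1, so A has diagonal exactly 1 and the remaining
  form has mean zero. The obstacle is that for exponents below 2 the ball is too rich for a single
  union bound, which would pair the full radius with the full entropy. Splitting by scale trades one
  against the other: classes of large entropy have small radius. The result consists of a term sqrt
  n * D and a term D^2, and D \<le> sqrt n is the range where the second is absorbed by the first.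
  Exponent 2 is the borderline where all scales have the same radius; it is served by one grid.
  Averages over finite sets of sign patterns replace probability spaces. In the lower bound the
  identity part of A has to be beaten in the estimate of its Hilbert--Schmidt norm. This dictates n
  \<le> m k / 16: the ratio sqrt (m k / n) is then at least 4.\<close>

definition mean :: "'b set \<Rightarrow> ('b \<Rightarrow> real) \<Rightarrow> real" where
  "mean S f = (\<Sum>x\<in>S. f x) / real (card S)"

text \<open>A sign pattern is stored as the set of its positive coordinates. Uniform signs become a
  uniform subset of \<open>I\<close>, and n independent sign vectors an element of the finite
  product \<open>signs n I\<close>.\<close>

definition rsign :: "'i set \<Rightarrow> 'i \<Rightarrow> real" where
  "rsign A i = (if i \<in> A then 1 else -1)"

abbreviation signs :: "nat \<Rightarrow> 'i set \<Rightarrow> (nat \<Rightarrow> 'i set) set" where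
  "signs n I \<equiv> PiE {..<n} (\<lambda>_. Pow I)"

lemma mean_mono: "(\<And>x. x \<in> S \<Longrightarrow> f x \<le> g x) \<Longrightarrow> mean S f \<le> mean S g"
  unfolding mean_def by (intro divide_right_mono sum_mono) auto

lemma mean_cong: "(\<And>x. x \<in> S \<Longrightarrow> f x = g x) \<Longrightarrow> mean S f = mean S g"
  by (simp add: mean_def)

lemma mean_add: "mean S (\<lambda>x. f x + g x) = mean S f + mean S g"
  by (simp add: mean_def sum.distrib add_divide_distrib)

lemma mean_cmult: "mean S (\<lambda>x. c * f x) = c * mean S f"
  by (simp add: mean_def sum_distrib_left)

lemma mean_sum: "mean S (\<lambda>x. \<Sum>a\<in>T. f a x) = (\<Sum>a\<in>T. mean S (f a))"
  unfolding mean_def by (subst sum.swap) (simp add: sum_divide_distrib)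

lemma mean_const: "finite S \<Longrightarrow> S \<noteq> {} \<Longrightarrow> mean S (\<lambda>x. c) = c"
  by (simp add: mean_def)

lemma mean_swap: "mean S (\<lambda>x. mean T (f x)) = mean T (\<lambda>y. mean S (\<lambda>x. f x y))"
  unfolding mean_def
  by (simp add: sum_divide_distrib[symmetric] sum.swap[of _ T S] mult.commute)

lemma mean_reindex:
  assumes "bij_betw \<pi> S S"
  shows "mean S (\<lambda>x. f (\<pi> x)) = mean S f"
  unfolding mean_def using sum.reindex_bij_betw[OF assms, of f] by simp

text \<open>The probabilistic method in finite form: a bound for the average yields an outcome
  obeying it.\<close>

lemma mean_attained:
  assumes "finite S" "S \<noteq> {}"
  obtains x where "x \<in> S" "f x \<le> mean S f"
proof (rule ccontr)
  assume "\<not> thesis"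
  then have "\<And>x. x \<in> S \<Longrightarrow> mean S f < f x" using that by force
  then have "(\<Sum>x\<in>S. mean S f) < (\<Sum>x\<in>S. f x)" using assms by (intro sum_strict_mono) auto
  then show False using assms by (simp add: mean_def)
qed

lemma finite_signs [simp]: "finite I \<Longrightarrow> finite (signs n I)"
  by (intro finite_PiE) auto

lemma signs_nonempty [simp]: "signs n I \<noteq> {}"
  by (auto simp: PiE_eq_empty_iff)

text \<open>Independence of the n rows: multiplying out the product of row sums gives the sum over
  the product set.\<close>

lemma mean_signs_prod:
  assumes "finite I"
  shows "mean (signs n I) (\<lambda>e. \<Prod>s<n. F s (e s)) = (\<Prod>s<n. mean (Pow I) (F s))"
proof -
  have "(\<Prod>s<n. \<Sum>A\<in>Pow I. F s A) = (\<Sum>e\<in>signs n I. \<Prod>s<n. F s (e s))"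
    using assms by (intro prod_sum_PiE) auto
  moreover have "card (signs n I) = (\<Prod>s<n. card (Pow I))"
    by (simp add: card_PiE)
  ultimately show ?thesis by (simp add: mean_def prod_dividef)
qed

section \<open>Sub-Gaussian estimates for sign sums\<close>

lemma exp_sums: "(\<lambda>k. z ^ k / fact k) sums exp (z::real)"
  using exp_converges[of z] by (simp add: divide_inverse mult.commute)

lemma cosh_sums: "(\<lambda>k. z ^ (2 * k) / fact (2 * k)) sums cosh (z::real)"
proof -
  have "(\<lambda>n. if even n then z ^ n /\<^sub>R fact n else 0) sums cosh z"
    by (rule cosh_converges)
  then have "(\<lambda>k. (\<lambda>n. if even n then z ^ n /\<^sub>R fact n else 0) (2 * k)) sums cosh z"
    by (subst sums_mono_reindex) (auto simp: strict_mono_def elim!: evenE)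
  then show ?thesis by (simp add: divide_inverse mult.commute)
qed

lemma two_power_fact_le: "2 ^ k * fact k \<le> (fact (2 * k) :: real)"
proof (induction k)
  case (Suc k)
  have "2 ^ Suc k * fact (Suc k) = (2 ^ k * fact k) * (2 * (real k + 1))"
    by (simp add: field_simps)
  also have "\<dots> \<le> fact (2 * k) * ((2 * real k + 2) * (2 * real k + 1))"
    using Suc by (intro mult_mono) (auto simp: field_simps)
  also have "\<dots> = fact (2 * Suc k)"
    by (simp add: field_simps)
  finally show ?case .
qed simp

text \<open>Termwise comparison of two power series, using (2k)! \<ge> 2^k k!. This is the Gaussian
  bound for a single sign, from which the sub-Gaussian estimates follow.\<close>

lemma cosh_le_exp: "cosh (z::real) \<le> exp (z\<^sup>2 / 2)"
proof (rule sums_le[OF _ cosh_sums])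
  show "(\<lambda>k. (z\<^sup>2 / 2) ^ k / fact k) sums exp (z\<^sup>2 / 2)"
    by (rule exp_sums)
  show "z ^ (2 * k) / fact (2 * k) \<le> (z\<^sup>2 / 2) ^ k / fact k" for k
  proof -
    have "z ^ (2 * k) / fact (2 * k) \<le> z ^ (2 * k) / (2 ^ k * fact k)"
      using two_power_fact_le[of k] by (intro divide_left_mono) (auto simp: power_mult)
    then show ?thesis by (simp add: power_mult power_divide)
  qed
qed

lemma power_le_cosh: "z ^ (2 * k) \<le> fact (2 * k) * cosh (z::real)"
proof -
  have "z ^ (2 * k) / fact (2 * k) \<le> cosh z"
    using sum_le_suminf[of "\<lambda>k. z ^ (2 * k) / fact (2 * k)" "{k}"] cosh_sums[of z]
    by (auto simp: sums_iff power_mult)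
  then show ?thesis by (simp add: field_simps)
qed

text \<open>When the right-hand side is multiplied out, the subset \<open>A\<close> records the
  factors that contribute exp (a i); the chosen exponents add up to the signed sum.\<close>

lemma sum_Pow_exp:
  assumes "finite I"
  shows "(\<Sum>A\<in>Pow I. exp (\<Sum>i\<in>I. rsign A i * a i)) = (\<Prod>i\<in>I. exp (a i) + exp (- a i))"
proof -
  have "(\<Prod>i\<in>A. exp (a i)) * (\<Prod>i\<in>I - A. exp (- a i)) = exp (\<Sum>i\<in>I. rsign A i * a i)"
    if "A \<subseteq> I" for A
  proof -
    have "(\<Sum>i\<in>I. rsign A i * a i) = (\<Sum>i\<in>A. a i) + (\<Sum>i\<in>I - A. - a i)"
      using that assms
      by (subst sum.subset_diff[OF that]) (auto simp: rsign_def intro!: sum.cong)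
    moreover have "finite A" using that assms finite_subset by blast
    ultimately show ?thesis using assms by (simp add: exp_add exp_sum)
  qed
  then show ?thesis by (subst prod_add[OF assms]) (auto intro!: sum.cong)
qed

lemma row_mgf:
  assumes "finite I"
  shows "mean (Pow I) (\<lambda>A. exp (\<Sum>i\<in>I. rsign A i * a i)) \<le> exp ((\<Sum>i\<in>I. (a i)\<^sup>2) / 2)"
proof -
  have "(\<Prod>i\<in>I. exp (a i) + exp (- a i)) \<le> (\<Prod>i\<in>I. 2 * exp ((a i)\<^sup>2 / 2))"
    using cosh_le_exp by (intro prod_mono) (auto simp: cosh_def mult.commute intro: add_nonneg_nonneg)
  also have "\<dots> = 2 ^ card I * exp ((\<Sum>i\<in>I. (a i)\<^sup>2) / 2)"
    using assms by (simp add: prod.distrib exp_sum sum_divide_distrib)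
  finally show ?thesis
    using assms by (simp only: mean_def sum_Pow_exp card_Pow) (simp add: field_simps)
qed

lemma signs_mgf:
  assumes "finite I"
  shows "mean (signs n I) (\<lambda>e. exp (\<Sum>s<n. \<Sum>i\<in>I. rsign (e s) i * a s i))
    \<le> exp ((\<Sum>s<n. \<Sum>i\<in>I. (a s i)\<^sup>2) / 2)"
proof -
  have "mean (signs n I) (\<lambda>e. exp (\<Sum>s<n. \<Sum>i\<in>I. rsign (e s) i * a s i))
      = (\<Prod>s<n. mean (Pow I) (\<lambda>A. exp (\<Sum>i\<in>I. rsign A i * a s i)))"
    by (simp add: exp_sum flip: mean_signs_prod[OF assms])
  also have "\<dots> \<le> (\<Prod>s<n. exp ((\<Sum>i\<in>I. (a s i)\<^sup>2) / 2))"
    by (intro prod_mono conjI row_mgf[OF assms]) (auto simp: mean_def intro!: sum_nonneg divide_nonneg_nonneg)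
  finally show ?thesis by (simp add: exp_sum sum_divide_distrib)
qed

text \<open>(2k)! is (k!)^2 times a central binomial coefficient. One factor k! is deliberately
  kept: it cancels the k! of the exponential series, while k^k cancels against (2k)^k up to a power
  of 2.\<close>

lemma fact_double_le: "fact (2 * k) \<le> 4 ^ k * (fact k * real k ^ k)"
proof -
  have "fact (2 * k) = (fact k * fact k * real (2 * k choose k))"
    using binomial_fact[of k "2 * k", where ?'a = real] by (simp add: field_simps)
  also have "\<dots> \<le> fact k * real k ^ k * 4 ^ k"
  proof (intro mult_mono)
    show "fact k \<le> real k ^ k"
      using fact_le_power[of k, where ?'a = real] by simp
    have "2 * k choose k \<le> 2 ^ (2 * k)" by (rule binomial_le_pow2)
    then have "real (2 * k choose k) \<le> real (2 ^ (2 * k))" by (simp only: of_nat_le_iff)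
    then show "real (2 * k choose k) \<le> 4 ^ k" by (simp add: power_mult)
  qed auto
  finally show ?thesis by (simp add: mult_ac)
qed

text \<open>Each moment is read off the Laplace transform at \<open>t = sqrt (2 * k)\<close>.\<close>

lemma mean_exp_square_le:
  assumes mgf: "\<And>t. mean S (\<lambda>e. exp (t * z e)) \<le> exp (t\<^sup>2 / 2)"
  shows "mean S (\<lambda>e. exp ((z e)\<^sup>2 / (4 * exp 1))) \<le> 2"
proof -
  define f where "f k = mean S (\<lambda>e. ((z e)\<^sup>2 / (4 * exp 1)) ^ k / fact k)" for k
  have "(\<lambda>k. ((z e)\<^sup>2 / (4 * exp 1)) ^ k / fact k) sums exp ((z e)\<^sup>2 / (4 * exp 1))" for e
    by (rule exp_sums)
  then have "f sums mean S (\<lambda>e. exp ((z e)\<^sup>2 / (4 * exp 1)))"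
    unfolding f_def mean_def by (intro sums_divide sums_sum)
  moreover have "(\<lambda>k. (1/2) ^ k) sums (2::real)"
    using geometric_sums[of "1/2::real"] by simp
  \<comment> \<open>Origin of the constant 4e: the 2k-th moment is at most (2k)! e^k / (2k)^k \<le>
    k! (2e)^k, so division by (4e)^k k! leaves 2^(-k), and the series sums to 2.\<close>
  moreover have "f k \<le> (1/2) ^ k" for k
  proof (cases "k = 0")
    case True
    \<comment> \<open>Not an equation: \<open>mean\<close> of a constant is 0 when \<open>S\<close>
      is empty or infinite.\<close>
    have "f 0 \<le> 1" by (simp add: f_def mean_def)
    with True show ?thesis by simp
  next
    case False
    define t where "t = sqrt (2 * k)"
    have t: "t > 0" "t\<^sup>2 = 2 * k" using False by (auto simp: t_def)
    have tk: "t ^ (2 * k) = (2 * k) ^ k" using t(2) by (simp add: power_mult)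
    have "mean S (\<lambda>e. (t * z e) ^ (2 * k)) \<le> mean S (\<lambda>e. fact (2 * k) * cosh (t * z e))"
      by (intro mean_mono power_le_cosh)
    also have "\<dots> = fact (2 * k) * ((1/2) * (mean S (\<lambda>e. exp (t * z e)) + mean S (\<lambda>e. exp ((- t) * z e))))"
      by (simp add: cosh_def flip: mean_cmult mean_add)
    also have "\<dots> \<le> fact (2 * k) * ((1/2) * (exp (t\<^sup>2 / 2) + exp ((- t)\<^sup>2 / 2)))"
      by (intro mult_left_mono add_mono mgf) auto
    also have "\<dots> = fact (2 * k) * exp 1 ^ k"
      using t by (simp add: exp_of_nat_mult[symmetric])
    also have "\<dots> \<le> 4 ^ k * (fact k * real k ^ k) * exp 1 ^ k"
      by (intro mult_right_mono fact_double_le) auto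
    finally have *: "mean S (\<lambda>e. (t * z e) ^ (2 * k)) \<le> 4 ^ k * (fact k * real k ^ k) * exp 1 ^ k" .
    have "f k = mean S (\<lambda>e. (1 / (real ((2*k) ^ k) * (4 * exp 1) ^ k * fact k)) * (t * z e) ^ (2 * k))"
      unfolding f_def using False
      by (intro arg_cong[where f = "mean S"] ext)
        (simp add: power_mult_distrib tk power_divide flip: power_mult)
    also have "\<dots> = (1 / (real ((2*k) ^ k) * (4 * exp 1) ^ k * fact k)) * mean S (\<lambda>e. (t * z e) ^ (2 * k))"
      by (rule mean_cmult)
    also have "\<dots> \<le> (1 / (real ((2*k) ^ k) * (4 * exp 1) ^ k * fact k)) * (4 ^ k * (fact k * real k ^ k) * exp 1 ^ k)"
      by (intro mult_left_mono *) auto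
    also have "\<dots> = (1/2) ^ k"
      using False by (simp add: power_mult_distrib field_simps)
    finally show ?thesis .
  qed
  ultimately show ?thesis by (meson sums_le)
qed

text \<open>Rows are independent and each row sum is sub-Gaussian of variance at most 1, so every
  row contributes one factor 2.\<close>

lemma signs_exp_square_le:
  assumes "finite I" "(\<Sum>i\<in>I. (a i)\<^sup>2) \<le> 1"
  shows "mean (signs n I) (\<lambda>e. exp ((\<Sum>s<n. (\<Sum>i\<in>I. rsign (e s) i * a i)\<^sup>2) / (4 * exp 1))) \<le> 2 ^ n"
proof -
  have row: "mean (Pow I) (\<lambda>A. exp ((\<Sum>i\<in>I. rsign A i * a i)\<^sup>2 / (4 * exp 1))) \<le> 2"
  proof (rule mean_exp_square_le)
    fix t :: real
    have "mean (Pow I) (\<lambda>A. exp (t * (\<Sum>i\<in>I. rsign A i * a i)))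
        = mean (Pow I) (\<lambda>A. exp (\<Sum>i\<in>I. rsign A i * (t * a i)))"
      by (simp add: sum_distrib_left mult_ac)
    also have "\<dots> \<le> exp ((\<Sum>i\<in>I. (t * a i)\<^sup>2) / 2)" by (rule row_mgf[OF assms(1)])
    also have "(\<Sum>i\<in>I. (t * a i)\<^sup>2) = t\<^sup>2 * (\<Sum>i\<in>I. (a i)\<^sup>2)"
      by (simp add: power_mult_distrib sum_distrib_left)
    also have "\<dots> \<le> t\<^sup>2" using assms(2) by (simp add: mult_left_le)
    finally show "mean (Pow I) (\<lambda>A. exp (t * (\<Sum>i\<in>I. rsign A i * a i))) \<le> exp (t\<^sup>2 / 2)"
      by (simp add: divide_right_mono)
  qed
  have "mean (signs n I) (\<lambda>e. exp ((\<Sum>s<n. (\<Sum>i\<in>I. rsign (e s) i * a i)\<^sup>2) / (4 * exp 1)))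
     = (\<Prod>s<n. mean (Pow I) (\<lambda>A. exp ((\<Sum>i\<in>I. rsign A i * a i)\<^sup>2 / (4 * exp 1))))"
    by (subst mean_signs_prod[OF assms(1), symmetric]) (simp add: exp_sum sum_divide_distrib)
  also have "\<dots> \<le> (\<Prod>s<n. 2)"
    using row by (intro prod_mono) (auto simp: mean_def intro!: sum_nonneg divide_nonneg_nonneg)
  finally show ?thesis by simp
qed

section \<open>Maxima over finite classes\<close>

text \<open>The tangent inequality 1 + u \<le> exp u at u = l * f - (h + \<mu>) takes the place of
  concavity of the logarithm. The exponential of the maximum is at most the sum of exponentials, and
  the normalization by h + \<mu> makes the average of that sum at most 1.\<close>

lemma mean_Max_le:
  fixes f :: "'x \<Rightarrow> 'e \<Rightarrow> real"
  assumes S: "finite S" "S \<noteq> {}" and T: "finite T" "T \<noteq> {}"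
    and l: "l > 0" and card: "real (card T) \<le> exp h"
    and mgf: "\<And>x. x \<in> T \<Longrightarrow> mean S (\<lambda>e. exp (l * f x e)) \<le> exp \<mu>"
  shows "mean S (\<lambda>e. Max ((\<lambda>x. f x e) ` T)) \<le> (h + \<mu>) / l"
proof -
  let ?M = "\<lambda>e. Max ((\<lambda>x. f x e) ` T)"
  have "l * ?M e \<le> (h + \<mu>) + (exp (- (h + \<mu>)) * (\<Sum>x\<in>T. exp (l * f x e)) - 1)" for e
  proof -
    have "?M e \<in> (\<lambda>x. f x e) ` T" using T by (intro Max_in) auto
    then obtain x where x: "x \<in> T" "?M e = f x e" by auto
    have "1 + (l * f x e - (h + \<mu>)) \<le> exp (l * f x e - (h + \<mu>))" by (rule exp_ge_add_one_self)
    also have "\<dots> = exp (- (h + \<mu>)) * exp (l * f x e)" by (simp flip: exp_add)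
    also have "\<dots> \<le> exp (- (h + \<mu>)) * (\<Sum>x\<in>T. exp (l * f x e))"
      using x T by (intro mult_left_mono member_le_sum) auto
    finally show ?thesis using x(2) by simp
  qed
  then have "mean S (\<lambda>e. l * ?M e)
      \<le> mean S (\<lambda>e. (h + \<mu> - 1) + exp (- (h + \<mu>)) * (\<Sum>x\<in>T. exp (l * f x e)))"
    by (intro mean_mono) (simp add: algebra_simps)
  also have "\<dots> = (h + \<mu> - 1) + exp (- (h + \<mu>)) * (\<Sum>x\<in>T. mean S (\<lambda>e. exp (l * f x e)))"
    by (simp only: mean_add mean_const[OF S] mean_cmult mean_sum)
  also have "\<dots> \<le> (h + \<mu> - 1) + exp (- (h + \<mu>)) * (\<Sum>x\<in>T. exp \<mu>)"
    by (intro add_left_mono mult_left_mono sum_mono mgf) auto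
  also have "\<dots> \<le> (h + \<mu> - 1) + exp (- (h + \<mu>)) * (exp h * exp \<mu>)"
    using card by (intro add_left_mono mult_left_mono) (auto intro: mult_right_mono)
  also have "\<dots> = h + \<mu>" by (simp flip: exp_add)
  finally show ?thesis using l by (simp add: mean_cmult field_simps)
qed

text \<open>The absolute value is handled by using both signs of l. This costs a factor 2 \<le> e,
  that is, 1 more in the exponent, which h \<ge> 1 absorbs: h + 1 + h/2 \<le> 3h. The radius 0 is
  separate because l divides by it.\<close>

lemma signs_Max_le:
  fixes a :: "'x \<Rightarrow> nat \<Rightarrow> 'i \<Rightarrow> real"
  assumes I: "finite I" and T: "finite T" "T \<noteq> {}" "real (card T) \<le> exp h" and h: "h \<ge> 1"
    and R: "R \<ge> 0" "\<And>x. x \<in> T \<Longrightarrow> (\<Sum>s<n. \<Sum>i\<in>I. (a x s i)\<^sup>2) \<le> R\<^sup>2"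
  shows "mean (signs n I) (\<lambda>e. Max ((\<lambda>x. \<bar>\<Sum>s<n. \<Sum>i\<in>I. rsign (e s) i * a x s i\<bar>) ` T))
    \<le> 3 * R * sqrt h"
proof (cases "R = 0")
  case True
  have "a x s i = 0" if "x \<in> T" "s < n" "i \<in> I" for x s i
  proof -
    have "(a x s i)\<^sup>2 \<le> (\<Sum>i\<in>I. (a x s i)\<^sup>2)" using that I by (intro member_le_sum) auto
    also have "\<dots> \<le> (\<Sum>s<n. \<Sum>i\<in>I. (a x s i)\<^sup>2)"
      using that by (intro member_le_sum[where f = "\<lambda>s. \<Sum>i\<in>I. (a x s i)\<^sup>2"]) (auto intro: sum_nonneg)
    also have "\<dots> \<le> 0" using R(2)[OF that(1)] True by simp
    finally show ?thesis by simp
  qed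
  then have "mean (signs n I) (\<lambda>e. Max ((\<lambda>x. \<bar>\<Sum>s<n. \<Sum>i\<in>I. rsign (e s) i * a x s i\<bar>) ` T))
      \<le> mean (signs n I) (\<lambda>e. 0)"
    using T by (intro mean_mono) (auto simp: Max_le_iff)
  then show ?thesis using True by (simp add: mean_def)
next
  case False
  with R have R0: "R > 0" by simp
  \<comment> \<open>Balances the two terms: the variance l^2 R^2 / 2 becomes h / 2, the order of the
    entropy.\<close>
  define l where "l = sqrt h / R"
  have l: "l > 0" "l\<^sup>2 * R\<^sup>2 = h" using R0 h by (auto simp: l_def power_divide)
  let ?Z = "\<lambda>x e. \<Sum>s<n. \<Sum>i\<in>I. rsign (e s) i * a x s i"
  have mgf: "mean (signs n I) (\<lambda>e. exp (c * ?Z x e)) \<le> exp (h / 2)" if "x \<in> T" "c\<^sup>2 = l\<^sup>2" for x c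
  proof -
    have "mean (signs n I) (\<lambda>e. exp (c * ?Z x e))
       = mean (signs n I) (\<lambda>e. exp (\<Sum>s<n. \<Sum>i\<in>I. rsign (e s) i * (c * a x s i)))"
      by (simp add: sum_distrib_left mult_ac)
    also have "\<dots> \<le> exp ((\<Sum>s<n. \<Sum>i\<in>I. (c * a x s i)\<^sup>2) / 2)"
      by (rule signs_mgf[OF I])
    also have "(\<Sum>s<n. \<Sum>i\<in>I. (c * a x s i)\<^sup>2) = l\<^sup>2 * (\<Sum>s<n. \<Sum>i\<in>I. (a x s i)\<^sup>2)"
      using that by (simp add: power_mult_distrib sum_distrib_left)
    also have "exp (\<dots> / 2) \<le> exp (h / 2)"
      using mult_left_mono[OF R(2)[OF that(1)], of "l\<^sup>2"] l by simp
    finally show ?thesis .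
  qed
  have "mean (signs n I) (\<lambda>e. Max ((\<lambda>x. \<bar>?Z x e\<bar>) ` T)) \<le> (h + (1 + h / 2)) / l"
  proof (rule mean_Max_le[OF finite_signs[OF I] signs_nonempty T(1,2) l(1) T(3)])
    fix x assume x: "x \<in> T"
    have "mean (signs n I) (\<lambda>e. exp (l * \<bar>?Z x e\<bar>))
        \<le> mean (signs n I) (\<lambda>e. exp (l * ?Z x e) + exp ((- l) * ?Z x e))"
      by (intro mean_mono) (auto simp: abs_real_def)
    also have "\<dots> \<le> exp (h / 2) + exp (h / 2)"
      unfolding mean_add by (intro add_mono mgf[OF x]) auto
    also have "\<dots> \<le> exp 1 * exp (h / 2)"
      using exp_ge_add_one_self[of 1] by (simp flip: mult_2)
    finally show "mean (signs n I) (\<lambda>e. exp (l * \<bar>?Z x e\<bar>)) \<le> exp (1 + h / 2)"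
      by (simp add: exp_add)
  qed
  also have "\<dots> \<le> 3 * h / l" using h l by (intro divide_right_mono) auto
  also have "h / l = R * sqrt h"
    using R0 h by (simp add: l_def field_simps)
  then have "3 * h / l = 3 * R * sqrt h" by simp
  finally show ?thesis .
qed

section \<open>Decoupling of the off-diagonal form\<close>

text \<open>With the diagonal included, the sum would be that of the products (\<epsilon>,
  x)(\<epsilon>, y) over n sign vectors; as signs square to 1, the diagonal part is exactly n (x,
  y). What remains is n times the bilinear form of A - 1 for the random operator A.\<close>

definition offdiag :: "nat \<Rightarrow> 'i set \<Rightarrow> (nat \<Rightarrow> 'i set) \<Rightarrow> ('i \<Rightarrow> real) \<Rightarrow> ('i \<Rightarrow> real) \<Rightarrow> real" where
  "offdiag n I e x y =
     (\<Sum>s<n. \<Sum>i\<in>I. \<Sum>j\<in>I - {i}. rsign (e s) i * x i * (rsign (e s) j * y j))"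

text \<open>For disjoint \<open>D\<close> and \<open>D'\<close> the two factors use disjoint groups
  of signs, so the form is linear in either group once the other is fixed.\<close>

definition decoupled :: "nat \<Rightarrow> 'i set \<Rightarrow> 'i set \<Rightarrow> (nat \<Rightarrow> 'i set) \<Rightarrow> ('i \<Rightarrow> real) \<Rightarrow> ('i \<Rightarrow> real) \<Rightarrow> real" where
  "decoupled n D D' e x y =
     (\<Sum>s<n. (\<Sum>i\<in>D. rsign (e s) i * x i) * (\<Sum>j\<in>D'. rsign (e s) j * y j))"

lemma decoupled_commute: "decoupled n D D' e x y = decoupled n D' D e y x"
  by (simp add: decoupled_def mult.commute)

lemma mean_separating:
  assumes "finite I" "i \<in> I" "j \<in> I" "i \<noteq> j"
  shows "mean (Pow I) (\<lambda>D. if i \<in> D \<and> j \<notin> D then 1 else 0) = 1 / 4"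
proof -
  have inj: "inj_on (insert i) (Pow (I - {i, j}))" by (auto simp: inj_on_def)
  have "{D \<in> Pow I. i \<in> D \<and> j \<notin> D} = insert i ` Pow (I - {i, j})"
  proof (intro set_eqI iffI)
    fix D assume "D \<in> {D \<in> Pow I. i \<in> D \<and> j \<notin> D}"
    then show "D \<in> insert i ` Pow (I - {i, j})"
      by (intro image_eqI[of _ _ "D - {i}"]) auto
  qed (use assms in auto)
  note sets = this
  define q where "q = card (I - {i, j})"
  have "card {D \<in> Pow I. i \<in> D \<and> j \<notin> D} = 2 ^ q"
    unfolding sets card_image[OF inj] q_def using assms by (intro card_Pow) auto
  moreover have "card I = q + 2"
  proof -
    have "card (I - {i, j}) = card I - card {i, j}" using assms by (intro card_Diff_subset) auto
    moreover have "card {i, j} \<le> card I" using assms by (intro card_mono) auto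
    ultimately show ?thesis using assms by (auto simp: q_def)
  qed
  moreover have "(\<Sum>D\<in>Pow I. if i \<in> D \<and> j \<notin> D then 1 else 0)
      = real (card {D \<in> Pow I. i \<in> D \<and> j \<notin> D})"
    using assms sum.inter_filter[of "Pow I" "\<lambda>_. 1::real" "\<lambda>D. i \<in> D \<and> j \<notin> D"] by simp
  ultimately show ?thesis
    using assms by (simp add: mean_def card_Pow power_add)
qed

text \<open>A random selector: an ordered pair of distinct indices has its first member in
  \<open>D\<close> and its second outside with probability 1/4, so averaging over \<open>D\<close>
  recovers every off-diagonal term with that weight.\<close>

lemma offdiag_eq_mean_decoupled:
  assumes "finite I"
  shows "offdiag n I e x y = 4 * mean (Pow I) (\<lambda>D. decoupled n D (I - D) e x y)"
proof -
  let ?t = "\<lambda>s i j. rsign (e s) i * x i * (rsign (e s) j * y j)"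
  have "decoupled n D (I - D) e x y
      = (\<Sum>s<n. \<Sum>i\<in>I. \<Sum>j\<in>I - {i}. ?t s i j * (if i \<in> D \<and> j \<notin> D then 1 else 0))"
    if "D \<subseteq> I" for D
  proof -
    have "(\<Sum>i\<in>D. rsign (e s) i * x i) * (\<Sum>j\<in>I - D. rsign (e s) j * y j)
      = (\<Sum>i\<in>I. \<Sum>j\<in>I - {i}. ?t s i j * (if i \<in> D \<and> j \<notin> D then 1 else 0))" for s
    proof -
      have "(\<Sum>i\<in>D. rsign (e s) i * x i) * (\<Sum>j\<in>I - D. rsign (e s) j * y j)
          = (\<Sum>i\<in>D. \<Sum>j\<in>I - D. ?t s i j)" by (simp add: sum_product)
      also have "\<dots> = (\<Sum>i\<in>D. \<Sum>j\<in>I - {i}. ?t s i j * (if i \<in> D \<and> j \<notin> D then 1 else 0))"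
        using assms by (intro sum.cong refl sum.mono_neutral_cong_left) auto
      also have "\<dots> = (\<Sum>i\<in>I. \<Sum>j\<in>I - {i}. ?t s i j * (if i \<in> D \<and> j \<notin> D then 1 else 0))"
        using assms that by (intro sum.mono_neutral_left) auto
      finally show ?thesis .
    qed
    then show ?thesis by (simp add: decoupled_def)
  qed
  then have "mean (Pow I) (\<lambda>D. decoupled n D (I - D) e x y)
      = mean (Pow I) (\<lambda>D. \<Sum>s<n. \<Sum>i\<in>I. \<Sum>j\<in>I - {i}. ?t s i j * (if i \<in> D \<and> j \<notin> D then 1 else 0))"
    by (intro mean_cong) (simp only: Pow_iff)
  also have "\<dots> = (\<Sum>s<n. \<Sum>i\<in>I. \<Sum>j\<in>I - {i}. ?t s i j * (1 / 4))"
    unfolding mean_sum mean_cmult using assms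
    by (intro sum.cong refl arg_cong2[where f = "(*)"] mean_separating) auto
  also have "\<dots> = offdiag n I e x y / 4"
    by (simp add: offdiag_def sum_divide_distrib)
  finally show ?thesis by simp
qed

text \<open>Symmetric difference with \<open>h s - D\<close> reverses the signs at the points of
  \<open>h s\<close> outside \<open>D\<close>: there the old sign is multiplied by
  \<open>- rsign (h s)\<close>, on \<open>D\<close> it is kept. On \<open>signs n I\<close> the map
  is an involution.\<close>

definition flip_outside :: "nat \<Rightarrow> 'i set \<Rightarrow> (nat \<Rightarrow> 'i set) \<Rightarrow> (nat \<Rightarrow> 'i set) \<Rightarrow> nat \<Rightarrow> 'i set" where
  "flip_outside n D h e = (\<lambda>s\<in>{..<n}. sym_diff (e s) (h s - D))"

lemma sym_diff_cancel: "sym_diff (sym_diff A B) B = A"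
proof (rule set_eqI)
  show "x \<in> sym_diff (sym_diff A B) B \<longleftrightarrow> x \<in> A" for x
    by (cases "x \<in> A"; cases "x \<in> B") simp_all
qed

lemma bij_flip_outside:
  assumes "h \<in> signs n I"
  shows "bij_betw (flip_outside n D h) (signs n I) (signs n I)"
proof (rule bij_betw_byWitness[where f' = "flip_outside n D h"])
  have inv: "flip_outside n D h (flip_outside n D h e) = e" if "e \<in> signs n I" for e
  proof
    fix s
    show "flip_outside n D h (flip_outside n D h e) s = e s"
    proof (cases "s < n")
      case False
      then have "e s = undefined" using PiE_arb[OF that] by simp
      then show ?thesis using False by (simp add: flip_outside_def)
    next
      case True
      then show ?thesis
        by (simp only: flip_outside_def restrict_apply lessThan_iff if_True sym_diff_cancel)
    qed
  qed
  then show "\<forall>e\<in>signs n I. flip_outside n D h (flip_outside n D h e) = e" by blast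
  then show "\<forall>e\<in>signs n I. flip_outside n D h (flip_outside n D h e) = e" by blast
  show "flip_outside n D h ` signs n I \<subseteq> signs n I"
  proof (intro image_subsetI PiE_I)
    fix e s assume e: "e \<in> signs n I" and "s \<in> {..<n}"
    with assms have "e s \<subseteq> I" "h s \<subseteq> I" by auto
    then show "flip_outside n D h e s \<in> Pow I" using \<open>s \<in> {..<n}\<close> by (auto simp: flip_outside_def)
  qed (auto simp: flip_outside_def)
  then show "flip_outside n D h ` signs n I \<subseteq> signs n I" .
qed

lemma rsign_flip_outside:
  "s < n \<Longrightarrow> rsign (flip_outside n D h e s) i = (if i \<in> D then rsign (e s) i else - rsign (h s) i * rsign (e s) i)"
  by (cases "i \<in> e s"; cases "i \<in> h s"; cases "i \<in> D") (simp_all add: flip_outside_def rsign_def)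

text \<open>Every fixed \<open>h\<close> acts by a bijection and leaves the average unchanged, so a
  further average over \<open>h\<close> is free. With the two averages exchanged, \<open>h\<close>
  supplies fresh signs outside \<open>D\<close> while those on \<open>D\<close> stay fixed; this
  replaces conditional expectations.\<close>

lemma mean_flip_outside:
  assumes "finite I"
  shows "mean (signs n I) F = mean (signs n I) (\<lambda>e. mean (signs n I) (\<lambda>h. F (flip_outside n D h e)))"
proof -
  have "mean (signs n I) (\<lambda>e. F (flip_outside n D h e)) = mean (signs n I) F" if "h \<in> signs n I" for h
    using mean_reindex[OF bij_flip_outside[OF that]] .
  then have "mean (signs n I) (\<lambda>h. mean (signs n I) (\<lambda>e. F (flip_outside n D h e)))
      = mean (signs n I) (\<lambda>h. mean (signs n I) F)"
    by (rule mean_cong)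
  also have "\<dots> = mean (signs n I) F" using assms by (intro mean_const) auto
  finally show ?thesis
    using mean_swap[of "signs n I" "signs n I" "\<lambda>e h. F (flip_outside n D h e)"] by (simp only:)
qed


subsection \<open>The off-diagonal chaos on finite classes\<close>

text \<open>Controls the random variance that remains when the signs on \<open>D\<close> are fixed.
  Exponential integrability costs n ln 2 for the n rows and the union bound costs h; the factor 12
  bounds 4e.\<close>

lemma mean_Max_row_norm_le:
  assumes I: "finite I" and T: "finite T" "T \<noteq> {}" "real (card T) \<le> exp h" and h: "h \<ge> 1"
    and \<sigma>: "\<sigma> > 0" "\<And>x. x \<in> T \<Longrightarrow> (\<Sum>i\<in>I. (x i)\<^sup>2) \<le> \<sigma>\<^sup>2" and D: "D \<subseteq> I"
  shows "mean (signs n I) (\<lambda>e. sqrt (Max ((\<lambda>x. \<Sum>s<n. (\<Sum>i\<in>D. rsign (e s) i * x i)\<^sup>2) ` T)))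
    \<le> sqrt (12 * (n + h)) * \<sigma>"
proof -
  let ?g = "\<lambda>x e. \<Sum>s<n. (\<Sum>i\<in>D. rsign (e s) i * x i)\<^sup>2"
  let ?M = "\<lambda>e. Max ((\<lambda>x. ?g x e / \<sigma>\<^sup>2) ` T)"
  define l where "l = 1 / (4 * exp (1::real))"
  have l: "l > 0" by (simp add: l_def)
  have "mean (signs n I) ?M \<le> (h + n * ln 2) / l"
  proof (rule mean_Max_le[OF finite_signs[OF I] signs_nonempty T(1,2) l T(3)])
    fix x assume x: "x \<in> T"
    define a where "a i = (if i \<in> D then x i / \<sigma> else 0)" for i
    have "(\<Sum>i\<in>I. (a i)\<^sup>2) \<le> (\<Sum>i\<in>I. (x i)\<^sup>2 / \<sigma>\<^sup>2)"
      by (intro sum_mono) (auto simp: a_def power_divide)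
    also have "\<dots> = (\<Sum>i\<in>I. (x i)\<^sup>2) / \<sigma>\<^sup>2" by (simp add: sum_divide_distrib)
    also have "\<dots> \<le> 1" using \<sigma>(2)[OF x] \<sigma>(1) by simp
    finally have a: "(\<Sum>i\<in>I. (a i)\<^sup>2) \<le> 1" .
    have row: "(\<Sum>i\<in>I. rsign (e s) i * a i) = (\<Sum>i\<in>D. rsign (e s) i * x i) / \<sigma>" for e s
    proof -
      have "(\<Sum>i\<in>I. rsign (e s) i * a i) = (\<Sum>i\<in>D. rsign (e s) i * a i)"
        using I D by (intro sum.mono_neutral_right) (auto simp: a_def)
      then show ?thesis by (simp add: a_def sum_divide_distrib)
    qed
    have eq: "l * (?g x e / \<sigma>\<^sup>2) = (\<Sum>s<n. (\<Sum>i\<in>I. rsign (e s) i * a i)\<^sup>2) / (4 * exp 1)" for e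
      unfolding row power_divide sum_divide_distrib[symmetric] l_def by simp
    have "mean (signs n I) (\<lambda>e. exp (l * (?g x e / \<sigma>\<^sup>2))) \<le> 2 ^ n"
      unfolding eq by (rule signs_exp_square_le[OF I a])
    also have "2 ^ n = exp (n * ln 2)" by (simp add: exp_of_nat_mult)
    finally show "mean (signs n I) (\<lambda>e. exp (l * (?g x e / \<sigma>\<^sup>2))) \<le> exp (n * ln 2)" .
  qed
  also have "(h + n * ln 2) / l = 4 * exp 1 * (h + n * ln 2)" by (simp add: l_def)
  also have "\<dots> \<le> 12 * (n + h)"
  proof (intro mult_mono)
    show "4 * exp 1 \<le> (12::real)" using exp_le by simp
    show "h + n * ln 2 \<le> n + h" using ln_2_less_1 by (simp add: mult_left_le)
  qed (use h in auto)
  finally have M: "mean (signs n I) ?M \<le> 12 * (n + h)" .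
  \<comment> \<open>\<tau>^2 is the bound just obtained for the mean of \<open>?M\<close>. The
    inequality sqrt M \<le> (M / \<tau> + \<tau>) / 2 is sharp at M = \<tau>^2 and plays the part of
    Jensen's inequality for the square root.\<close>
  define \<tau> where "\<tau> = sqrt (12 * (n + h))"
  have \<tau>: "\<tau> > 0" "\<tau>\<^sup>2 = 12 * (n + h)" using h by (auto simp: \<tau>_def)
  have "sqrt (Max ((\<lambda>x. ?g x e) ` T)) \<le> (\<sigma> / (2 * \<tau>)) * ?M e + \<sigma> * \<tau> / 2" for e
  proof -
    have "?M e \<in> (\<lambda>x. ?g x e / \<sigma>\<^sup>2) ` T" using T by (intro Max_in) auto
    then have M0: "?M e \<ge> 0" using \<sigma>(1) by (auto intro!: sum_nonneg divide_nonneg_nonneg)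
    have "Max ((\<lambda>x. ?g x e) ` T) \<le> \<sigma>\<^sup>2 * ?M e"
    proof (subst Max_le_iff)
      show "\<forall>a\<in>(\<lambda>x. ?g x e) ` T. a \<le> \<sigma>\<^sup>2 * ?M e"
      proof safe
        fix x assume "x \<in> T"
        then have "?g x e / \<sigma>\<^sup>2 \<le> ?M e" using T by (intro Max_ge) auto
        then show "?g x e \<le> \<sigma>\<^sup>2 * ?M e" using \<sigma>(1) by (simp add: field_simps)
      qed
    qed (use T in auto)
    then have "sqrt (Max ((\<lambda>x. ?g x e) ` T)) \<le> sqrt (\<sigma>\<^sup>2 * ?M e)" by (rule real_sqrt_le_mono)
    also have "\<dots> = \<sigma> * sqrt (?M e)" using \<sigma>(1) by (simp add: real_sqrt_mult)
    also have "sqrt (?M e) \<le> (?M e / \<tau> + \<tau>) / 2"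
    proof -
      have "2 * sqrt (?M e) * \<tau> \<le> ?M e + \<tau>\<^sup>2"
        using sum_squares_bound[of "sqrt (?M e)" \<tau>] M0 by simp
      then show ?thesis using \<tau>(1) by (simp add: field_simps power2_eq_square)
    qed
    finally show ?thesis using \<sigma>(1) by (simp add: algebra_simps add_divide_distrib)
  qed
  then have "mean (signs n I) (\<lambda>e. sqrt (Max ((\<lambda>x. ?g x e) ` T)))
     \<le> mean (signs n I) (\<lambda>e. (\<sigma> / (2 * \<tau>)) * ?M e + \<sigma> * \<tau> / 2)"
    by (rule mean_mono)
  also have "\<dots> = (\<sigma> / (2 * \<tau>)) * mean (signs n I) ?M + \<sigma> * \<tau> / 2"
    by (simp only: mean_add mean_cmult mean_const[OF finite_signs[OF I] signs_nonempty])
  also have "\<dots> \<le> (\<sigma> / (2 * \<tau>)) * \<tau>\<^sup>2 + \<sigma> * \<tau> / 2"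
    using M \<sigma>(1) \<tau> by (intro add_right_mono mult_left_mono) auto
  also have "\<dots> = \<tau> * \<sigma>" using \<tau>(1) by (simp add: power2_eq_square)
  finally show ?thesis by (simp add: \<tau>_def)
qed

text \<open>For fixed signs on \<open>D\<close> the form is a Rademacher sum in the signs outside \<open>D\<close>;
  resampling the latter separates the two sources of randomness.\<close>

lemma mean_Max_decoupled_le:
  assumes I: "finite I"
    and T: "finite T" "T \<noteq> {}" "real (card T) \<le> exp h" "h \<ge> 1"
    and T': "finite T'" "T' \<noteq> {}" "real (card T') \<le> exp h'" "h' \<ge> 1"
    and \<sigma>: "\<sigma> > 0" "\<And>x. x \<in> T \<Longrightarrow> (\<Sum>i\<in>I. (x i)\<^sup>2) \<le> \<sigma>\<^sup>2"
    and \<sigma>': "\<sigma>' > 0" "\<And>x. x \<in> T' \<Longrightarrow> (\<Sum>i\<in>I. (x i)\<^sup>2) \<le> \<sigma>'\<^sup>2"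
    and D: "D \<subseteq> I"
  shows "mean (signs n I) (\<lambda>e. Max ((\<lambda>(x, y). \<bar>decoupled n D (I - D) e x y\<bar>) ` (T \<times> T')))
    \<le> 12 * \<sigma> * \<sigma>' * sqrt ((n + h) * (h + h'))"
proof -
  let ?F = "\<lambda>e. Max ((\<lambda>(x, y). \<bar>decoupled n D (I - D) e x y\<bar>) ` (T \<times> T'))"
  let ?g = "\<lambda>x e s. \<Sum>i\<in>D. rsign (e s) i * x i"
  let ?G = "\<lambda>e. sqrt (Max ((\<lambda>x. \<Sum>s<n. (?g x e s)\<^sup>2) ` T))"
  have inner: "mean (signs n I) (\<lambda>\<eta>. ?F (flip_outside n D \<eta> e)) \<le> (3 * \<sigma>' * sqrt (h + h')) * ?G e" for e
  proof -
    \<comment> \<open>Coefficients of the fresh signs. They vanish on \<open>D\<close>, where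
      nothing is resampled; the minus sign comes from \<open>rsign_flip_outside\<close>.\<close>
    define a where "a = (\<lambda>(x, y) s j. if j \<in> D then 0 else - (?g x e s * (rsign (e s) j * y j)))"
    have "decoupled n D (I - D) (flip_outside n D \<eta> e) x y
        = (\<Sum>s<n. \<Sum>j\<in>I. rsign (\<eta> s) j * a (x, y) s j)" for \<eta> x y
      unfolding decoupled_def
    proof (intro sum.cong refl)
      fix s assume "s \<in> {..<n}"
      then have s: "s < n" by simp
      have "(\<Sum>j\<in>I. rsign (\<eta> s) j * a (x, y) s j) = (\<Sum>j\<in>I - D. rsign (\<eta> s) j * a (x, y) s j)"
        using I by (intro sum.mono_neutral_right) (auto simp: a_def)
      also have "\<dots> = (\<Sum>j\<in>I - D. ?g x e s * (- rsign (\<eta> s) j * rsign (e s) j * y j))"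
        by (intro sum.cong) (auto simp: a_def)
      also have "\<dots> = ?g x e s * (\<Sum>j\<in>I - D. rsign (flip_outside n D \<eta> e s) j * y j)"
        unfolding sum_distrib_left[symmetric] by (intro arg_cong2[where f = "(*)"] sum.cong)
          (auto simp: rsign_flip_outside[OF s])
      also have "?g x e s = (\<Sum>i\<in>D. rsign (flip_outside n D \<eta> e s) i * x i)"
        by (intro sum.cong) (auto simp: rsign_flip_outside[OF s])
      finally show "(\<Sum>i\<in>D. rsign (flip_outside n D \<eta> e s) i * x i)
          * (\<Sum>j\<in>I - D. rsign (flip_outside n D \<eta> e s) j * y j)
        = (\<Sum>j\<in>I. rsign (\<eta> s) j * a (x, y) s j)" by simp
    qed
    then have "mean (signs n I) (\<lambda>\<eta>. ?F (flip_outside n D \<eta> e))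
        = mean (signs n I) (\<lambda>\<eta>. Max ((\<lambda>z. \<bar>\<Sum>s<n. \<Sum>j\<in>I. rsign (\<eta> s) j * a z s j\<bar>) ` (T \<times> T')))"
      by (simp add: case_prod_unfold)
    \<comment> \<open>For fixed \<open>e\<close> this is a Rademacher maximum over at most exp (h +
      h') pairs; its radius \<open>?G e * \<sigma>'\<close> still depends on the signs on
      \<open>D\<close>.\<close>
    also have "\<dots> \<le> 3 * (?G e * \<sigma>') * sqrt (h + h')"
    proof (rule signs_Max_le[OF I])
      have "real (card (T \<times> T')) \<le> exp h * exp h'"
        using T T' by (simp add: card_cartesian_product) (intro mult_mono, auto)
      then show "real (card (T \<times> T')) \<le> exp (h + h')" by (simp add: exp_add)
      have "Max ((\<lambda>x. \<Sum>s<n. (?g x e s)\<^sup>2) ` T) \<in> (\<lambda>x. \<Sum>s<n. (?g x e s)\<^sup>2) ` T"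
        using T by (intro Max_in) auto
      then have M0: "Max ((\<lambda>x. \<Sum>s<n. (?g x e s)\<^sup>2) ` T) \<ge> 0" by (auto intro!: sum_nonneg)
      then show "?G e * \<sigma>' \<ge> 0" using \<sigma>' by auto
      fix z assume "z \<in> T \<times> T'"
      then obtain x y where z: "z = (x, y)" "x \<in> T" "y \<in> T'" by auto
      have "(\<Sum>j\<in>I. (a z s j)\<^sup>2) \<le> (?g x e s)\<^sup>2 * \<sigma>'\<^sup>2" for s
      proof -
        have "(\<Sum>j\<in>I. (a z s j)\<^sup>2) \<le> (\<Sum>j\<in>I. (?g x e s)\<^sup>2 * (y j)\<^sup>2)"
          by (intro sum_mono) (auto simp: a_def z power_mult_distrib rsign_def)
        also have "\<dots> = (?g x e s)\<^sup>2 * (\<Sum>j\<in>I. (y j)\<^sup>2)" by (simp add: sum_distrib_left)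
        also have "\<dots> \<le> (?g x e s)\<^sup>2 * \<sigma>'\<^sup>2" using \<sigma>'(2)[OF z(3)] by (intro mult_left_mono) auto
        finally show ?thesis .
      qed
      then have "(\<Sum>s<n. \<Sum>j\<in>I. (a z s j)\<^sup>2) \<le> (\<Sum>s<n. (?g x e s)\<^sup>2 * \<sigma>'\<^sup>2)" by (intro sum_mono)
      also have "\<dots> = (\<Sum>s<n. (?g x e s)\<^sup>2) * \<sigma>'\<^sup>2" by (simp add: sum_distrib_right)
      also have "\<dots> \<le> Max ((\<lambda>x. \<Sum>s<n. (?g x e s)\<^sup>2) ` T) * \<sigma>'\<^sup>2"
        using T z by (intro mult_right_mono Max_ge) auto
      also have "\<dots> = (?G e * \<sigma>')\<^sup>2" using M0 by (simp add: power_mult_distrib)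
      finally show "(\<Sum>s<n. \<Sum>j\<in>I. (a z s j)\<^sup>2) \<le> (?G e * \<sigma>')\<^sup>2" .
    qed (use T T' in auto)
    finally show ?thesis by (simp add: mult_ac)
  qed
  have "mean (signs n I) ?F \<le> mean (signs n I) (\<lambda>e. (3 * \<sigma>' * sqrt (h + h')) * ?G e)"
    by (subst mean_flip_outside[OF I, of _ _ D]) (intro mean_mono inner)
  also have "\<dots> = (3 * \<sigma>' * sqrt (h + h')) * mean (signs n I) ?G" by (rule mean_cmult)
  also have "\<dots> \<le> (3 * \<sigma>' * sqrt (h + h')) * (sqrt (12 * (n + h)) * \<sigma>)"
    using mean_Max_row_norm_le[OF I T \<sigma> D] T T' \<sigma>' by (intro mult_left_mono) auto
  also have "\<dots> \<le> (3 * \<sigma>' * sqrt (h + h')) * (4 * sqrt (n + h) * \<sigma>)"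
  proof (intro mult_left_mono mult_right_mono)
    have "sqrt (12 * (n + h)) \<le> sqrt (4\<^sup>2 * (n + h))" using T by (intro real_sqrt_le_mono) auto
    then show "sqrt (12 * (n + h)) \<le> 4 * sqrt (n + h)"
      by (simp only: real_sqrt_mult[of "4\<^sup>2"] real_sqrt_abs abs_numeral)
  qed (use \<sigma> \<sigma>' T T' in auto)
  also have "\<dots> = 12 * \<sigma> * \<sigma>' * sqrt ((n + h) * (h + h'))" by (simp add: real_sqrt_mult)
  finally show ?thesis .
qed

text \<open>The product contains the term h^2, and h \<le> h' is what turns it into h h'. With the
  roles exchanged the square of the larger entropy would survive, too large for the later
  sums.\<close>

lemma sqrt_split_le:
  assumes "1 \<le> h" "h \<le> h'" "N \<ge> 0"
  shows "sqrt ((N + h) * (h + h')) \<le> 2 * (sqrt N * (sqrt h + sqrt h') + sqrt h * sqrt h')"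
proof -
  have "sqrt ((N + h) * (h + h')) \<le> sqrt (4 * (N * h' + h * h'))"
    using assms by (intro real_sqrt_le_mono) (simp add: algebra_simps mult_mono add_mono)
  also have "\<dots> = 2 * sqrt (N * h' + h * h')" by (simp only: real_sqrt_mult[of 4] real_sqrt_four)
  also have "\<dots> \<le> 2 * (sqrt (N * h') + sqrt (h * h'))"
    using assms by (intro mult_left_mono sqrt_add_le_add_sqrt) auto
  also have "\<dots> \<le> 2 * (sqrt N * (sqrt h + sqrt h') + sqrt h * sqrt h')"
    using assms by (simp add: real_sqrt_mult algebra_simps)
  finally show ?thesis .
qed

lemma image_pair_swap: "(\<lambda>(x, y). f x y) ` (T \<times> T') = (\<lambda>(y, x). f x y) ` (T' \<times> T)"
  by force

text \<open>The decoupled estimate is not symmetric in the two classes, so the class of smaller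
  entropy is paired with the fixed signs; if necessary \<open>D\<close> is replaced by its
  complement and the arguments are exchanged. The constant is 96 = 4 * 12 * 2, from decoupling, the
  decoupled maximum and \<open>sqrt_split_le\<close>.\<close>

lemma mean_Max_offdiag_le:
  assumes I: "finite I"
    and T: "finite T" "T \<noteq> {}" "real (card T) \<le> exp h" "h \<ge> 1"
    and T': "finite T'" "T' \<noteq> {}" "real (card T') \<le> exp h'" "h' \<ge> 1"
    and \<sigma>: "\<sigma> > 0" "\<And>x. x \<in> T \<Longrightarrow> (\<Sum>i\<in>I. (x i)\<^sup>2) \<le> \<sigma>\<^sup>2"
    and \<sigma>': "\<sigma>' > 0" "\<And>x. x \<in> T' \<Longrightarrow> (\<Sum>i\<in>I. (x i)\<^sup>2) \<le> \<sigma>'\<^sup>2"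
  shows "mean (signs n I) (\<lambda>e. Max ((\<lambda>(x, y). \<bar>offdiag n I e x y\<bar>) ` (T \<times> T')))
    \<le> 96 * \<sigma> * \<sigma>' * (sqrt n * (sqrt h + sqrt h') + sqrt h * sqrt h')" (is "_ \<le> ?B")
proof -
  let ?F = "\<lambda>D e. Max ((\<lambda>(x, y). \<bar>decoupled n D (I - D) e x y\<bar>) ` (T \<times> T'))"
  have F: "mean (signs n I) (?F D) \<le> ?B / 4" if D: "D \<subseteq> I" for D
  proof (cases "h \<le> h'")
    case True
    have "mean (signs n I) (?F D) \<le> 12 * \<sigma> * \<sigma>' * sqrt ((n + h) * (h + h'))"
      by (rule mean_Max_decoupled_le[OF I T T' \<sigma> \<sigma>' D])
    also have "\<dots> \<le> 12 * \<sigma> * \<sigma>' * (2 * (sqrt n * (sqrt h + sqrt h') + sqrt h * sqrt h'))"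
      using \<sigma>(1) \<sigma>'(1) T True by (intro mult_left_mono sqrt_split_le) auto
    finally show ?thesis by (simp only: mult_ac)
  next
    case False
    have "I - (I - D) = D" using D by blast
    then have "\<bar>decoupled n (I - D) (I - (I - D)) e y x\<bar> = \<bar>decoupled n D (I - D) e x y\<bar>" for e x y
      by (simp only: decoupled_commute)
    then have "(\<lambda>(x, y). \<bar>decoupled n D (I - D) e x y\<bar>) ` (T \<times> T')
        = (\<lambda>(y, x). \<bar>decoupled n (I - D) (I - (I - D)) e y x\<bar>) ` (T' \<times> T)" for e
      by (subst image_pair_swap) (simp only:)
    then have "mean (signs n I) (?F D)
        = mean (signs n I) (\<lambda>e. Max ((\<lambda>(y, x). \<bar>decoupled n (I - D) (I - (I - D)) e y x\<bar>) ` (T' \<times> T)))"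
      by (simp only:)
    also have "\<dots> \<le> 12 * \<sigma>' * \<sigma> * sqrt ((n + h') * (h' + h))"
      by (rule mean_Max_decoupled_le[OF I T' T \<sigma>' \<sigma>]) auto
    also have "\<dots> \<le> 12 * \<sigma>' * \<sigma> * (2 * (sqrt n * (sqrt h' + sqrt h) + sqrt h' * sqrt h))"
      using \<sigma>(1) \<sigma>'(1) T' False by (intro mult_left_mono sqrt_split_le) auto
    also have "\<dots> = ?B / 4" by (simp add: algebra_simps)
    finally show ?thesis .
  qed
  have "Max ((\<lambda>(x, y). \<bar>offdiag n I e x y\<bar>) ` (T \<times> T')) \<le> 4 * mean (Pow I) (\<lambda>D. ?F D e)" for e
  proof (subst Max_le_iff)
    show "\<forall>a\<in>(\<lambda>(x, y). \<bar>offdiag n I e x y\<bar>) ` (T \<times> T'). a \<le> 4 * mean (Pow I) (\<lambda>D. ?F D e)"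
    proof safe
      fix x y assume xy: "x \<in> T" "y \<in> T'"
      have "\<bar>mean (Pow I) (\<lambda>D. decoupled n D (I - D) e x y)\<bar>
          \<le> mean (Pow I) (\<lambda>D. \<bar>decoupled n D (I - D) e x y\<bar>)"
        by (simp add: mean_def divide_right_mono sum_abs)
      also have "\<dots> \<le> mean (Pow I) (\<lambda>D. ?F D e)"
        using xy T T' by (intro mean_mono Max_ge) auto
      finally show "\<bar>offdiag n I e x y\<bar> \<le> 4 * mean (Pow I) (\<lambda>D. ?F D e)"
        by (simp add: offdiag_eq_mean_decoupled[OF I])
    qed
  qed (use T T' in auto)
  then have "mean (signs n I) (\<lambda>e. Max ((\<lambda>(x, y). \<bar>offdiag n I e x y\<bar>) ` (T \<times> T')))
      \<le> mean (signs n I) (\<lambda>e. 4 * mean (Pow I) (\<lambda>D. ?F D e))"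
    by (rule mean_mono)
  also have "\<dots> = 4 * mean (Pow I) (\<lambda>D. mean (signs n I) (?F D))"
    by (subst mean_swap) (rule mean_cmult)
  also have "\<dots> \<le> 4 * mean (Pow I) (\<lambda>D. ?B / 4)"
    by (intro mult_left_mono mean_mono F) auto
  also have "\<dots> = ?B" using I by (subst mean_const) auto
  finally show ?thesis .
qed

text \<open>One sign pattern must serve all pairs of classes, so the average is taken of the sum of
  all maxima, and \<open>M\<close> holds the maxima at an outcome where this sum does not exceed its
  mean. Single entries of \<open>M\<close> are not estimated; bilinear decompositions only need the
  sum.\<close>

lemma ex_signs_offdiag_le:
  fixes T :: "'a \<Rightarrow> ('i \<Rightarrow> real) set" and \<sigma> h :: "'a \<Rightarrow> real"
  assumes I: "finite I"
    and T: "\<And>a. a \<in> \<Lambda> \<Longrightarrow> finite (T a)" "\<And>a. a \<in> \<Lambda> \<Longrightarrow> T a \<noteq> {}"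
      "\<And>a. a \<in> \<Lambda> \<Longrightarrow> real (card (T a)) \<le> exp (h a)" "\<And>a. a \<in> \<Lambda> \<Longrightarrow> h a \<ge> 1"
    and \<sigma>: "\<And>a. a \<in> \<Lambda> \<Longrightarrow> \<sigma> a > 0"
      "\<And>a x. a \<in> \<Lambda> \<Longrightarrow> x \<in> T a \<Longrightarrow> (\<Sum>i\<in>I. (x i)\<^sup>2) \<le> (\<sigma> a)\<^sup>2"
  shows "\<exists>e\<in>signs n I. \<exists>M.
    (\<forall>a\<in>\<Lambda>. \<forall>b\<in>\<Lambda>. \<forall>x\<in>T a. \<forall>y\<in>T b. \<bar>offdiag n I e x y\<bar> \<le> M a b) \<and>
    (\<Sum>a\<in>\<Lambda>. \<Sum>b\<in>\<Lambda>. M a b) \<le> 96 * (2 * sqrt n * (\<Sum>a\<in>\<Lambda>. \<sigma> a) * (\<Sum>a\<in>\<Lambda>. \<sigma> a * sqrt (h a))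
        + (\<Sum>a\<in>\<Lambda>. \<sigma> a * sqrt (h a))\<^sup>2)"
proof -
  let ?M = "\<lambda>e a b. Max ((\<lambda>(x, y). \<bar>offdiag n I e x y\<bar>) ` (T a \<times> T b))"
  let ?S = "\<Sum>a\<in>\<Lambda>. \<sigma> a" and ?G = "\<Sum>a\<in>\<Lambda>. \<sigma> a * sqrt (h a)"
  obtain e where e: "e \<in> signs n I"
    "(\<Sum>a\<in>\<Lambda>. \<Sum>b\<in>\<Lambda>. ?M e a b) \<le> mean (signs n I) (\<lambda>e. \<Sum>a\<in>\<Lambda>. \<Sum>b\<in>\<Lambda>. ?M e a b)"
    by (rule mean_attained[OF finite_signs[OF I] signs_nonempty,
        where f = "\<lambda>e. \<Sum>a\<in>\<Lambda>. \<Sum>b\<in>\<Lambda>. ?M e a b"])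
  have double: "(\<Sum>a\<in>\<Lambda>. \<Sum>b\<in>\<Lambda>. c * (u a * v b)) = c * (sum u \<Lambda> * sum v \<Lambda>)" for c and u v :: "'a \<Rightarrow> real"
    by (simp only: sum_product sum_distrib_left[symmetric])
  note e(2)
  also have "mean (signs n I) (\<lambda>e. \<Sum>a\<in>\<Lambda>. \<Sum>b\<in>\<Lambda>. ?M e a b)
      = (\<Sum>a\<in>\<Lambda>. \<Sum>b\<in>\<Lambda>. mean (signs n I) (\<lambda>e. ?M e a b))" by (simp only: mean_sum)
  also have "\<dots> \<le> (\<Sum>a\<in>\<Lambda>. \<Sum>b\<in>\<Lambda>. 96 * \<sigma> a * \<sigma> b *
      (sqrt n * (sqrt (h a) + sqrt (h b)) + sqrt (h a) * sqrt (h b)))"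
    by (intro sum_mono mean_Max_offdiag_le I T \<sigma>)
  also have "\<dots> = (\<Sum>a\<in>\<Lambda>. \<Sum>b\<in>\<Lambda>. 96 * sqrt n * ((\<sigma> a * sqrt (h a)) * \<sigma> b)
      + 96 * sqrt n * (\<sigma> a * (\<sigma> b * sqrt (h b))) + 96 * ((\<sigma> a * sqrt (h a)) * (\<sigma> b * sqrt (h b))))"
    by (intro sum.cong refl) (simp add: algebra_simps)
  also have "\<dots> = 96 * sqrt n * (?G * ?S) + 96 * sqrt n * (?S * ?G) + 96 * (?G * ?G)"
    by (simp only: sum.distrib double)
  also have "\<dots> = 96 * (2 * sqrt n * ?S * ?G + ?G\<^sup>2)"
    by (simp add: algebra_simps power2_eq_square)
  finally have "(\<Sum>a\<in>\<Lambda>. \<Sum>b\<in>\<Lambda>. ?M e a b) \<le> 96 * (2 * sqrt n * ?S * ?G + ?G\<^sup>2)" .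
  moreover have "\<forall>a\<in>\<Lambda>. \<forall>b\<in>\<Lambda>. \<forall>x\<in>T a. \<forall>y\<in>T b. \<bar>offdiag n I e x y\<bar> \<le> ?M e a b"
    using T by (intro ballI Max_ge) auto
  ultimately show ?thesis using e(1) by (intro bexI[of _ e] exI[of _ "?M e"] conjI)
qed


subsection \<open>Decomposition into atoms\<close>

text \<open>A Dudley-type decomposition of the body \<open>B\<close>: every point of \<open>B\<close> is dominated coordinatewise
  by a sum of atoms, one from each sign-symmetric class \<open>U a\<close>, where \<open>h a\<close> bounds the entropy of the class.\<close>

definition atomic_dec ::
    "('i \<Rightarrow> real) set \<Rightarrow> 'i set \<Rightarrow> 'a set \<Rightarrow> ('a \<Rightarrow> ('i \<Rightarrow> real) set) \<Rightarrow> ('a \<Rightarrow> real) \<Rightarrow> ('a \<Rightarrow> real) \<Rightarrow> bool" where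
  "atomic_dec B I \<Lambda> U \<sigma> h \<longleftrightarrow>
     (\<forall>a\<in>\<Lambda>. finite (U a) \<and> U a \<noteq> {} \<and> real (card (U a)) \<le> exp (h a) \<and> 1 \<le> h a \<and> 0 < \<sigma> a) \<and>
     (\<forall>a\<in>\<Lambda>. \<forall>u\<in>U a. (\<Sum>i\<in>I. (u i)\<^sup>2) \<le> (\<sigma> a)\<^sup>2 \<and> real (card {i \<in> I. u i \<noteq> 0}) \<le> h a) \<and>
     (\<forall>a\<in>\<Lambda>. \<forall>u\<in>U a. \<forall>s. (\<forall>i\<in>I. \<bar>s i\<bar> = 1) \<longrightarrow> (\<exists>v\<in>U a. \<forall>i\<in>I. v i = s i * u i)) \<and>
     (\<forall>x\<in>B. \<exists>u. (\<forall>a\<in>\<Lambda>. u a \<in> U a) \<and> (\<forall>i\<in>I. \<bar>x i\<bar> \<le> (\<Sum>a\<in>\<Lambda>. u a i)))"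

text \<open>Sign symmetry of the classes turns coordinatewise domination into a bound for
  functionals: the sign of \<open>c i\<close> is moved into the atom, so that \<bar>c i\<bar> never
  has to appear in the conclusion.\<close>

lemma atomic_dec_linear:
  assumes dec: "atomic_dec B I \<Lambda> U \<sigma> h" and x: "x \<in> B"
  shows "\<exists>u. (\<forall>a\<in>\<Lambda>. u a \<in> U a) \<and> \<bar>\<Sum>i\<in>I. c i * x i\<bar> \<le> (\<Sum>a\<in>\<Lambda>. \<Sum>i\<in>I. c i * u a i)"
proof -
  define s where "s i = (if c i < 0 then -1 else 1 :: real)" for i
  obtain v where v: "\<forall>a\<in>\<Lambda>. v a \<in> U a" "\<forall>i\<in>I. \<bar>x i\<bar> \<le> (\<Sum>a\<in>\<Lambda>. v a i)"
    using dec x unfolding atomic_dec_def by blast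
  have "\<forall>a\<in>\<Lambda>. \<exists>w\<in>U a. \<forall>i\<in>I. w i = s i * v a i"
  proof
    fix a assume a: "a \<in> \<Lambda>"
    have "\<forall>u\<in>U a. \<forall>s. (\<forall>i\<in>I. \<bar>s i\<bar> = 1) \<longrightarrow> (\<exists>v\<in>U a. \<forall>i\<in>I. v i = s i * u i)"
      using dec a unfolding atomic_dec_def by blast
    moreover have "\<forall>i\<in>I. \<bar>s i\<bar> = 1" by (simp add: s_def)
    ultimately show "\<exists>w\<in>U a. \<forall>i\<in>I. w i = s i * v a i" using v a by blast
  qed
  then obtain u where u: "\<forall>a\<in>\<Lambda>. u a \<in> U a \<and> (\<forall>i\<in>I. u a i = s i * v a i)"
    by (auto simp: Bex_def dest!: bchoice)
  have "\<bar>\<Sum>i\<in>I. c i * x i\<bar> \<le> (\<Sum>i\<in>I. \<bar>c i * x i\<bar>)" by (rule sum_abs)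
  also have "\<dots> \<le> (\<Sum>i\<in>I. \<bar>c i\<bar> * (\<Sum>a\<in>\<Lambda>. v a i))"
    using v by (intro sum_mono) (simp add: abs_mult mult_left_mono)
  also have "\<dots> = (\<Sum>a\<in>\<Lambda>. \<Sum>i\<in>I. c i * (s i * v a i))"
  proof -
    have "c i * (s i * t) = \<bar>c i\<bar> * t" for i t by (simp add: s_def)
    then show ?thesis by (subst sum.swap) (simp only: sum_distrib_left)
  qed
  also have "\<dots> = (\<Sum>a\<in>\<Lambda>. \<Sum>i\<in>I. c i * u a i)" using u by (intro sum.cong) auto
  finally show ?thesis using u by blast
qed

lemma offdiag_commute:
  assumes "finite I"
  shows "offdiag n I e x y = offdiag n I e y x"
proof -
  have "(\<Sum>i\<in>I. \<Sum>j\<in>I - {i}. t i j) = (\<Sum>j\<in>I. \<Sum>i\<in>I - {j}. t i j)" for t :: "'a \<Rightarrow> 'a \<Rightarrow> real"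
  proof -
    have "(\<Sum>i\<in>I. \<Sum>j\<in>I - {i}. t i j) = (\<Sum>i\<in>I. \<Sum>j\<in>I. if i = j then 0 else t i j)"
      using assms by (intro sum.cong refl sum.mono_neutral_cong_left) auto
    also have "\<dots> = (\<Sum>j\<in>I. \<Sum>i\<in>I. if i = j then 0 else t i j)" by (rule sum.swap)
    also have "\<dots> = (\<Sum>j\<in>I. \<Sum>i\<in>I - {j}. t i j)"
      using assms by (intro sum.cong refl sum.mono_neutral_cong_right) auto
    finally show ?thesis .
  qed
  note swap = this
  show ?thesis unfolding offdiag_def
    by (rule sum.cong[OF refl], subst swap) (intro sum.cong refl mult.commute)
qed

lemma offdiag_linear:
  "offdiag n I e x y = (\<Sum>i\<in>I. (\<Sum>s<n. \<Sum>j\<in>I - {i}. rsign (e s) i * (rsign (e s) j * y j)) * x i)"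
  unfolding offdiag_def sum_distrib_right
  by (subst sum.swap) (intro sum.cong refl, simp add: mult_ac)

text \<open>One argument is decomposed at a time: y with x held fixed, and x anew against each atom
  of y. The atoms of x may therefore depend on the atom of y, which is harmless because
  \<open>M a b\<close> bounds the form for every pair of atoms from the two classes.\<close>

lemma ex_signs_offdiag_le_dec:
  assumes I: "finite I" and dec: "atomic_dec B I \<Lambda> U \<sigma> h"
  shows "\<exists>e\<in>signs n I. \<forall>x\<in>B. \<forall>y\<in>B. \<bar>offdiag n I e x y\<bar>
      \<le> 96 * (2 * sqrt n * (\<Sum>a\<in>\<Lambda>. \<sigma> a) * (\<Sum>a\<in>\<Lambda>. \<sigma> a * sqrt (h a)) + (\<Sum>a\<in>\<Lambda>. \<sigma> a * sqrt (h a))\<^sup>2)"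
proof -
  have d: "\<And>a. a \<in> \<Lambda> \<Longrightarrow> finite (U a)" "\<And>a. a \<in> \<Lambda> \<Longrightarrow> U a \<noteq> {}"
      "\<And>a. a \<in> \<Lambda> \<Longrightarrow> real (card (U a)) \<le> exp (h a)" "\<And>a. a \<in> \<Lambda> \<Longrightarrow> h a \<ge> 1"
      "\<And>a. a \<in> \<Lambda> \<Longrightarrow> \<sigma> a > 0"
      "\<And>a x. a \<in> \<Lambda> \<Longrightarrow> x \<in> U a \<Longrightarrow> (\<Sum>i\<in>I. (x i)\<^sup>2) \<le> (\<sigma> a)\<^sup>2"
    using dec by (simp_all add: atomic_dec_def)
  obtain e M where e: "e \<in> signs n I"
    and M: "\<And>a b x y. a \<in> \<Lambda> \<Longrightarrow> b \<in> \<Lambda> \<Longrightarrow> x \<in> U a \<Longrightarrow> y \<in> U b \<Longrightarrow> \<bar>offdiag n I e x y\<bar> \<le> M a b"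
    and le: "(\<Sum>a\<in>\<Lambda>. \<Sum>b\<in>\<Lambda>. M a b) \<le> 96 * (2 * sqrt n * (\<Sum>a\<in>\<Lambda>. \<sigma> a) * (\<Sum>a\<in>\<Lambda>. \<sigma> a * sqrt (h a))
        + (\<Sum>a\<in>\<Lambda>. \<sigma> a * sqrt (h a))\<^sup>2)"
    using ex_signs_offdiag_le[of I \<Lambda> U h \<sigma> n, OF I d] by blast
  have lin: "\<exists>u. (\<forall>a\<in>\<Lambda>. u a \<in> U a) \<and> \<bar>offdiag n I e x y\<bar> \<le> (\<Sum>a\<in>\<Lambda>. \<bar>offdiag n I e (u a) y\<bar>)"
    if x: "x \<in> B" for x y
  proof -
    have "\<exists>u. (\<forall>a\<in>\<Lambda>. u a \<in> U a) \<and> \<bar>offdiag n I e x y\<bar> \<le> (\<Sum>a\<in>\<Lambda>. offdiag n I e (u a) y)"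
      unfolding offdiag_linear by (rule atomic_dec_linear[OF dec x])
    then obtain u where u: "\<forall>a\<in>\<Lambda>. u a \<in> U a"
      "\<bar>offdiag n I e x y\<bar> \<le> (\<Sum>a\<in>\<Lambda>. offdiag n I e (u a) y)" by blast
    note u(2)
    also have "\<dots> \<le> (\<Sum>a\<in>\<Lambda>. \<bar>offdiag n I e (u a) y\<bar>)" by (intro sum_mono) auto
    finally show ?thesis using u(1) by blast
  qed
  show ?thesis
  proof (intro bexI[OF _ e] ballI)
    fix x y assume x: "x \<in> B" and y: "y \<in> B"
    obtain v where v: "\<forall>b\<in>\<Lambda>. v b \<in> U b" "\<bar>offdiag n I e y x\<bar> \<le> (\<Sum>b\<in>\<Lambda>. \<bar>offdiag n I e (v b) x\<bar>)"
      using lin[OF y] by blast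
    have "\<bar>offdiag n I e x y\<bar> \<le> (\<Sum>b\<in>\<Lambda>. \<bar>offdiag n I e x (v b)\<bar>)"
      using v(2) by (simp only: offdiag_commute[OF I, of n e x])
    also have "\<dots> \<le> (\<Sum>b\<in>\<Lambda>. \<Sum>a\<in>\<Lambda>. M a b)"
    proof (rule sum_mono)
      fix b assume b: "b \<in> \<Lambda>"
      obtain u where u: "\<forall>a\<in>\<Lambda>. u a \<in> U a"
        "\<bar>offdiag n I e x (v b)\<bar> \<le> (\<Sum>a\<in>\<Lambda>. \<bar>offdiag n I e (u a) (v b)\<bar>)"
        using lin[OF x] by blast
      note u(2)
      also have "\<dots> \<le> (\<Sum>a\<in>\<Lambda>. M a b)" using u(1) v(1) b by (intro sum_mono M) auto
      finally show "\<bar>offdiag n I e x (v b)\<bar> \<le> (\<Sum>a\<in>\<Lambda>. M a b)" .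
    qed
    also have "\<dots> = (\<Sum>a\<in>\<Lambda>. \<Sum>b\<in>\<Lambda>. M a b)" by (rule sum.swap)
    also note le
    finally show "\<bar>offdiag n I e x y\<bar>
      \<le> 96 * (2 * sqrt n * (\<Sum>a\<in>\<Lambda>. \<sigma> a) * (\<Sum>a\<in>\<Lambda>. \<sigma> a * sqrt (h a)) + (\<Sum>a\<in>\<Lambda>. \<sigma> a * sqrt (h a))\<^sup>2)" .
  qed
qed

section \<open>Entropy counts and the Euclidean ball\<close>

text \<open>A Chernoff count: exp (W - total weight) is at least 1 on the counted set, and its sum
  over the whole product factorizes into partition functions of single coordinates.\<close>

lemma card_PiE_weight_le:
  fixes w :: "'b \<Rightarrow> real"
  assumes "finite I" "finite F"
  shows "real (card {v \<in> PiE I (\<lambda>_. F). (\<Sum>i\<in>I. w (v i)) \<le> W})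
    \<le> exp W * (\<Sum>f\<in>F. exp (- w f)) ^ card I"
proof -
  let ?P = "PiE I (\<lambda>_. F)" and ?S = "{v \<in> PiE I (\<lambda>_. F). (\<Sum>i\<in>I. w (v i)) \<le> W}"
  have P: "finite ?P" using assms by (intro finite_PiE) auto
  have "real (card ?S) = (\<Sum>v\<in>?S. 1)" by simp
  also have "\<dots> \<le> (\<Sum>v\<in>?S. exp (W - (\<Sum>i\<in>I. w (v i))))" by (intro sum_mono) auto
  also have "\<dots> \<le> (\<Sum>v\<in>?P. exp (W - (\<Sum>i\<in>I. w (v i))))" using P by (intro sum_mono2) auto
  also have "\<dots> = exp W * (\<Sum>v\<in>?P. \<Prod>i\<in>I. exp (- w (v i)))"
  proof -
    have "exp (W - (\<Sum>i\<in>I. w (v i))) = exp W * (\<Prod>i\<in>I. exp (- w (v i)))" for v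
    proof -
      have "W - (\<Sum>i\<in>I. w (v i)) = W + (\<Sum>i\<in>I. - w (v i))" by (simp add: sum_negf)
      then show ?thesis by (simp only: exp_add exp_sum[OF assms(1)])
    qed
    then show ?thesis by (simp only: sum_distrib_left)
  qed
  also have "(\<Sum>v\<in>?P. \<Prod>i\<in>I. exp (- w (v i))) = (\<Prod>i\<in>I. \<Sum>f\<in>F. exp (- w f))"
    using assms by (subst prod_sum_PiE) auto
  finally show ?thesis by simp
qed

lemma sum_half_powers_le: "(\<Sum>z\<in>{- int L..int L}. (1 / 2 :: real) ^ nat \<bar>z\<bar>) \<le> 3"
proof -
  have "(\<Sum>z\<in>{- int L..int L}. (1 / 2 :: real) ^ nat \<bar>z\<bar>) = 3 - 2 * (1 / 2) ^ L"
  proof (induction L)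
    case (Suc L)
    have "{- int (Suc L)..int (Suc L)} = insert (int (Suc L)) (insert (- int (Suc L)) {- int L..int L})"
      by auto
    then have "(\<Sum>z\<in>{- int (Suc L)..int (Suc L)}. (1 / 2 :: real) ^ nat \<bar>z\<bar>)
        = 2 * (1 / 2) ^ Suc L + (\<Sum>z\<in>{- int L..int L}. (1 / 2) ^ nat \<bar>z\<bar>)"
      by (simp add: nat_add_distrib)
    then show ?case using Suc by simp
  qed simp
  then show ?thesis by simp
qed

definition lp_ball :: "real \<Rightarrow> 'i set \<Rightarrow> ('i \<Rightarrow> real) set" where
  "lp_ball r I = {x. (\<Sum>i\<in>I. \<bar>x i\<bar> powr r) \<le> 1}"

text \<open>The weight N f^2 on a grid of mesh 1 / sqrt N is the square of an integer z, so one
  coordinate has partition function at most the sum of 2^(-\<bar>z\<bar>), hence at most 3 \<le>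
  e^2. The constraint contributes 4 N to the exponent and the N coordinates contribute 2 N.\<close>

lemma grid_count:
  assumes I: "finite I" "card I = N" and N: "N \<ge> 1"
  shows "real (card {v \<in> PiE I (\<lambda>_. (\<lambda>z. real_of_int z / sqrt N) ` {- int (2 * N)..int (2 * N)}).
     (\<Sum>i\<in>I. (v i)\<^sup>2) \<le> 4}) \<le> exp (6 * real N)" (is "real (card ?U) \<le> _")
proof -
  let ?F = "(\<lambda>z. real_of_int z / sqrt N) ` {- int (2 * N)..int (2 * N)}"
  define w where "w f = N * f\<^sup>2" for f :: real
  have "?U = {v \<in> PiE I (\<lambda>_. ?F). (\<Sum>i\<in>I. w (v i)) \<le> 4 * N}"
    using N by (auto simp: w_def sum_distrib_left[symmetric])
  then have "real (card ?U) \<le> exp (4 * N) * (\<Sum>f\<in>?F. exp (- w f)) ^ card I"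
    using card_PiE_weight_le[OF I(1), of ?F w "4 * N"] by simp
  also have "\<dots> \<le> exp (4 * N) * 3 ^ card I"
  proof (intro mult_left_mono power_mono)
    show "(\<Sum>f\<in>?F. exp (- w f)) \<le> 3"
    proof -
      have "inj_on (\<lambda>z. real_of_int z / sqrt N) {- int (2 * N)..int (2 * N)}"
        using N by (auto simp: inj_on_def)
      then have "(\<Sum>f\<in>?F. exp (- w f)) = (\<Sum>z\<in>{- int (2 * N)..int (2 * N)}. exp (- w (z / sqrt N)))"
        by (simp add: sum.reindex)
      also have "\<dots> \<le> (\<Sum>z\<in>{- int (2 * N)..int (2 * N)}. (1 / 2 :: real) ^ nat \<bar>z\<bar>)"
      proof (rule sum_mono)
        fix z :: int
        have w: "w (z / sqrt N) = (real_of_int z)\<^sup>2" using N by (simp add: w_def power_divide)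
        have "real (nat \<bar>z\<bar>) \<le> (real_of_int z)\<^sup>2"
        proof -
          have "\<bar>z\<bar> * 1 \<le> \<bar>z\<bar> * \<bar>z\<bar>" by (cases "z = 0") (simp, intro mult_left_mono, auto)
          then have "real_of_int \<bar>z\<bar> \<le> real_of_int (z\<^sup>2)" by (simp only: of_int_le_iff) (simp add: power2_eq_square)
          then show ?thesis by simp
        qed
        then have "exp (- w (z / sqrt N)) \<le> exp (- real (nat \<bar>z\<bar>))" by (simp add: w)
        also have "\<dots> = exp (-1) ^ nat \<bar>z\<bar>" by (simp add: exp_of_nat_mult[symmetric])
        also have "\<dots> \<le> (1 / 2) ^ nat \<bar>z\<bar>"
          using exp_ge_add_one_self[of 1] by (intro power_mono) (auto simp: exp_minus field_simps)
        finally show "exp (- w (z / sqrt N)) \<le> (1 / 2) ^ nat \<bar>z\<bar>" .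
      qed
      also have "\<dots> \<le> 3" by (rule sum_half_powers_le)
      finally show ?thesis .
    qed
  qed (auto intro: sum_nonneg)
  also have "\<dots> \<le> exp (4 * N) * exp 2 ^ N"
    using exp_ge_add_one_self[of 2] I by (intro mult_left_mono) (auto intro: power_mono)
  also have "\<dots> = exp (6 * real N)" by (simp add: exp_of_nat_mult[symmetric] exp_add[symmetric])
  finally show ?thesis .
qed

text \<open>Coordinates are rounded up, not to the nearest grid point, because the atom has to
  dominate. Rounding adds at most 1 / sqrt N to each, so the sum of squares is at most 2 + 2.
  Coordinates of the ball are at most 1, and sqrt N \<le> 2 N keeps the integers in range.\<close>

lemma atomic_dec_l2:
  assumes I: "finite I" "card I = N" and N: "N \<ge> 1"
  defines "U \<equiv> {v \<in> PiE I (\<lambda>_. (\<lambda>z. real_of_int z / sqrt N) ` {- int (2 * N)..int (2 * N)}).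
     (\<Sum>i\<in>I. (v i)\<^sup>2) \<le> 4}"
  shows "atomic_dec (lp_ball 2 I) I {0::nat} (\<lambda>_. U) (\<lambda>_. 2) (\<lambda>_. 6 * real N)"
  unfolding atomic_dec_def
proof (intro conjI ballI allI impI)
  let ?F = "(\<lambda>z. real_of_int z / sqrt N) ` {- int (2 * N)..int (2 * N)}"
  show fin: "finite U" 
  proof (rule finite_subset)
    show "U \<subseteq> PiE I (\<lambda>_. ?F)" by (auto simp: U_def)
    show "finite (PiE I (\<lambda>_. ?F))" using I by (intro finite_PiE) auto
  qed
  show "U \<noteq> {}"
  proof -
    have "(\<lambda>i\<in>I. 0) \<in> U" unfolding U_def by (auto simp: image_iff)
    then show ?thesis by blast
  qed
  show "real (card U) \<le> exp (6 * real N)" unfolding U_def by (rule grid_count[OF I N])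
  show "1 \<le> 6 * real N" "0 < (2::real)" using N by auto
  fix u assume u: "u \<in> U"
  show "(\<Sum>i\<in>I. (u i)\<^sup>2) \<le> 2\<^sup>2" using u by (simp add: U_def)
  have "card {i \<in> I. u i \<noteq> 0} \<le> card I" using I by (intro card_mono) auto
  then show "real (card {i \<in> I. u i \<noteq> 0}) \<le> 6 * real N" using I by simp
  fix s :: "'a \<Rightarrow> real" assume s: "\<forall>i\<in>I. \<bar>s i\<bar> = 1"
  have "(\<lambda>i\<in>I. s i * u i) \<in> U"
  proof -
    have "s i * u i \<in> ?F" if i: "i \<in> I" for i
    proof -
      from u i have "u i \<in> ?F" by (auto simp: U_def)
      then obtain z where z: "z \<in> {- int (2 * N)..int (2 * N)}" "u i = z / sqrt N" by auto
      from s i consider "s i = 1" | "s i = -1" by fastforce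
      then show ?thesis
      proof cases
        case 1 then show ?thesis using z by auto
      next
        case 2 then show ?thesis using z by (intro image_eqI[of _ _ "- z"]) auto
      qed
    qed
    moreover have "(\<Sum>i\<in>I. ((\<lambda>i\<in>I. s i * u i) i)\<^sup>2) = (\<Sum>i\<in>I. (u i)\<^sup>2)"
      using s by (intro sum.cong) (auto simp: power_mult_distrib abs_square_eq_1)
    ultimately show ?thesis using u by (auto simp: U_def)
  qed
  then show "\<exists>v\<in>U. \<forall>i\<in>I. v i = s i * u i" by (rule bexI[rotated]) auto
next
  let ?F = "(\<lambda>z. real_of_int z / sqrt N) ` {- int (2 * N)..int (2 * N)}"
  fix x :: "'a \<Rightarrow> real" assume "x \<in> lp_ball 2 I"
  then have x: "(\<Sum>i\<in>I. (x i)\<^sup>2) \<le> 1" by (simp add: lp_ball_def powr_numeral)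
  have x1: "\<bar>x i\<bar> \<le> 1" if "i \<in> I" for i
  proof -
    have "(x i)\<^sup>2 \<le> (\<Sum>i\<in>I. (x i)\<^sup>2)" using I that by (intro member_le_sum) auto
    then have "(x i)\<^sup>2 \<le> 1" using x by linarith
    then show ?thesis by (simp only: abs_square_le_1)
  qed
  define u where "u = (\<lambda>i\<in>I. real_of_int \<lceil>sqrt N * \<bar>x i\<bar>\<rceil> / sqrt N)"
  have sN: "sqrt N > 0" using N by simp
  have sN': "sqrt N \<le> N"
  proof (rule real_le_lsqrt)
    show "real N \<le> (real N)\<^sup>2" using N by (simp add: power2_eq_square)
  qed simp
  have ge: "\<bar>x i\<bar> \<le> u i" if "i \<in> I" for i
    using that sN by (simp add: u_def field_simps)
  have sq: "(u i)\<^sup>2 \<le> 2 * (x i)\<^sup>2 + 2 / N" if "i \<in> I" for i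
  proof -
    have "real_of_int \<lceil>sqrt N * \<bar>x i\<bar>\<rceil> \<le> sqrt N * \<bar>x i\<bar> + 1" by linarith
    then have "u i \<le> \<bar>x i\<bar> + 1 / sqrt N" using that sN by (simp add: u_def field_simps)
    moreover have "u i \<ge> 0" using ge[OF that] by linarith
    ultimately have "(u i)\<^sup>2 \<le> (\<bar>x i\<bar> + 1 / sqrt N)\<^sup>2" by (rule power_mono)
    also have "\<dots> \<le> 2 * \<bar>x i\<bar>\<^sup>2 + 2 * (1 / sqrt N)\<^sup>2"
      using sum_squares_bound[of "\<bar>x i\<bar>" "1 / sqrt N"] by (simp only: power2_sum)
    finally show ?thesis by (simp add: power_divide)
  qed
  have "u \<in> U"
  proof -
    have "u i \<in> ?F" if i: "i \<in> I" for i
    proof -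
      have "sqrt N * \<bar>x i\<bar> \<le> sqrt N * 1" using x1[OF i] by (intro mult_left_mono) auto
      then have "sqrt N * \<bar>x i\<bar> \<le> real_of_int (int (2 * N))" using sN' by simp
      then have "\<lceil>sqrt N * \<bar>x i\<bar>\<rceil> \<le> int (2 * N)" by (simp only: ceiling_le_iff)
      moreover have "sqrt N * \<bar>x i\<bar> \<ge> 0" by simp
      then have "0 \<le> \<lceil>sqrt N * \<bar>x i\<bar>\<rceil>" by linarith
      ultimately show ?thesis using i
        by (simp only: u_def restrict_apply if_True) (intro imageI, simp, linarith)
    qed
    moreover have "(\<Sum>i\<in>I. (u i)\<^sup>2) \<le> 4"
    proof -
      have "(\<Sum>i\<in>I. (u i)\<^sup>2) \<le> (\<Sum>i\<in>I. 2 * (x i)\<^sup>2 + 2 / N)"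
        by (rule sum_mono) (rule sq)
      also have "\<dots> = 2 * (\<Sum>i\<in>I. (x i)\<^sup>2) + 2" 
        using N by (simp only: sum.distrib sum_distrib_left[symmetric] sum_constant I(2)) simp
      finally show ?thesis using x by simp
    qed
    ultimately show ?thesis 
      unfolding U_def mem_Collect_eq by (intro conjI PiE_I) (simp_all add: u_def)
  qed
  then show "\<exists>u. (\<forall>a\<in>{0}. u a \<in> U) \<and> (\<forall>i\<in>I. \<bar>x i\<bar> \<le> (\<Sum>a\<in>{0}. u a i))"
    using ge by (intro exI[of _ "\<lambda>_. u"]) auto
qed

section \<open>Dyadic levels for exponents other than 2\<close>

text \<open>Candidates for the part of a point of the l_r ball with coordinates of size about
  2^(-a/r). At most 2^(a+1) coordinates of such a point can exceed 2^(-(a+1)/r), which explains the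
  bound on the support.\<close>

definition levels :: "real \<Rightarrow> 'i set \<Rightarrow> nat \<Rightarrow> ('i \<Rightarrow> real) set" where
  "levels r I a = {v \<in> PiE I (\<lambda>_. {- (2 powr (- a / r)), 0, 2 powr (- a / r)}).
     card {i \<in> I. v i \<noteq> 0} \<le> 2 ^ (a + 1)}"

text \<open>The logarithm of the number of signed sets of at most 2^(a+1) points among N is of this
  order. For 2^a \<le> N the leading 1 makes it dominate the size of the support as well.\<close>

definition level_entropy :: "nat \<Rightarrow> nat \<Rightarrow> real" where
  "level_entropy N a = 2 ^ (a + 1) * (1 + ln (N / 2 ^ a))"

lemma sum_support:
  assumes "finite I"
  shows "(\<Sum>i\<in>I. if v i \<noteq> 0 then L else 0) = real (card {i \<in> I. v i \<noteq> 0}) * (L::real)"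
  using sum.inter_filter[OF assms, of "\<lambda>_. L" "\<lambda>i. v i \<noteq> 0"] by simp

text \<open>The weighted count with weight L = ln (N / 2^a) on nonzero values: the two nonzero
  values contribute 2^(a+1) / N to the partition function, whose N-th power is thus at most exp
  (2^(a+1)), and the support bound accounts for 2^(a+1) L.\<close>

lemma card_levels_le:
  assumes I: "finite I" "card I = N" and a: "2 ^ a \<le> N"
  shows "real (card (levels r I a)) \<le> exp (level_entropy N a)"
proof -
  define c where "c = 2 powr (- real a / r)"
  have c: "c > 0" by (simp add: c_def)
  let ?F = "{- c, 0, c}"
  have aN: "2 ^ a \<le> real N" using a by (metis of_nat_le_iff of_nat_numeral of_nat_power)
  have N: "real N > 0" using aN by (rule less_le_trans[rotated]) simp
  define L where "L = ln (N / 2 ^ a)"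
  have L: "L \<ge> 0" using aN by (auto simp: L_def)
  have eL: "exp (- L) = 2 ^ a / N" using N by (simp add: L_def exp_minus)
  define w where "w f = (if f \<noteq> 0 then L else 0)" for f :: real
  let ?S = "{v \<in> PiE I (\<lambda>_. ?F). (\<Sum>i\<in>I. w (v i)) \<le> 2 ^ (a + 1) * L}"
  have "levels r I a \<subseteq> ?S"
  proof
    fix v assume v: "v \<in> levels r I a"
    then have "real (card {i \<in> I. v i \<noteq> 0}) \<le> real (2 ^ (a + 1))"
      unfolding levels_def by (simp only: of_nat_le_iff) simp
    then have "real (card {i \<in> I. v i \<noteq> 0}) * L \<le> 2 ^ (a + 1) * L"
      using L by (intro mult_right_mono) auto
    then show "v \<in> ?S" using v unfolding levels_def c_def[symmetric] w_def sum_support[OF I(1)] by simp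
  qed
  moreover have "finite ?S"
  proof (rule finite_subset)
    show "?S \<subseteq> PiE I (\<lambda>_. ?F)" by auto
    show "finite (PiE I (\<lambda>_. ?F))" using I by (intro finite_PiE) auto
  qed
  ultimately have "real (card (levels r I a)) \<le> real (card ?S)" by (simp add: card_mono)
  also have "\<dots> \<le> exp (2 ^ (a + 1) * L) * (\<Sum>f\<in>?F. exp (- w f)) ^ card I"
    by (rule card_PiE_weight_le[OF I(1)]) simp
  also have "(\<Sum>f\<in>?F. exp (- w f)) = 1 + 2 ^ (a + 1) / N"
    using c by (simp add: w_def eL)
  also have "exp (2 ^ (a + 1) * L) * (1 + 2 ^ (a + 1) / real N) ^ card I
      \<le> exp (2 ^ (a + 1) * L) * exp (2 ^ (a + 1) / N) ^ card I"
    by (intro mult_left_mono power_mono exp_ge_add_one_self) auto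
  also have "\<dots> = exp (level_entropy N a)"
    using N I by (simp add: level_entropy_def L_def exp_of_nat_mult[symmetric] exp_add[symmetric] algebra_simps)
  finally show ?thesis .
qed

text \<open>Each coordinate is charged to the last level a \<le> A whose height \<open>c a\<close>
  still dominates it. For a < A it also exceeds \<open>c (a + 1)\<close>, so Chebyshev's inequality
  limits their number to 2^(a+1). Level A takes all smaller coordinates, where N < 2^(A+1) suffices.
  The radius comes from 2^(a+1) entries with square 2^(-2a/r).\<close>

lemma atomic_dec_levels:
  fixes I :: "'i set"
  assumes r: "r > 0" and I: "finite I" "card I = N" and A: "2 ^ A \<le> N" "N < 2 ^ (A + 1)"
  shows "atomic_dec (lp_ball r I) I {..A} (levels r I)
    (\<lambda>a. sqrt 2 * 2 powr (a * (1/2 - 1/r))) (level_entropy N)"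
proof -
  define c where "c a = 2 powr (- real a / r)" for a :: nat
  have c: "c a > 0" for a by (simp add: c_def)
  have lev: "levels r I a = {v \<in> PiE I (\<lambda>_. {- c a, 0, c a}). card {i \<in> I. v i \<noteq> 0} \<le> 2 ^ (a + 1)}" for a
    by (simp add: levels_def c_def)
  have fin: "finite (levels r I a)" for a
  proof (rule finite_subset)
    show "levels r I a \<subseteq> PiE I (\<lambda>_. {- c a, 0, c a})" by (auto simp: lev)
    show "finite (PiE I (\<lambda>_. {- c a, 0, c a}))" using I by (intro finite_PiE) auto
  qed
  have ne: "levels r I a \<noteq> {}" for a
  proof -
    have "{i \<in> I. (\<lambda>i\<in>I. 0::real) i \<noteq> 0} = {}" by auto
    then have "(\<lambda>i\<in>I. 0) \<in> levels r I a" by (simp add: lev)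
    then show ?thesis by blast
  qed
  have ent: "2 ^ (a + 1) \<le> level_entropy N a" if "a \<le> A" for a
  proof -
    have "(2::nat) ^ a \<le> 2 ^ A" using that by (intro power_increasing) auto
    also have "\<dots> \<le> N" by (rule A)
    finally have "2 ^ a \<le> real N" by (metis of_nat_le_iff of_nat_numeral of_nat_power)
    then have "2 ^ (a + 1) * 1 \<le> 2 ^ (a + 1) * (1 + ln (N / 2 ^ a))" by (intro mult_left_mono) auto
    then show ?thesis by (simp add: level_entropy_def)
  qed
  have supp: "real (card {i \<in> I. u i \<noteq> 0}) \<le> 2 ^ (a + 1)" if "u \<in> levels r I a" for u a
  proof -
    have "real (card {i \<in> I. u i \<noteq> 0}) \<le> real (2 ^ (a + 1))"
      using that unfolding lev by (simp only: of_nat_le_iff) simp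
    then show ?thesis by simp
  qed
  have sq: "(\<Sum>i\<in>I. (u i)\<^sup>2) \<le> (sqrt 2 * 2 powr (a * (1/2 - 1/r)))\<^sup>2" if u: "u \<in> levels r I a" for u a
  proof -
    have "(\<Sum>i\<in>I. (u i)\<^sup>2) = (\<Sum>i\<in>I. if u i \<noteq> 0 then (c a)\<^sup>2 else 0)"
      using u by (intro sum.cong) (auto simp: lev dest!: PiE_mem)
    also have "\<dots> = real (card {i \<in> I. u i \<noteq> 0}) * (c a)\<^sup>2" by (rule sum_support[OF I(1)])
    also have "\<dots> \<le> 2 ^ (a + 1) * (c a)\<^sup>2" using supp[OF u] by (intro mult_right_mono) auto
    also have "\<dots> = 2 * (2 powr a * (2 powr (- real a / r) * 2 powr (- real a / r)))"
      by (simp add: c_def power2_eq_square powr_realpow)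
    also have "\<dots> = 2 * (2 powr (a * (1/2 - 1/r)) * 2 powr (a * (1/2 - 1/r)))"
      by (simp add: powr_add[symmetric] algebra_simps)
    also have "\<dots> = (sqrt 2 * 2 powr (a * (1/2 - 1/r)))\<^sup>2"
      by (simp add: power_mult_distrib power2_eq_square)
    finally show ?thesis .
  qed
  have sgn: "\<exists>v\<in>levels r I a. \<forall>i\<in>I. v i = s i * u i"
    if u: "u \<in> levels r I a" and s: "\<forall>i\<in>I. \<bar>s i\<bar> = 1" for u s a
  proof (rule bexI)
    have "s i * u i \<in> {- c a, 0, c a}" if i: "i \<in> I" for i
    proof -
      have "u i \<in> {- c a, 0, c a}" using u i by (auto simp: lev dest!: PiE_mem)
      moreover have "s i = 1 \<or> s i = -1" using s i by fastforce
      ultimately show ?thesis by auto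
    qed
    moreover have "{i \<in> I. (\<lambda>i\<in>I. s i * u i) i \<noteq> 0} = {i \<in> I. u i \<noteq> 0}" using s by auto
    ultimately show "(\<lambda>i\<in>I. s i * u i) \<in> levels r I a" using u by (auto simp: lev)
  qed simp
  have cover: "\<exists>u. (\<forall>a\<in>{..A}. u a \<in> levels r I a) \<and> (\<forall>i\<in>I. \<bar>x i\<bar> \<le> (\<Sum>a\<in>{..A}. u a i))"
    if x: "x \<in> lp_ball r I" for x
  proof -
    have x: "(\<Sum>i\<in>I. \<bar>x i\<bar> powr r) \<le> 1" using x by (simp add: lp_ball_def)
    define S where "S a = {i \<in> I. \<bar>x i\<bar> \<le> c a \<and> (a < A \<longrightarrow> c (a + 1) < \<bar>x i\<bar>)}" for a
    define u where "u a = (\<lambda>i\<in>I. if i \<in> S a then c a else 0)" for a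
    have cardS: "card (S a) \<le> 2 ^ (a + 1)" if "a \<le> A" for a
    proof (cases "a = A")
      case True
      have "card (S a) \<le> card I" using I by (intro card_mono) (auto simp: S_def)
      then show ?thesis using A I True by simp
    next
      case False
      with that have a: "a < A" by simp
      have "real (card (S a)) * (1 / 2 ^ (a + 1)) = (\<Sum>i\<in>S a. c (a + 1) powr r)"
      proof -
        have "c (a + 1) powr r = 2 powr (- real (a + 1))" using r by (simp add: c_def powr_powr)
        also have "\<dots> = 1 / 2 ^ (a + 1)"
          by (simp only: powr_minus powr_realpow zero_less_numeral inverse_eq_divide)
        finally show ?thesis by simp
      qed
      also have "\<dots> \<le> (\<Sum>i\<in>S a. \<bar>x i\<bar> powr r)"
        using a r c by (intro sum_mono powr_mono2) (auto simp: S_def less_imp_le)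
      also have "\<dots> \<le> (\<Sum>i\<in>I. \<bar>x i\<bar> powr r)" using I by (intro sum_mono2) (auto simp: S_def)
      also note x
      finally have "real (card (S a)) \<le> real (2 ^ (a + 1))" by (simp add: field_simps)
      then show ?thesis by (simp only: of_nat_le_iff)
    qed
    have "u a \<in> levels r I a" if "a \<le> A" for a
    proof -
      have "{i \<in> I. u a i \<noteq> 0} = S a" using c[of a] by (auto simp: u_def S_def)
      then show ?thesis using cardS[OF that] by (auto simp: lev u_def)
    qed
    moreover have "\<bar>x i\<bar> \<le> (\<Sum>a\<in>{..A}. u a i)" if i: "i \<in> I" for i
    proof -
      let ?P = "\<lambda>a. a \<le> A \<and> \<bar>x i\<bar> \<le> c a"
      have "\<bar>x i\<bar> powr r \<le> (\<Sum>i\<in>I. \<bar>x i\<bar> powr r)" using I i by (intro member_le_sum) auto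
      then have "\<bar>x i\<bar> powr r \<le> 1 powr r" using x by simp
      then have "\<bar>x i\<bar> \<le> 1" using powr_less_mono2[of r 1 "\<bar>x i\<bar>"] r by linarith
      then have P0: "?P 0" by (simp add: c_def)
      \<comment> \<open>Level 0 has height 1 and dominates every coordinate of the ball, so an
        admissible level exists.\<close>
      define a where "a = (GREATEST a. ?P a)"
      have a: "?P a" unfolding a_def using P0 by (rule GreatestI_nat[where b = A]) auto
      have "\<not> \<bar>x i\<bar> \<le> c (a + 1)" if "a < A"
        using Greatest_le_nat[of ?P "a + 1" A] that unfolding a_def[symmetric] by auto
      then have "i \<in> S a" using a i by (auto simp: S_def)
      then have "\<bar>x i\<bar> \<le> u a i" using a i by (simp add: u_def)
      also have "\<dots> \<le> (\<Sum>a\<in>{..A}. u a i)"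
        using a i c by (intro member_le_sum) (auto simp: u_def less_imp_le)
      finally show ?thesis .
    qed
    ultimately show ?thesis by (intro exI[of _ u]) auto
  qed
  have card: "real (card (levels r I a)) \<le> exp (level_entropy N a)" if "a \<le> A" for a
  proof (rule card_levels_le[OF I])
    have "(2::nat) ^ a \<le> 2 ^ A" using that by (intro power_increasing) auto
    then show "2 ^ a \<le> N" using A by linarith
  qed
  have one: "1 \<le> level_entropy N a" if "a \<le> A" for a
    using ent[OF that] one_le_power[of "2::real" "a + 1"] by linarith
  show ?thesis
    unfolding atomic_dec_def
  proof (intro conjI ballI allI impI)
    fix a u assume "a \<in> {..A}" "u \<in> levels r I a"
    then show "real (card {i \<in> I. u i \<noteq> 0}) \<le> level_entropy N a"
      using ent[of a] supp[of u a] by simp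
  qed (use fin ne card one sq sgn cover in auto)
qed

lemma sum_geometric_le:
  fixes \<rho> :: real
  assumes "0 \<le> \<rho>" "\<rho> < 1"
  shows "(\<Sum>a\<le>A. \<rho> ^ a) \<le> 1 / (1 - \<rho>)"
proof -
  have "(1 - \<rho>) * (\<Sum>a\<le>A. \<rho> ^ a) = 1 - \<rho> ^ Suc A" by (rule sum_gp_basic)
  also have "\<dots> \<le> 1" using assms by simp
  finally show ?thesis using assms by (simp add: pos_le_divide_eq mult.commute)
qed

lemma sum_geometric_ge_one_le:
  fixes \<beta> :: real
  assumes "\<beta> > 1"
  shows "(\<Sum>a\<le>A. \<beta> ^ a) \<le> \<beta> / (\<beta> - 1) * \<beta> ^ A"
proof -
  have "(\<beta> - 1) * (\<Sum>a\<le>A. \<beta> ^ a) = \<beta> ^ Suc A - 1"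
    using sum_gp_basic[of \<beta> A] by (simp add: algebra_simps)
  then show ?thesis using assms by (simp add: field_simps)
qed

text \<open>Since 1/2 - 1/r = 1/q - 1/2 < 0, the radii decay geometrically. With the entropy factor
  they grow like 2^(a/q) times the root of 1 + ln (N / 2^a). Bounding this logarithm by q (N /
  2^a)^(1/q) leaves N^(1/(2q)) \<beta>^a with \<beta> = 2^(1/(2q)) > 1: the sum is governed by its
  last term, where 2^A \<le> N gives another N^(1/(2q)).\<close>

lemma level_sums_le:
  assumes q: "q > 2" and r: "r = q / (q - 1)"
  shows "\<exists>C>0. \<forall>N A. 2 ^ A \<le> N \<longrightarrow>
    (\<Sum>a\<le>A. sqrt 2 * 2 powr (real a * (1/2 - 1/r))) \<le> C \<and>
    (\<Sum>a\<le>A. sqrt 2 * 2 powr (real a * (1/2 - 1/r)) * sqrt (level_entropy N a)) \<le> C * real N powr (1/q)"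
proof -
  define \<rho> where "\<rho> = 2 powr (1/2 - 1/r)"
  define \<beta> where "\<beta> = 2 powr (1/(2*q))"
  have e: "1/2 - 1/r = 1/q - 1/2" using q by (simp add: r field_simps)
  have "1/2 - 1/r < 0" unfolding e using q by (simp add: field_simps)
  then have \<rho>: "0 < \<rho>" "\<rho> < 1" by (simp_all add: \<rho>_def powr_less_one)
  have \<beta>: "\<beta> > 1" using q by (simp add: \<beta>_def)
  have \<rho>_pow: "2 powr (real a * (1/2 - 1/r)) = \<rho> ^ a" for a
    unfolding \<rho>_def by (subst powr_realpow[symmetric]) (simp_all add: powr_powr mult.commute)
  have \<beta>_pow: "\<beta> ^ a = (2 ^ a) powr (1/(2*q))" for a
    unfolding \<beta>_def by (simp add: powr_realpow[symmetric] powr_powr mult.commute)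
  define C1 where "C1 = sqrt 2 / (1 - \<rho>)"
  define C2 where "C2 = 2 * sqrt q * (\<beta> / (\<beta> - 1))"
  have sum1: "(\<Sum>a\<le>A. sqrt 2 * 2 powr (real a * (1/2 - 1/r))) \<le> C1" for A :: nat
    using mult_left_mono[OF sum_geometric_le[of \<rho> A], of "sqrt 2"] \<rho>
    by (simp add: \<rho>_pow C1_def sum_distrib_left)
  have sum2: "(\<Sum>a\<le>A. sqrt 2 * 2 powr (real a * (1/2 - 1/r)) * sqrt (level_entropy N a)) \<le> C2 * real N powr (1/q)"
    if AN: "2 ^ A \<le> N" for A N :: nat
  proof -
    have AN': "2 ^ A \<le> real N" using AN by (metis of_nat_le_iff of_nat_numeral of_nat_power)
    have N: "real N > 0" using AN' by (rule less_le_trans[rotated]) simp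
    have step: "sqrt 2 * 2 powr (real a * (1/2 - 1/r)) * sqrt (level_entropy N a)
        \<le> 2 * sqrt q * real N powr (1/(2*q)) * \<beta> ^ a" if a: "a \<le> A" for a
    proof -
      define y where "y = real N / 2 ^ a"
      have "(2::real) ^ a \<le> 2 ^ A" using a by (intro power_increasing) auto
      then have "2 ^ a \<le> real N" using AN' by linarith
      then have y: "y \<ge> 1" unfolding y_def by (subst le_divide_eq_1_pos) auto
      have "ln y = q * ln (y powr (1/q))" using y q by (simp add: ln_powr)
      also have "\<dots> \<le> q * (y powr (1/q) - 1)" using y q by (intro mult_left_mono ln_le_minus_one) auto
      finally have "1 + ln y \<le> q * y powr (1/q)" using q by (simp add: algebra_simps)
      then have "sqrt (level_entropy N a) \<le> sqrt (2 * 2 ^ a * (q * y powr (1/q)))"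
        by (intro real_sqrt_le_mono) (simp add: level_entropy_def y_def)
      also have "\<dots> = sqrt 2 * sqrt (2 ^ a) * (sqrt q * sqrt (y powr (1/q)))"
        by (simp only: real_sqrt_mult)
      also have "sqrt (y powr (1/q)) = y powr (1/(2*q))"
        using y by (simp add: powr_half_sqrt[symmetric] powr_powr mult.commute)
      also have "y powr (1/(2*q)) = real N powr (1/(2*q)) / \<beta> ^ a"
        using N by (simp add: y_def powr_divide \<beta>_pow)
      finally have "sqrt 2 * 2 powr (real a * (1/2 - 1/r)) * sqrt (level_entropy N a)
        \<le> sqrt 2 * 2 powr (real a * (1/2 - 1/r)) * (sqrt 2 * sqrt (2 ^ a) * (sqrt q * (real N powr (1/(2*q)) / \<beta> ^ a)))"
        by (intro mult_left_mono) auto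
      also have "\<dots> = 2 * sqrt q * real N powr (1/(2*q)) * (2 powr (real a * (1/2 - 1/r)) * sqrt (2 ^ a) / \<beta> ^ a)"
        by simp
      also have "2 powr (real a * (1/2 - 1/r)) * sqrt (2 ^ a) / \<beta> ^ a = \<beta> ^ a"
      proof -
        have "sqrt (2 ^ a) = 2 powr (real a / 2)"
          by (simp add: powr_half_sqrt[symmetric] powr_realpow[symmetric] powr_powr)
        moreover have "\<beta> ^ a = 2 powr (real a / (2*q))"
          by (simp add: \<beta>_pow powr_realpow[symmetric] powr_powr)
        moreover have "real a * (1/2 - 1/r) + real a / 2 - real a / (2*q) = real a / (2*q)"
          unfolding e using q by (simp add: field_simps)
        ultimately show ?thesis by (simp only: powr_add[symmetric] powr_diff[symmetric])
      qed
      finally show ?thesis .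
    qed
    have "(\<Sum>a\<le>A. sqrt 2 * 2 powr (real a * (1/2 - 1/r)) * sqrt (level_entropy N a))
        \<le> (\<Sum>a\<le>A. 2 * sqrt q * real N powr (1/(2*q)) * \<beta> ^ a)" by (intro sum_mono step) auto
    also have "\<dots> = 2 * sqrt q * real N powr (1/(2*q)) * (\<Sum>a\<le>A. \<beta> ^ a)"
      by (simp add: sum_distrib_left)
    also have "\<dots> \<le> 2 * sqrt q * real N powr (1/(2*q)) * (\<beta> / (\<beta> - 1) * \<beta> ^ A)"
      using q \<beta> by (intro mult_left_mono sum_geometric_ge_one_le) auto
    also have "\<dots> \<le> 2 * sqrt q * real N powr (1/(2*q)) * (\<beta> / (\<beta> - 1) * real N powr (1/(2*q)))"
      unfolding \<beta>_pow using q \<beta> AN' by (intro mult_left_mono powr_mono2) auto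
    also have "\<dots> = C2 * (real N powr (1/(2*q)) * real N powr (1/(2*q)))" by (simp add: C2_def)
    also have "\<dots> = C2 * real N powr (1/q)" using q by (simp add: powr_add[symmetric] field_simps)
    finally show ?thesis .
  qed
  show ?thesis
  proof (intro exI[of _ "max C1 C2"] conjI allI impI)
    show "max C1 C2 > 0" using \<rho> by (simp add: C1_def less_max_iff_disj)
    fix N A :: nat assume AN: "2 ^ A \<le> N"
    show "(\<Sum>a\<le>A. sqrt 2 * 2 powr (real a * (1/2 - 1/r))) \<le> max C1 C2" using sum1[of A] by simp
    have "C2 * real N powr (1/q) \<le> max C1 C2 * real N powr (1/q)" by (intro mult_right_mono) auto
    then show "(\<Sum>a\<le>A. sqrt 2 * 2 powr (real a * (1/2 - 1/r)) * sqrt (level_entropy N a)) \<le> max C1 C2 * real N powr (1/q)"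
      using sum2[OF AN] by linarith
  qed
qed

text \<open>At q = 2 the ratio of successive radii would be 1, and their sum would grow with the
  number of levels, of order ln N. The grid class of radius 2 and entropy 6 N takes their place;
  hence the constant 2 sqrt 6.\<close>

lemma atomic_dec_exists:
  assumes q: "q \<ge> 2" and r: "r = q / (q - 1)"
  shows "\<exists>C>0. \<forall>N\<ge>1. \<exists>\<Lambda> :: nat set. \<exists>U \<sigma> h. atomic_dec (lp_ball r {1..N}) {1..N} \<Lambda> U \<sigma> h \<and>
    (\<Sum>a\<in>\<Lambda>. \<sigma> a) \<le> C \<and> (\<Sum>a\<in>\<Lambda>. \<sigma> a * sqrt (h a)) \<le> C * real N powr (1/q)"
proof (cases "q = 2")
  case True
  with r have r2: "r = 2" by simp
  show ?thesis
  proof (intro exI[of _ "2 * sqrt 6"] conjI allI impI)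
    fix N :: nat assume N: "N \<ge> 1"
    have "2 \<le> 2 * sqrt (6::real)" by simp
    moreover have "2 * sqrt (6 * real N) = 2 * sqrt 6 * real N powr (1/q)"
      using True by (simp add: real_sqrt_mult powr_half_sqrt)
    ultimately show "\<exists>\<Lambda> :: nat set. \<exists>U \<sigma> h. atomic_dec (lp_ball r {1..N}) {1..N} \<Lambda> U \<sigma> h \<and>
        (\<Sum>a\<in>\<Lambda>. \<sigma> a) \<le> 2 * sqrt 6 \<and> (\<Sum>a\<in>\<Lambda>. \<sigma> a * sqrt (h a)) \<le> 2 * sqrt 6 * real N powr (1/q)"
      using atomic_dec_l2[of "{1..N}" N] N unfolding r2
      by (intro exI[of _ "{0}"] exI conjI) (assumption | simp)+
  qed simp
next
  case False
  with q have q2: "q > 2" by simp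
  have r0: "r > 0" using q2 r by simp
  obtain C where C: "C > 0" "\<And>N A. 2 ^ A \<le> N \<Longrightarrow>
      (\<Sum>a\<le>A. sqrt 2 * 2 powr (real a * (1/2 - 1/r))) \<le> C \<and>
      (\<Sum>a\<le>A. sqrt 2 * 2 powr (real a * (1/2 - 1/r)) * sqrt (level_entropy N a)) \<le> C * real N powr (1/q)"
    using level_sums_le[OF q2 r] by blast
  show ?thesis
  proof (intro exI[of _ C] conjI allI impI)
    fix N :: nat assume N: "N \<ge> 1"
    obtain A where A: "2 ^ A \<le> N" "N < 2 ^ (A + 1)"
      using ex_power_ivl1[of 2 N] N by auto
    show "\<exists>\<Lambda> :: nat set. \<exists>U \<sigma> h. atomic_dec (lp_ball r {1..N}) {1..N} \<Lambda> U \<sigma> h \<and>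
        (\<Sum>a\<in>\<Lambda>. \<sigma> a) \<le> C \<and> (\<Sum>a\<in>\<Lambda>. \<sigma> a * sqrt (h a)) \<le> C * real N powr (1/q)"
      using atomic_dec_levels[OF r0, of "{1..N}" N A] A C(2)[OF A(1)]
      by (intro exI[of _ "{..A}"] exI[of _ "levels r {1..N}"]
          exI[of _ "\<lambda>a. sqrt 2 * 2 powr (real a * (1/2 - 1/r))"] exI[of _ "level_entropy N"]) simp
  qed (rule C)
qed

text \<open>\<open>mixed_ball r t m k\<close> carries no outer root: it is the unit ball of \<open>l\<^bsub>r,t\<^esub>\<^bsup>m,k\<^esup>\<close>.\<close>

definition mixed_ball :: "real \<Rightarrow> real \<Rightarrow> nat \<Rightarrow> nat \<Rightarrow> (nat \<times> nat \<Rightarrow> real) set" where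
  "mixed_ball r t m k = {x. (\<Sum>j=1..k. (\<Sum>i=1..m. \<bar>x (i, j)\<bar> powr r) powr (t / r)) \<le> 1}"

section \<open>Tensor products of decompositions\<close>

text \<open>Not elementary tensors: every column in the support of u carries an atom of
  \<open>V\<close> of its own. Restricting the choice to that support is what keeps the entropy at
  the product scale.\<close>

definition tensor_atoms :: "nat \<Rightarrow> nat \<Rightarrow> (nat \<Rightarrow> real) set \<Rightarrow> (nat \<Rightarrow> real) set \<Rightarrow> (nat \<times> nat \<Rightarrow> real) set" where
  "tensor_atoms m k V U = (\<Union>u\<in>U. (\<lambda>v (i, j). if u j = 0 then 0 else u j * v j i) `
     PiE {j \<in> {1..k}. u j \<noteq> 0} (\<lambda>_. V))"

lemma tensor_atomsI:
  assumes "u \<in> U" and V: "\<And>j. j \<in> {1..k} \<Longrightarrow> u j \<noteq> 0 \<Longrightarrow> z j \<in> V"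
  shows "(\<lambda>(i, j). if u j = 0 then 0 else u j * restrict z {j \<in> {1..k}. u j \<noteq> 0} j i) \<in> tensor_atoms m k V U"
  unfolding tensor_atoms_def
proof (rule UN_I[OF assms(1)])
  show "(\<lambda>(i, j). if u j = 0 then 0 else u j * restrict z {j \<in> {1..k}. u j \<noteq> 0} j i)
      \<in> (\<lambda>v (i, j). if u j = 0 then 0 else u j * v j i) ` PiE {j \<in> {1..k}. u j \<noteq> 0} (\<lambda>_. V)"
    by (rule image_eqI[where x = "restrict z {j \<in> {1..k}. u j \<noteq> 0}", OF refl]) (use V in auto)
qed

text \<open>This is where the support bound in \<open>atomic_dec\<close> pays off: u has at most h2
  nonzero columns, each with exp h1 choices, so the inner choices have entropy h1 h2. The choice of
  u itself adds h2 \<le> h1 h2, whence the factor 2.\<close>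

lemma atomic_dec_tensor:
  assumes r: "r > 0" "t > 0"
    and V: "atomic_dec (lp_ball r {1..m}) {1..m} \<Lambda>1 V \<sigma>1 h1"
    and U: "atomic_dec (lp_ball t {1..k}) {1..k} \<Lambda>2 U \<sigma>2 h2"
  shows "atomic_dec (mixed_ball r t m k) ({1..m} \<times> {1..k}) (\<Lambda>1 \<times> \<Lambda>2)
    (\<lambda>(b, a). tensor_atoms m k (V b) (U a)) (\<lambda>(b, a). \<sigma>1 b * \<sigma>2 a) (\<lambda>(b, a). 2 * (h1 b * h2 a))"
proof -
  have V1: "finite (V b)" "V b \<noteq> {}" "real (card (V b)) \<le> exp (h1 b)" "1 \<le> h1 b" "0 < \<sigma>1 b" if "b \<in> \<Lambda>1" for b
    using V that by (simp_all add: atomic_dec_def)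
  have U1: "finite (U a)" "U a \<noteq> {}" "real (card (U a)) \<le> exp (h2 a)" "1 \<le> h2 a" "0 < \<sigma>2 a" if "a \<in> \<Lambda>2" for a
    using U that by (simp_all add: atomic_dec_def)
  have V2: "(\<Sum>i\<in>{1..m}. (v i)\<^sup>2) \<le> (\<sigma>1 b)\<^sup>2" "real (card {i \<in> {1..m}. v i \<noteq> 0}) \<le> h1 b"
    if "b \<in> \<Lambda>1" "v \<in> V b" for b v
    using V that by (simp_all add: atomic_dec_def)
  have U2: "(\<Sum>i\<in>{1..k}. (u i)\<^sup>2) \<le> (\<sigma>2 a)\<^sup>2" "real (card {i \<in> {1..k}. u i \<noteq> 0}) \<le> h2 a"
    if "a \<in> \<Lambda>2" "u \<in> U a" for a u
    using U that by (simp_all add: atomic_dec_def)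
  have Vsgn: "\<exists>w\<in>V b. \<forall>i\<in>{1..m}. w i = s i * v i" if "b \<in> \<Lambda>1" "v \<in> V b" "\<forall>i\<in>{1..m}. \<bar>s i\<bar> = 1" for b v s
    using V that unfolding atomic_dec_def by blast
  have Vcov: "\<exists>v. (\<forall>b\<in>\<Lambda>1. v b \<in> V b) \<and> (\<forall>i\<in>{1..m}. \<bar>x i\<bar> \<le> (\<Sum>b\<in>\<Lambda>1. v b i))"
    if "x \<in> lp_ball r {1..m}" for x
    using V that unfolding atomic_dec_def by blast
  have Ucov: "\<exists>u. (\<forall>a\<in>\<Lambda>2. u a \<in> U a) \<and> (\<forall>j\<in>{1..k}. \<bar>x j\<bar> \<le> (\<Sum>a\<in>\<Lambda>2. u a j))"
    if "x \<in> lp_ball t {1..k}" for x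
    using U that unfolding atomic_dec_def by blast
  let ?g = "\<lambda>u v (i, j). if u j = 0 then 0 else u j * v j i"
  let ?K = "\<lambda>u. {j \<in> {1..k}. u j \<noteq> 0}"
  have finite_PiE_V: "finite (PiE (?K u) (\<lambda>_. V b))" if "b \<in> \<Lambda>1" for u b
    using V1(1)[OF that] by (intro finite_PiE) auto
  have card: "real (card (tensor_atoms m k (V b) (U a))) \<le> exp (2 * (h1 b * h2 a))" if b: "b \<in> \<Lambda>1" and a: "a \<in> \<Lambda>2" for a b
  proof -
    have each: "real (card (?g u ` PiE (?K u) (\<lambda>_. V b))) \<le> exp (h1 b * h2 a)" if u: "u \<in> U a" for u
    proof -
      have "real (card (?g u ` PiE (?K u) (\<lambda>_. V b))) \<le> real (card (PiE (?K u) (\<lambda>_. V b)))"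
        unfolding of_nat_le_iff by (rule card_image_le[OF finite_PiE_V[OF b]])
      also have "\<dots> = real (card (V b)) ^ card (?K u)" by (simp add: card_PiE)
      also have "\<dots> \<le> exp (h1 b) ^ card (?K u)" using V1[OF b] by (intro power_mono) auto
      also have "\<dots> = exp (real (card (?K u)) * h1 b)" by (simp add: exp_of_nat_mult)
      also have "\<dots> \<le> exp (h1 b * h2 a)"
        using mult_right_mono[OF U2(2)[OF a u], of "h1 b"] V1(4)[OF b]
        unfolding exp_le_cancel_iff by (simp only: mult.commute)
      finally show ?thesis .
    qed
    have "real (card (tensor_atoms m k (V b) (U a))) \<le> (\<Sum>u\<in>U a. real (card (?g u ` PiE (?K u) (\<lambda>_. V b))))"
      unfolding tensor_atoms_def of_nat_sum[symmetric] of_nat_le_iff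
      using U1(1)[OF a] by (rule card_UN_le)
    also have "\<dots> \<le> (\<Sum>u\<in>U a. exp (h1 b * h2 a))" by (intro sum_mono each)
    also have "\<dots> = real (card (U a)) * exp (h1 b * h2 a)" by simp
    also have "\<dots> \<le> exp (h2 a) * exp (h1 b * h2 a)" using U1[OF a] by (intro mult_right_mono) auto
    also have "\<dots> = exp (1 * h2 a + h1 b * h2 a)" by (simp add: exp_add)
    also have "\<dots> \<le> exp (h1 b * h2 a + h1 b * h2 a)"
      using U1(4)[OF a] V1(4)[OF b] unfolding exp_le_cancel_iff by (intro add_right_mono mult_right_mono) auto
    finally show ?thesis by simp
  qed
  have sq: "(\<Sum>i\<in>{1..m} \<times> {1..k}. (w i)\<^sup>2) \<le> (\<sigma>1 b * \<sigma>2 a)\<^sup>2"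
    if b: "b \<in> \<Lambda>1" and a: "a \<in> \<Lambda>2" and w: "w \<in> tensor_atoms m k (V b) (U a)" for a b w
  proof -
    obtain u v where uv: "u \<in> U a" "v \<in> PiE (?K u) (\<lambda>_. V b)" "w = ?g u v"
      using w unfolding tensor_atoms_def by blast
    have "(\<Sum>i\<in>{1..m} \<times> {1..k}. (w i)\<^sup>2) = (\<Sum>i\<in>{1..m}. \<Sum>j\<in>{1..k}. (w (i, j))\<^sup>2)"
      by (simp add: sum.cartesian_product)
    also have "\<dots> = (\<Sum>j\<in>{1..k}. \<Sum>i\<in>{1..m}. (w (i, j))\<^sup>2)" by (rule sum.swap)
    also have "\<dots> \<le> (\<Sum>j\<in>{1..k}. (u j)\<^sup>2 * (\<sigma>1 b)\<^sup>2)"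
    proof (rule sum_mono)
      fix j assume j: "j \<in> {1..k}"
      show "(\<Sum>i\<in>{1..m}. (w (i, j))\<^sup>2) \<le> (u j)\<^sup>2 * (\<sigma>1 b)\<^sup>2"
      proof (cases "u j = 0")
        case False
        then have "v j \<in> V b" using uv(2) j by (auto dest!: PiE_mem)
        moreover have "(\<Sum>i\<in>{1..m}. (w (i, j))\<^sup>2) = (u j)\<^sup>2 * (\<Sum>i\<in>{1..m}. (v j i)\<^sup>2)"
          using False by (simp add: uv(3) power_mult_distrib sum_distrib_left)
        ultimately show ?thesis using V2(1)[OF b] by (simp add: mult_left_mono)
      qed (simp add: uv(3))
    qed
    also have "\<dots> = (\<Sum>j\<in>{1..k}. (u j)\<^sup>2) * (\<sigma>1 b)\<^sup>2" by (simp add: sum_distrib_right)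
    also have "\<dots> \<le> (\<sigma>2 a)\<^sup>2 * (\<sigma>1 b)\<^sup>2" using U2(1)[OF a uv(1)] by (intro mult_right_mono) auto
    finally show ?thesis by (simp add: power_mult_distrib mult.commute)
  qed
  have supp: "real (card {i \<in> {1..m} \<times> {1..k}. w i \<noteq> 0}) \<le> 2 * (h1 b * h2 a)"
    if b: "b \<in> \<Lambda>1" and a: "a \<in> \<Lambda>2" and w: "w \<in> tensor_atoms m k (V b) (U a)" for a b w
  proof -
    obtain u v where uv: "u \<in> U a" "v \<in> PiE (?K u) (\<lambda>_. V b)" "w = ?g u v"
      using w unfolding tensor_atoms_def by blast
    have "{i \<in> {1..m} \<times> {1..k}. w i \<noteq> 0} = (\<Union>j\<in>?K u. (\<lambda>i. (i, j)) ` {i \<in> {1..m}. v j i \<noteq> 0})"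
      by (auto simp: uv(3) split: if_splits)
    then have "card {i \<in> {1..m} \<times> {1..k}. w i \<noteq> 0} \<le> (\<Sum>j\<in>?K u. card ((\<lambda>i. (i, j)) ` {i \<in> {1..m}. v j i \<noteq> 0}))"
      by (simp only:) (rule card_UN_le, simp)
    also have "\<dots> = (\<Sum>j\<in>?K u. card {i \<in> {1..m}. v j i \<noteq> 0})"
      by (intro sum.cong refl card_image) (auto simp: inj_on_def)
    finally have "real (card {i \<in> {1..m} \<times> {1..k}. w i \<noteq> 0}) \<le> (\<Sum>j\<in>?K u. real (card {i \<in> {1..m}. v j i \<noteq> 0}))"
      unfolding of_nat_sum[symmetric] of_nat_le_iff .
    also have "\<dots> \<le> (\<Sum>j\<in>?K u. h1 b)"
      using uv(2) by (intro sum_mono V2(2)[OF b]) (auto dest!: PiE_mem)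
    also have "\<dots> = real (card (?K u)) * h1 b" by simp
    also have "\<dots> \<le> h2 a * h1 b" using U2(2)[OF a uv(1)] V1(4)[OF b] by (intro mult_right_mono) auto
    also have "\<dots> \<le> 2 * (h1 b * h2 a)" using V1(4)[OF b] U1(4)[OF a] by simp
    finally show ?thesis .
  qed
  have sgn: "\<exists>w'\<in>tensor_atoms m k (V b) (U a). \<forall>i\<in>{1..m} \<times> {1..k}. w' i = s i * w i"
    if b: "b \<in> \<Lambda>1" and a: "a \<in> \<Lambda>2" and w: "w \<in> tensor_atoms m k (V b) (U a)"
      and s: "\<forall>i\<in>{1..m} \<times> {1..k}. \<bar>s i\<bar> = 1" for a b w s
  proof -
    obtain u v where uv: "u \<in> U a" "v \<in> PiE (?K u) (\<lambda>_. V b)" "w = ?g u v"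
      using w unfolding tensor_atoms_def by blast
    have "\<forall>j\<in>?K u. \<exists>z\<in>V b. \<forall>i\<in>{1..m}. z i = s (i, j) * v j i"
    proof
      fix j assume j: "j \<in> ?K u"
      then have "v j \<in> V b" using uv(2) by (auto dest!: PiE_mem)
      then show "\<exists>z\<in>V b. \<forall>i\<in>{1..m}. z i = s (i, j) * v j i"
        using s j by (intro Vsgn[OF b]) auto
    qed
    then have "\<forall>j\<in>?K u. \<exists>z. z \<in> V b \<and> (\<forall>i\<in>{1..m}. z i = s (i, j) * v j i)" by blast
    from bchoice[OF this]
    obtain z where z: "\<forall>j\<in>?K u. z j \<in> V b \<and> (\<forall>i\<in>{1..m}. z j i = s (i, j) * v j i)" by blast
    have "?g u (restrict z (?K u)) \<in> tensor_atoms m k (V b) (U a)"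
      using z by (intro tensor_atomsI uv(1)) auto
    moreover have "?g u (restrict z (?K u)) ij = s ij * w ij" if "ij \<in> {1..m} \<times> {1..k}" for ij
      using that z by (cases ij) (auto simp: uv(3))
    ultimately show ?thesis by blast
  qed
  have cover: "\<exists>u. (\<forall>c\<in>\<Lambda>1 \<times> \<Lambda>2. u c \<in> (case c of (b, a) \<Rightarrow> tensor_atoms m k (V b) (U a)))
      \<and> (\<forall>i\<in>{1..m} \<times> {1..k}. \<bar>x i\<bar> \<le> (\<Sum>c\<in>\<Lambda>1 \<times> \<Lambda>2. u c i))"
    if x: "x \<in> mixed_ball r t m k" for x
  proof -
    \<comment> \<open>The vector of column norms lies in the outer ball and the normalized columns
      \<open>z j\<close> lie in the inner one; both are decomposed and multiplied. For
      \<open>T j = 0\<close> the column is zero, and division by zero makes \<open>z j\<close> zero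
      too.\<close>
    define T where "T j = (\<Sum>i=1..m. \<bar>x (i, j)\<bar> powr r) powr (1 / r)" for j
    define z where "z j i = x (i, j) / T j" for j i
    have T0: "T j \<ge> 0" for j by (simp add: T_def)
    have Tr: "T j powr r = (\<Sum>i=1..m. \<bar>x (i, j)\<bar> powr r)" for j
      using r by (simp add: T_def powr_powr sum_nonneg)
    have zero: "x (i, j) = 0" if "T j = 0" "i \<in> {1..m}" for i j
    proof -
      have "(\<Sum>i=1..m. \<bar>x (i, j)\<bar> powr r) = 0" using Tr[of j] that(1) r by simp
      then have "\<forall>i\<in>{1..m}. \<bar>x (i, j)\<bar> powr r = 0" by (subst (asm) sum_nonneg_eq_0_iff) auto
      then show ?thesis using that by simp
    qed
    have "T \<in> lp_ball t {1..k}"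
    proof -
      have "(\<Sum>j=1..k. \<bar>T j\<bar> powr t) = (\<Sum>j=1..k. (\<Sum>i=1..m. \<bar>x (i, j)\<bar> powr r) powr (t / r))"
        by (intro sum.cong refl) (simp add: T_def powr_powr)
      then show ?thesis using x by (simp add: lp_ball_def mixed_ball_def)
    qed
    then obtain u where u: "\<forall>a\<in>\<Lambda>2. u a \<in> U a" "\<forall>j\<in>{1..k}. \<bar>T j\<bar> \<le> (\<Sum>a\<in>\<Lambda>2. u a j)"
      using Ucov by blast
    have "\<forall>j. \<exists>v. (\<forall>b\<in>\<Lambda>1. v b \<in> V b) \<and> (\<forall>i\<in>{1..m}. \<bar>z j i\<bar> \<le> (\<Sum>b\<in>\<Lambda>1. v b i))"
    proof
      fix j
      have "z j \<in> lp_ball r {1..m}"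
      proof (cases "T j = 0")
        case False
        have "(\<Sum>i=1..m. \<bar>z j i\<bar> powr r) = (\<Sum>i=1..m. \<bar>x (i, j)\<bar> powr r / T j powr r)"
          using T0[of j] by (simp add: z_def powr_divide)
        also have "\<dots> = (\<Sum>i=1..m. \<bar>x (i, j)\<bar> powr r) / T j powr r" by (simp add: sum_divide_distrib)
        also have "\<dots> \<le> 1" unfolding Tr[symmetric] using False by simp
        finally show ?thesis by (simp add: lp_ball_def)
      qed (simp add: z_def lp_ball_def)
      then show "\<exists>v. (\<forall>b\<in>\<Lambda>1. v b \<in> V b) \<and> (\<forall>i\<in>{1..m}. \<bar>z j i\<bar> \<le> (\<Sum>b\<in>\<Lambda>1. v b i))" by (rule Vcov)
    qed
    from choice[OF this]
    obtain v where v: "\<forall>j. (\<forall>b\<in>\<Lambda>1. v j b \<in> V b) \<and> (\<forall>i\<in>{1..m}. \<bar>z j i\<bar> \<le> (\<Sum>b\<in>\<Lambda>1. v j b i))"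
      by blast
    define w where "w = (\<lambda>(b, a). ?g (u a) (\<lambda>j\<in>?K (u a). v j b))"
    have "w (b, a) \<in> tensor_atoms m k (V b) (U a)" if "b \<in> \<Lambda>1" "a \<in> \<Lambda>2" for a b
      unfolding w_def prod.case using u(1) v that by (intro tensor_atomsI) auto
    moreover have "\<bar>x (i, j)\<bar> \<le> (\<Sum>c\<in>\<Lambda>1 \<times> \<Lambda>2. w c (i, j))" if ij: "i \<in> {1..m}" "j \<in> {1..k}" for i j
    proof -
      have w: "w (b, a) (i, j) = v j b i * u a j" for a b using ij by (auto simp: w_def)
      have "\<bar>x (i, j)\<bar> = \<bar>z j i\<bar> * \<bar>T j\<bar>" using zero[of j i] ij by (cases "T j = 0") (auto simp: z_def)
      also have "\<dots> \<le> (\<Sum>b\<in>\<Lambda>1. v j b i) * (\<Sum>a\<in>\<Lambda>2. u a j)"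
      proof (rule mult_mono)
        show z: "\<bar>z j i\<bar> \<le> (\<Sum>b\<in>\<Lambda>1. v j b i)" using v ij by blast
        show "0 \<le> (\<Sum>b\<in>\<Lambda>1. v j b i)" using z by linarith
      qed (use u ij in auto)
      also have "\<dots> = (\<Sum>c\<in>\<Lambda>1 \<times> \<Lambda>2. w c (i, j))"
        by (simp add: sum_product sum.cartesian_product w[symmetric] case_prod_unfold)
      finally show ?thesis .
    qed
    ultimately show ?thesis by (intro exI[of _ w]) auto
  qed
  have base: "finite (tensor_atoms m k (V b) (U a)) \<and> tensor_atoms m k (V b) (U a) \<noteq> {} \<and>
      real (card (tensor_atoms m k (V b) (U a))) \<le> exp (2 * (h1 b * h2 a)) \<and>
      1 \<le> 2 * (h1 b * h2 a) \<and> 0 < \<sigma>1 b * \<sigma>2 a"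
    if b: "b \<in> \<Lambda>1" and a: "a \<in> \<Lambda>2" for a b
  proof (intro conjI)
    show "finite (tensor_atoms m k (V b) (U a))"
      unfolding tensor_atoms_def using U1(1)[OF a] finite_PiE_V[OF b] by (intro finite_UN_I finite_imageI)
    obtain u v0 where "u \<in> U a" "v0 \<in> V b" using U1(2)[OF a] V1(2)[OF b] by blast
    then have "?g u (\<lambda>j\<in>?K u. v0) \<in> tensor_atoms m k (V b) (U a)"
      by (intro tensor_atomsI) auto
    then show "tensor_atoms m k (V b) (U a) \<noteq> {}" by blast
    show "real (card (tensor_atoms m k (V b) (U a))) \<le> exp (2 * (h1 b * h2 a))" by (rule card[OF b a])
    have "1 * 1 \<le> h1 b * h2 a" using V1(4)[OF b] U1(4)[OF a] by (intro mult_mono) auto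
    then show "1 \<le> 2 * (h1 b * h2 a)" by simp
    show "0 < \<sigma>1 b * \<sigma>2 a" using V1(5)[OF b] U1(5)[OF a] by simp
  qed
  have pairs: "(\<forall>c\<in>\<Lambda>1 \<times> \<Lambda>2. P c) \<longleftrightarrow> (\<forall>b\<in>\<Lambda>1. \<forall>a\<in>\<Lambda>2. P (b, a))" for P by blast
  show ?thesis
    unfolding atomic_dec_def pairs prod.case
    using base sq supp sgn cover[unfolded pairs prod.case] by (intro conjI ballI allI impI) blast+
qed

lemma tensor_sums:
  shows "(\<Sum>c\<in>\<Lambda>1 \<times> \<Lambda>2. case c of (b, a) \<Rightarrow> \<sigma>1 b * \<sigma>2 a) = (\<Sum>b\<in>\<Lambda>1. \<sigma>1 b) * (\<Sum>a\<in>\<Lambda>2. \<sigma>2 a :: real)"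
  and "(\<Sum>c\<in>\<Lambda>1 \<times> \<Lambda>2. (case c of (b, a) \<Rightarrow> \<sigma>1 b * \<sigma>2 a) * sqrt (case c of (b, a) \<Rightarrow> 2 * (h1 b * h2 a)))
    = sqrt 2 * ((\<Sum>b\<in>\<Lambda>1. \<sigma>1 b * sqrt (h1 b)) * (\<Sum>a\<in>\<Lambda>2. \<sigma>2 a * sqrt (h2 a)))"
proof -
  show "(\<Sum>c\<in>\<Lambda>1 \<times> \<Lambda>2. case c of (b, a) \<Rightarrow> \<sigma>1 b * \<sigma>2 a) = (\<Sum>b\<in>\<Lambda>1. \<sigma>1 b) * (\<Sum>a\<in>\<Lambda>2. \<sigma>2 a)"
    by (simp add: sum_product sum.cartesian_product)
  have "(\<Sum>c\<in>\<Lambda>1 \<times> \<Lambda>2. (case c of (b, a) \<Rightarrow> \<sigma>1 b * \<sigma>2 a) * sqrt (case c of (b, a) \<Rightarrow> 2 * (h1 b * h2 a)))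
     = (\<Sum>c\<in>\<Lambda>1 \<times> \<Lambda>2. case c of (b, a) \<Rightarrow> sqrt 2 * ((\<sigma>1 b * sqrt (h1 b)) * (\<sigma>2 a * sqrt (h2 a))))"
    by (intro sum.cong refl) (auto simp: real_sqrt_mult)
  also have "\<dots> = (\<Sum>b\<in>\<Lambda>1. \<Sum>a\<in>\<Lambda>2. sqrt 2 * ((\<sigma>1 b * sqrt (h1 b)) * (\<sigma>2 a * sqrt (h2 a))))"
    by (simp only: sum.cartesian_product)
  also have "\<dots> = sqrt 2 * ((\<Sum>b\<in>\<Lambda>1. \<sigma>1 b * sqrt (h1 b)) * (\<Sum>a\<in>\<Lambda>2. \<sigma>2 a * sqrt (h2 a)))"
    by (simp only: sum_product sum_distrib_left[symmetric])
  finally show "(\<Sum>c\<in>\<Lambda>1 \<times> \<Lambda>2. (case c of (b, a) \<Rightarrow> \<sigma>1 b * \<sigma>2 a) * sqrt (case c of (b, a) \<Rightarrow> 2 * (h1 b * h2 a)))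
    = sqrt 2 * ((\<Sum>b\<in>\<Lambda>1. \<sigma>1 b * sqrt (h1 b)) * (\<Sum>a\<in>\<Lambda>2. \<sigma>2 a * sqrt (h2 a)))" .
qed


subsection \<open>Mixed norms\<close>

definition lp :: "real \<Rightarrow> 'i set \<Rightarrow> ('i \<Rightarrow> real) \<Rightarrow> real" where
  "lp r I a = (\<Sum>i\<in>I. \<bar>a i\<bar> powr r) powr (1 / r)"

definition mnorm :: "real \<Rightarrow> real \<Rightarrow> nat \<Rightarrow> nat \<Rightarrow> (nat \<times> nat \<Rightarrow> real) \<Rightarrow> real" where
  "mnorm p q m k f = lp q {1..k} (\<lambda>j. lp p {1..m} (\<lambda>i. f (i, j)))"

lemma lp_nonneg [simp]: "lp r I a \<ge> 0"
  by (simp add: lp_def)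

lemma mnorm_nonneg [simp]: "mnorm p q m k f \<ge> 0"
  by (simp add: mnorm_def)

lemma lp_powr: "r > 0 \<Longrightarrow> lp r I a powr r = (\<Sum>i\<in>I. \<bar>a i\<bar> powr r)"
  by (simp add: lp_def powr_powr sum_nonneg)

lemma lp_powr_divide: "lp p I a powr q = (\<Sum>i\<in>I. \<bar>a i\<bar> powr p) powr (q / p)"
  by (simp add: lp_def powr_powr)

lemma lmk_norm_eq_mnorm: "lmk_norm p q m k x = mnorm p q m k (Poly_Mapping.lookup x)"
  by (simp add: lmk_norm_def mnorm_def lp_def[of q] lp_powr_divide)

lemma mnorm_powr:
  assumes "q > 0"
  shows "mnorm p q m k f powr q = (\<Sum>j=1..k. (\<Sum>i=1..m. \<bar>f (i, j)\<bar> powr p) powr (q / p))"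
  unfolding mnorm_def
  by (subst lp_powr[OF assms]) (simp only: abs_of_nonneg[OF lp_nonneg] lp_powr_divide)

lemma mixed_ball_iff:
  assumes "q > 0"
  shows "f \<in> mixed_ball p q m k \<longleftrightarrow> mnorm p q m k f \<le> 1"
proof -
  have "mnorm p q m k f powr q \<le> 1 \<longleftrightarrow> mnorm p q m k f \<le> 1"
    using powr_mono2[of q "mnorm p q m k f" 1] powr_less_mono2[of q 1 "mnorm p q m k f"] assms
    by (cases "mnorm p q m k f \<le> 1") (auto simp: not_le)
  then show ?thesis unfolding mixed_ball_def mem_Collect_eq mnorm_powr[OF assms] .
qed

lemma lp_mono:
  assumes "r > 0" "\<And>i. i \<in> I \<Longrightarrow> \<bar>a i\<bar> \<le> \<bar>b i\<bar>"
  shows "lp r I a \<le> lp r I b"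
  unfolding lp_def using assms by (intro powr_mono2 sum_mono sum_nonneg) auto

lemma lp_cmult:
  assumes "r > 0" "c \<ge> 0"
  shows "lp r I (\<lambda>i. c * a i) = c * lp r I a"
proof -
  have "(\<Sum>i\<in>I. \<bar>c * a i\<bar> powr r) = c powr r * (\<Sum>i\<in>I. \<bar>a i\<bar> powr r)"
    using assms by (simp add: abs_mult powr_mult sum_distrib_left)
  then show ?thesis using assms by (simp add: lp_def powr_mult powr_powr sum_nonneg)
qed

lemma lp_coord_le:
  assumes "r > 0" "finite I" "i \<in> I"
  shows "\<bar>a i\<bar> \<le> lp r I a"
proof -
  have "\<bar>a i\<bar> powr r \<le> (\<Sum>i\<in>I. \<bar>a i\<bar> powr r)" using assms by (intro member_le_sum) auto
  then have "(\<bar>a i\<bar> powr r) powr (1 / r) \<le> lp r I a"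
    unfolding lp_def using assms by (intro powr_mono2) auto
  then show ?thesis using assms by (simp add: powr_powr)
qed

text \<open>No coordinate exceeds the l_s norm T, so \<bar>a i\<bar>^r \<le> \<bar>a i\<bar>^s
  T^(r-s), and summation gives T^r.\<close>

lemma lp_antimono:
  assumes s: "0 < s" "s \<le> r" and I: "finite I"
  shows "lp r I a \<le> lp s I a"
proof -
  define T where "T = lp s I a"
  have T: "T \<ge> 0" "T powr s = (\<Sum>i\<in>I. \<bar>a i\<bar> powr s)" using s by (simp_all add: T_def lp_powr)
  have "(\<Sum>i\<in>I. \<bar>a i\<bar> powr r) \<le> (\<Sum>i\<in>I. \<bar>a i\<bar> powr s * T powr (r - s))"
  proof (rule sum_mono)
    fix i assume i: "i \<in> I"
    have "\<bar>a i\<bar> powr r = \<bar>a i\<bar> powr s * \<bar>a i\<bar> powr (r - s)" by (simp add: powr_add[symmetric])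
    also have "\<dots> \<le> \<bar>a i\<bar> powr s * T powr (r - s)"
      unfolding T_def using s I i by (intro mult_left_mono powr_mono2 lp_coord_le) auto
    finally show "\<bar>a i\<bar> powr r \<le> \<bar>a i\<bar> powr s * T powr (r - s)" .
  qed
  also have "\<dots> = T powr s * T powr (r - s)" by (simp add: T sum_distrib_right)
  also have "\<dots> = T powr r" by (simp add: powr_add[symmetric])
  finally have "lp r I a \<le> (T powr r) powr (1 / r)"
    unfolding lp_def using s by (intro powr_mono2 sum_nonneg) auto
  then show ?thesis using s T by (simp add: powr_powr T_def)
qed

lemma mnorm_mono:
  assumes "p > 0" "q > 0" "\<And>i j. i \<in> {1..m} \<Longrightarrow> j \<in> {1..k} \<Longrightarrow> \<bar>f (i, j)\<bar> \<le> \<bar>g (i, j)\<bar>"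
  shows "mnorm p q m k f \<le> mnorm p q m k g"
  unfolding mnorm_def using assms by (intro lp_mono) (auto intro!: lp_mono)

lemma mnorm_antimono:
  assumes "0 < p1" "p1 \<le> p2" "0 < q1" "q1 \<le> q2"
  shows "mnorm p2 q2 m k f \<le> mnorm p1 q1 m k f"
proof -
  have "mnorm p2 q2 m k f \<le> lp q2 {1..k} (\<lambda>j. lp p1 {1..m} (\<lambda>i. f (i, j)))"
    unfolding mnorm_def using assms by (intro lp_mono) (auto intro!: lp_antimono)
  also have "\<dots> \<le> mnorm p1 q1 m k f"
    unfolding mnorm_def using assms by (intro lp_antimono) auto
  finally show ?thesis .
qed

lemma mnorm_coord_le:
  assumes "p > 0" "q > 0" "i \<in> {1..m}" "j \<in> {1..k}"
  shows "\<bar>f (i, j)\<bar> \<le> mnorm p q m k f"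
proof -
  have "\<bar>f (i, j)\<bar> \<le> lp p {1..m} (\<lambda>i. f (i, j))" using assms lp_coord_le[of p "{1..m}" i "\<lambda>i. f (i, j)"] by simp
  also have "\<dots> \<le> \<bar>lp p {1..m} (\<lambda>i. f (i, j))\<bar>" by simp
  also have "\<dots> \<le> mnorm p q m k f"
    unfolding mnorm_def using assms by (intro lp_coord_le[where a = "\<lambda>j. lp p {1..m} (\<lambda>i. f (i, j))"]) auto
  finally show ?thesis .
qed

text \<open>Young's inequality against the mean of the \<open>\<bar>a i\<bar> powr r\<close>.\<close>

lemma lp_le_lp:
  assumes s: "0 < s" "s \<le> r" and I: "finite I" "card I = N" and N: "N \<ge> 1"
  shows "lp s I a \<le> N powr (1 / s - 1 / r) * lp r I a"
proof -
  define T where "T = (\<Sum>i\<in>I. \<bar>a i\<bar> powr r)"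
  have T0: "T \<ge> 0" by (simp add: T_def sum_nonneg)
  show ?thesis
  proof (cases "T = 0")
    case True
    then have "\<forall>i\<in>I. \<bar>a i\<bar> powr r = 0" unfolding T_def using I by (subst (asm) sum_nonneg_eq_0_iff) auto
    then have "lp s I a = 0" by (simp add: lp_def)
    then show ?thesis by simp
  next
    case False
    with T0 have T: "T > 0" by simp
    define \<theta> where "\<theta> = s / r"
    have \<theta>: "0 < \<theta>" "\<theta> \<le> 1" using s by (auto simp: \<theta>_def)
    have TN: "T / N > 0" using T N by simp
    have "\<bar>a i\<bar> powr s * (T / N) powr (1 - \<theta>) \<le> \<theta> * \<bar>a i\<bar> powr r + (1 - \<theta>) * (T / N)" for i
    proof (cases "a i = 0")
      case True
      have "(1 - \<theta>) * (T / N) \<ge> 0" using \<theta> TN by (intro mult_nonneg_nonneg) auto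
      then show ?thesis using True by simp
    next
      case False
      have "(\<bar>a i\<bar> powr r) powr \<theta> = \<bar>a i\<bar> powr s" using s by (simp add: powr_powr \<theta>_def)
      then show ?thesis
        using Youngs_inequality_0[of \<theta> "1 - \<theta>" "\<bar>a i\<bar> powr r" "T / N"] \<theta> TN False by simp
    qed
    then have "(\<Sum>i\<in>I. \<bar>a i\<bar> powr s * (T / N) powr (1 - \<theta>)) \<le> (\<Sum>i\<in>I. \<theta> * \<bar>a i\<bar> powr r + (1 - \<theta>) * (T / N))"
      by (intro sum_mono)
    also have "\<dots> = \<theta> * T + N * ((1 - \<theta>) * (T / N))"
      by (simp only: sum.distrib sum_distrib_left[symmetric] T_def[symmetric] sum_constant I(2))
        (simp only: mult_ac)
    also have "\<dots> = T" using N by (simp add: field_simps)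
    finally have "(\<Sum>i\<in>I. \<bar>a i\<bar> powr s) * (T / N) powr (1 - \<theta>) \<le> T" by (simp add: sum_distrib_right)
    then have "(\<Sum>i\<in>I. \<bar>a i\<bar> powr s) \<le> T / (T / N) powr (1 - \<theta>)" 
      by (subst pos_le_divide_eq) (use T N in auto)
    also have "\<dots> = T powr 1 / (T powr (1 - \<theta>) / N powr (1 - \<theta>))" using T N by (simp add: powr_divide)
    also have "\<dots> = N powr (1 - \<theta>) * (T powr 1 / T powr (1 - \<theta>))" by simp
    also have "T powr 1 / T powr (1 - \<theta>) = T powr \<theta>" unfolding powr_diff[symmetric] by simp
    finally have "lp s I a \<le> (N powr (1 - \<theta>) * T powr \<theta>) powr (1 / s)"
      unfolding lp_def using s by (intro powr_mono2 sum_nonneg) auto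
    also have "\<dots> = N powr ((1 - \<theta>) * (1 / s)) * T powr (\<theta> * (1 / s))"
      by (simp add: powr_mult powr_powr)
    also have "(1 - \<theta>) * (1 / s) = 1 / s - 1 / r" using s by (simp add: \<theta>_def field_simps)
    also have "\<theta> * (1 / s) = 1 / r" using s by (simp add: \<theta>_def)
    finally show ?thesis by (simp add: lp_def T_def)
  qed
qed

lemma mnorm_le_mnorm:
  assumes p: "0 < p1" "p1 \<le> p2" and q: "0 < q1" "q1 \<le> q2" and mk: "m \<ge> 1" "k \<ge> 1"
  shows "mnorm p1 q1 m k f \<le> m powr (1 / p1 - 1 / p2) * k powr (1 / q1 - 1 / q2) * mnorm p2 q2 m k f"
proof -
  have "mnorm p1 q1 m k f \<le> lp q1 {1..k} (\<lambda>j. m powr (1 / p1 - 1 / p2) * lp p2 {1..m} (\<lambda>i. f (i, j)))"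
    unfolding mnorm_def
  proof (rule lp_mono[OF q(1)])
    fix j
    have "lp p1 {1..m} (\<lambda>i. f (i, j)) \<le> m powr (1 / p1 - 1 / p2) * lp p2 {1..m} (\<lambda>i. f (i, j))"
      using p mk by (intro lp_le_lp) auto
    then show "\<bar>lp p1 {1..m} (\<lambda>i. f (i, j))\<bar> \<le> \<bar>m powr (1 / p1 - 1 / p2) * lp p2 {1..m} (\<lambda>i. f (i, j))\<bar>"
      by simp
  qed
  also have "\<dots> = m powr (1 / p1 - 1 / p2) * lp q1 {1..k} (\<lambda>j. lp p2 {1..m} (\<lambda>i. f (i, j)))"
    using q by (intro lp_cmult) auto
  also have "\<dots> \<le> m powr (1 / p1 - 1 / p2) * (k powr (1 / q1 - 1 / q2) * mnorm p2 q2 m k f)"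
    unfolding mnorm_def using q mk by (intro mult_left_mono lp_le_lp) auto
  finally show ?thesis by (simp add: mult.assoc)
qed

lemma sum_pairs: "(\<Sum>i\<in>{1..m} \<times> {1..k}. g i) = (\<Sum>j=1..k. \<Sum>i=1..m. g (i, j))" for g :: "nat \<times> nat \<Rightarrow> real"
proof -
  have "(\<Sum>i\<in>{1..m} \<times> {1..k}. g i) = (\<Sum>i=1..m. \<Sum>j=1..k. g (i, j))"
    by (simp add: sum.cartesian_product)
  also have "\<dots> = (\<Sum>j=1..k. \<Sum>i=1..m. g (i, j))" by (rule sum.swap)
  finally show ?thesis .
qed

lemma mnorm_2_2: "mnorm 2 2 m k f = sqrt (\<Sum>i\<in>{1..m} \<times> {1..k}. (f i)\<^sup>2)"
proof -
  have "mnorm 2 2 m k f powr 2 = (\<Sum>j=1..k. \<Sum>i=1..m. (f (i, j))\<^sup>2)"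
    by (subst mnorm_powr) (simp_all add: powr_numeral sum_nonneg)
  then have "(mnorm 2 2 m k f)\<^sup>2 = (\<Sum>i\<in>{1..m} \<times> {1..k}. (f i)\<^sup>2)"
    unfolding sum_pairs by (simp add: powr_numeral)
  then show ?thesis by (metis mnorm_nonneg real_sqrt_unique)
qed

text \<open>It suffices to exhibit the extremal functional. With c j the norm of column j, it is sgn
  (w (i, j)) \<bar>w (i, j)\<bar>^(p-1) (c j)^(q-p), where the last factor adjusts the columns to
  the outer exponent; the scalar \<open>b\<close> puts it on the dual unit sphere, where its pairing
  with w is the norm of w.\<close>

lemma mnorm_le_of_dual:
  assumes p: "p > 1" and q: "q > 1" and \<epsilon>: "\<epsilon> \<ge> 0"
    and dual: "\<And>y. y \<in> mixed_ball (p / (p - 1)) (q / (q - 1)) m k \<Longrightarrow> (\<Sum>i\<in>{1..m} \<times> {1..k}. w i * y i) \<le> \<epsilon>"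
  shows "mnorm p q m k w \<le> \<epsilon>"
proof -
  define p' where "p' = p / (p - 1)"
  define q' where "q' = q / (q - 1)"
  have p': "p' > 0" "(p - 1) * p' = p" using p by (simp_all add: p'_def)
  have q': "q' > 0" "(q - 1) * q' = q" using q by (simp_all add: q'_def)
  define c where "c j = lp p {1..m} (\<lambda>i. w (i, j))" for j
  have cp: "c j powr p = (\<Sum>i=1..m. \<bar>w (i, j)\<bar> powr p)" for j using p by (simp add: c_def lp_powr)
  have c0: "c j \<ge> 0" for j by (simp add: c_def)
  define S where "S = (\<Sum>j=1..k. c j powr q)"
  have S0: "S \<ge> 0" by (simp add: S_def sum_nonneg)
  have norm: "mnorm p q m k w = S powr (1 / q)" by (simp add: mnorm_def lp_def[of q] S_def c_def)
  show ?thesis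
  proof (cases "S = 0")
    case True then show ?thesis using norm \<epsilon> by simp
  next
    case False
    with S0 have S: "S > 0" by simp
    define b where "b = S powr (- 1 / q')"
    have b: "b > 0" using S by (simp add: b_def)
    define y where "y = (\<lambda>(i, j). sgn (w (i, j)) * \<bar>w (i, j)\<bar> powr (p - 1) * (c j powr (q - p) * b))"
    have col: "(\<Sum>i=1..m. \<bar>y (i, j)\<bar> powr p') powr (q' / p') = c j powr q / S" for j
    proof -
      have "\<bar>y (i, j)\<bar> powr p' = \<bar>w (i, j)\<bar> powr p * (c j powr (q - p) * b) powr p'" for i
      proof (cases "w (i, j) = 0")
        case False
        then have "\<bar>y (i, j)\<bar> = \<bar>w (i, j)\<bar> powr (p - 1) * (c j powr (q - p) * b)"
          using b by (simp add: y_def abs_mult abs_sgn_eq)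
        then show ?thesis using b p' by (simp add: powr_mult powr_powr)
      qed (simp add: y_def)
      then have "(\<Sum>i=1..m. \<bar>y (i, j)\<bar> powr p') = c j powr p * (c j powr (q - p) * b) powr p'"
        by (simp add: cp sum_distrib_right)
      then have "(\<Sum>i=1..m. \<bar>y (i, j)\<bar> powr p') powr (q' / p') = c j powr (p * (q' / p')) * (c j powr (q - p) * b) powr q'"
        using p' b by (simp add: powr_mult powr_powr)
      also have "\<dots> = c j powr (p * (q' / p')) * c j powr ((q - p) * q') * b powr q'"
        using b by (simp add: powr_mult powr_powr)
      also have "\<dots> = c j powr (p * (q' / p') + (q - p) * q') * b powr q'" by (simp add: powr_add)
      also have "p * (q' / p') + (q - p) * q' = q"
      proof -
        have "p * (q' / p') = (p - 1) * q'" using p by (simp add: p'_def)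
        then show ?thesis using q'(2) by (simp add: algebra_simps)
      qed
      also have "b powr q' = 1 / S" using S q' 
      proof -
        have "- 1 / q' * q' = - 1" using q' by simp
        then show ?thesis unfolding b_def powr_powr using S by (simp add: powr_minus_divide)
      qed
      finally show ?thesis by simp
    qed
    have "y \<in> mixed_ball p' q' m k"
    proof -
      have "(\<Sum>j=1..k. c j powr q / S) = 1" 
        unfolding sum_divide_distrib[symmetric] S_def[symmetric] using S by simp
      then show ?thesis unfolding mixed_ball_def mem_Collect_eq col by linarith
    qed
    then have "(\<Sum>i\<in>{1..m} \<times> {1..k}. w i * y i) \<le> \<epsilon>" unfolding p'_def q'_def by (rule dual)
    moreover have "(\<Sum>i\<in>{1..m} \<times> {1..k}. w i * y i) = S powr (1 / q)"
    proof -
      have "(\<Sum>i=1..m. w (i, j) * y (i, j)) = c j powr q * b" for j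
      proof -
        have "w (i, j) * y (i, j) = \<bar>w (i, j)\<bar> powr p * (c j powr (q - p) * b)" for i
        proof (cases "w (i, j) = 0")
          case False
          have "\<bar>w (i, j)\<bar> * \<bar>w (i, j)\<bar> powr (p - 1) = \<bar>w (i, j)\<bar> powr p"
            using False powr_add[of "\<bar>w (i, j)\<bar>" 1 "p - 1"] by simp
          moreover have "w (i, j) * sgn (w (i, j)) = \<bar>w (i, j)\<bar>" by (simp add: abs_sgn)
          ultimately show ?thesis by (simp add: y_def mult.assoc[symmetric])
        qed (simp add: y_def)
        then have "(\<Sum>i=1..m. w (i, j) * y (i, j)) = c j powr p * c j powr (q - p) * b"
          by (simp add: cp sum_distrib_right mult.assoc)
        then show ?thesis by (simp add: powr_add[symmetric])
      qed
      then have "(\<Sum>i\<in>{1..m} \<times> {1..k}. w i * y i) = S * b" 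
        by (simp only: sum_pairs S_def sum_distrib_right)
      also have "\<dots> = S powr (1 + - 1 / q')" using S by (simp only: powr_add powr_one b_def)
      also have "1 + - 1 / q' = 1 / q" using q by (simp add: q'_def field_simps)
      finally show ?thesis .
    qed
    ultimately show ?thesis using norm by simp
  qed
qed

lemma mnorm_cmult:
  assumes "p > 0" "q > 0" "c \<ge> 0"
  shows "mnorm p q m k (\<lambda>i. c * f i) = c * mnorm p q m k f"
  unfolding mnorm_def by (simp only: lp_cmult[OF assms(1,3)] lp_cmult[OF assms(2,3)])

lemma mnorm_le_const:
  assumes "p > 0" "q > 0" "M \<ge> 0" "\<And>i. i \<in> {1..m} \<times> {1..k} \<Longrightarrow> \<bar>f i\<bar> \<le> M"
  shows "mnorm p q m k f \<le> M * mnorm p q m k (\<lambda>_. 1)"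
proof -
  have "mnorm p q m k f \<le> mnorm p q m k (\<lambda>_. M * 1)" using assms by (intro mnorm_mono) auto
  also have "\<dots> = M * mnorm p q m k (\<lambda>_. 1)"
    using assms by (intro mnorm_cmult) auto
  finally show ?thesis .
qed


subsection \<open>The upper bound\<close>

lemma ex_signs_mixed_le:
  assumes p: "p \<ge> 2" and q: "q \<ge> 2"
  shows "\<exists>C>0. \<forall>m\<ge>1. \<forall>k\<ge>1. \<forall>n. real m powr (1/p) * real k powr (1/q) \<le> sqrt n \<longrightarrow>
    (\<exists>e. \<forall>x\<in>mixed_ball (p / (p - 1)) (q / (q - 1)) m k. \<forall>y\<in>mixed_ball (p / (p - 1)) (q / (q - 1)) m k.
      \<bar>offdiag n ({1..m} \<times> {1..k}) e x y\<bar> \<le> C * sqrt n * (real m powr (1/p) * real k powr (1/q)))"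
proof -
  let ?r = "p / (p - 1)" and ?t = "q / (q - 1)"
  have rt: "?r > 0" "?t > 0" using p q by auto
  obtain C1 where C1: "C1 > 0" "\<And>N. N \<ge> 1 \<Longrightarrow> \<exists>\<Lambda> :: nat set. \<exists>U \<sigma> h. 
      atomic_dec (lp_ball ?r {1..N}) {1..N} \<Lambda> U \<sigma> h \<and>
      (\<Sum>a\<in>\<Lambda>. \<sigma> a) \<le> C1 \<and> (\<Sum>a\<in>\<Lambda>. \<sigma> a * sqrt (h a)) \<le> C1 * real N powr (1/p)"
    using atomic_dec_exists[OF p refl] by blast
  obtain C2 where C2: "C2 > 0" "\<And>N. N \<ge> 1 \<Longrightarrow> \<exists>\<Lambda> :: nat set. \<exists>U \<sigma> h. 
      atomic_dec (lp_ball ?t {1..N}) {1..N} \<Lambda> U \<sigma> h \<and>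
      (\<Sum>a\<in>\<Lambda>. \<sigma> a) \<le> C2 \<and> (\<Sum>a\<in>\<Lambda>. \<sigma> a * sqrt (h a)) \<le> C2 * real N powr (1/q)"
    using atomic_dec_exists[OF q refl] by blast
  define K where "K = C1 * C2"
  have K: "K > 0" using C1 C2 by (simp add: K_def)
  show ?thesis
  proof (intro exI[of _ "96 * (2 * sqrt 2 + 2) * K\<^sup>2"] conjI allI impI)
    show "96 * (2 * sqrt 2 + 2) * K\<^sup>2 > 0" using K by (simp add: add_pos_pos)
    fix m k n :: nat
    define D where "D = real m powr (1/p) * real k powr (1/q)"
    assume m: "m \<ge> 1" and k: "k \<ge> 1" and n: "real m powr (1/p) * real k powr (1/q) \<le> sqrt n"
    have D: "0 \<le> D" "D \<le> sqrt n" using n by (auto simp: D_def)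
    obtain \<Lambda>1 :: "nat set" and V \<sigma>1 h1 where 1: "atomic_dec (lp_ball ?r {1..m}) {1..m} \<Lambda>1 V \<sigma>1 h1"
      "(\<Sum>a\<in>\<Lambda>1. \<sigma>1 a) \<le> C1" "(\<Sum>a\<in>\<Lambda>1. \<sigma>1 a * sqrt (h1 a)) \<le> C1 * real m powr (1/p)"
      using C1(2)[OF m] by blast
    obtain \<Lambda>2 :: "nat set" and U \<sigma>2 h2 where 2: "atomic_dec (lp_ball ?t {1..k}) {1..k} \<Lambda>2 U \<sigma>2 h2"
      "(\<Sum>a\<in>\<Lambda>2. \<sigma>2 a) \<le> C2" "(\<Sum>a\<in>\<Lambda>2. \<sigma>2 a * sqrt (h2 a)) \<le> C2 * real k powr (1/q)"
      using C2(2)[OF k] by blast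
    have pos: "0 < \<sigma>1 b" "1 \<le> h1 b" if "b \<in> \<Lambda>1" for b using 1(1) that by (simp_all add: atomic_dec_def)
    have pos': "0 < \<sigma>2 b" "1 \<le> h2 b" if "b \<in> \<Lambda>2" for b using 2(1) that by (simp_all add: atomic_dec_def)
    let ?S = "\<Sum>c\<in>\<Lambda>1 \<times> \<Lambda>2. case c of (b, a) \<Rightarrow> \<sigma>1 b * \<sigma>2 a"
    let ?G = "\<Sum>c\<in>\<Lambda>1 \<times> \<Lambda>2. (case c of (b, a) \<Rightarrow> \<sigma>1 b * \<sigma>2 a) * sqrt (case c of (b, a) \<Rightarrow> 2 * (h1 b * h2 a))"
    have S: "?S \<le> K" unfolding tensor_sums(1) K_def
      using 1 2 C1 pos pos' by (intro mult_mono sum_nonneg) (auto intro: less_imp_le)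
    have G: "?G \<le> sqrt 2 * K * D"
    proof -
      have "?G \<le> sqrt 2 * ((C1 * real m powr (1/p)) * (C2 * real k powr (1/q)))"
        unfolding tensor_sums(2)
        using 1 2 C1 pos pos' by (intro mult_left_mono mult_mono sum_nonneg mult_nonneg_nonneg)
          (auto intro: less_imp_le order_trans[of 0 1])
      then show ?thesis by (simp add: K_def D_def mult_ac)
    qed
    have nonneg: "0 \<le> \<sigma>1 b * \<sigma>2 a" "0 \<le> 2 * (h1 b * h2 a)" if "b \<in> \<Lambda>1" "a \<in> \<Lambda>2" for a b
      using pos[OF that(1)] pos'[OF that(2)] by simp_all
    have G0: "?G \<ge> 0"
    proof (rule sum_nonneg)
      fix c assume "c \<in> \<Lambda>1 \<times> \<Lambda>2"
      then obtain b a where "c = (b, a)" "b \<in> \<Lambda>1" "a \<in> \<Lambda>2" by blast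
      then show "0 \<le> (case c of (b, a) \<Rightarrow> \<sigma>1 b * \<sigma>2 a) * sqrt (case c of (b, a) \<Rightarrow> 2 * (h1 b * h2 a))"
        using mult_nonneg_nonneg[OF nonneg(1)[of b a] real_sqrt_ge_zero[OF nonneg(2)[of b a]]] by simp
    qed
    have S0: "?S \<ge> 0"
      by (rule sum_nonneg) (use nonneg in auto)
    have fin: "finite ({1..m} \<times> {1..k})" by simp
    obtain e where e: "\<forall>x\<in>mixed_ball ?r ?t m k. \<forall>y\<in>mixed_ball ?r ?t m k.
        \<bar>offdiag n ({1..m} \<times> {1..k}) e x y\<bar> \<le> 96 * (2 * sqrt n * ?S * ?G + ?G\<^sup>2)"
      using ex_signs_offdiag_le_dec[OF fin atomic_dec_tensor[OF rt 1(1) 2(1)], of n] by blast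
    have "96 * (2 * sqrt n * ?S * ?G + ?G\<^sup>2) \<le> 96 * (2 * sqrt n * K * (sqrt 2 * K * D) + (sqrt 2 * K * D)\<^sup>2)"
      using S G S0 G0 K by (intro mult_left_mono add_mono mult_mono power_mono) auto
    also have "\<dots> = 96 * (2 * sqrt n * K * (sqrt 2 * K * D) + 2 * K\<^sup>2 * (D * D))"
      by (simp add: power_mult_distrib power2_eq_square)
    \<comment> \<open>The assumption D \<le> sqrt n enters here: it reduces the quadratic term to
      the order of the linear one.\<close>
    also have "\<dots> \<le> 96 * (2 * sqrt n * K * (sqrt 2 * K * D) + 2 * K\<^sup>2 * (sqrt n * D))"
      using D by (intro mult_left_mono mult_right_mono add_left_mono) auto
    also have "\<dots> = 96 * (2 * sqrt 2 + 2) * K\<^sup>2 * sqrt n * D"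
      by (simp add: power2_eq_square algebra_simps)
    finally have le: "96 * (2 * sqrt n * ?S * ?G + ?G\<^sup>2) \<le> 96 * (2 * sqrt 2 + 2) * K\<^sup>2 * sqrt n * D" .
    show "\<exists>e. \<forall>x\<in>mixed_ball ?r ?t m k. \<forall>y\<in>mixed_ball ?r ?t m k.
      \<bar>offdiag n ({1..m} \<times> {1..k}) e x y\<bar> \<le> 96 * (2 * sqrt 2 + 2) * K\<^sup>2 * sqrt n * (real m powr (1/p) * real k powr (1/q))"
      using e unfolding D_def[symmetric] by (intro exI[of _ e] ballI order_trans[OF _ le]) blast
  qed
qed

section \<open>Finite-rank operators and the width\<close>

lemma lookup_scaleR: "Poly_Mapping.lookup (c *\<^sub>R x) i = c * Poly_Mapping.lookup x i"
  for x :: "'i \<Rightarrow>\<^sub>0 real"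
proof -
  have "finite {i. c *\<^sub>R Poly_Mapping.lookup x i \<noteq> 0}"
    by (rule finite_subset[OF _ finite_lookup[of x]]) auto
  then show ?thesis by (simp add: scaleR_poly_mapping_def)
qed

lemma lmk_space_iff: "x \<in> lmk_space m k \<longleftrightarrow> (\<forall>i. i \<notin> {1..m} \<times> {1..k} \<longrightarrow> Poly_Mapping.lookup x i = 0)"
  unfolding lmk_space_def mem_Collect_eq subset_iff in_keys_iff by blast

lemma subspace_lmk_space: "subspace (lmk_space m k)"
  by (rule subspaceI) (auto simp: lmk_space_iff lookup_add lookup_scaleR)

text \<open>\<open>rank_at_most\<close> asks for a basis of the exact range. The range is a
  subspace, so a maximal independent subset of it spans precisely the range, and it has no more
  elements than the spanning set \<open>T\<close>.\<close>

lemma rank_at_mostI: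
  assumes V: "subspace V" and A: "linear_operator_on V A"
    and T: "finite T" "card T \<le> n" "A ` V \<subseteq> span T"
  shows "rank_at_most n V A"
proof -
  have sub: "subspace (A ` V)"
  proof (rule subspaceI)
    have "0 \<in> V" using V by (rule subspace_0)
    moreover have "A (0 *\<^sub>R 0) = 0 *\<^sub>R A 0" using A \<open>0 \<in> V\<close> unfolding linear_operator_on_def by blast
    ultimately show "0 \<in> A ` V" by (auto simp: image_iff intro!: bexI[of _ 0])
  next
    fix x y assume "x \<in> A ` V" "y \<in> A ` V"
    then obtain u v where "u \<in> V" "v \<in> V" "x = A u" "y = A v" by blast
    then show "x + y \<in> A ` V"
      using A V unfolding linear_operator_on_def by (intro image_eqI[of _ _ "u + v"]) (auto intro: subspace_add)
  next
    fix c x assume "x \<in> A ` V"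
    then obtain u where "u \<in> V" "x = A u" by blast
    then show "c *\<^sub>R x \<in> A ` V"
      using A V unfolding linear_operator_on_def by (intro image_eqI[of _ _ "c *\<^sub>R u"]) (auto intro: subspace_scale)
  qed
  obtain B where B: "B \<subseteq> A ` V" "independent B" "A ` V \<subseteq> span B"
    using maximal_independent_subset by blast
  have "finite B \<and> card B \<le> card T" using B T by (intro independent_span_bound) auto
  moreover have "span B = A ` V" using B sub by (intro span_subspace)
  ultimately show ?thesis unfolding rank_at_most_def using B T by (intro exI[of _ B]) auto
qed

text \<open>The common form of the operators in the upper bound, the zero operator included, so that
  admissibility is checked once.\<close>

definition rank_op ::
    "nat \<Rightarrow> 'i set \<Rightarrow> (nat \<Rightarrow> 'i \<Rightarrow> real) \<Rightarrow> (nat \<Rightarrow> 'i \<Rightarrow>\<^sub>0 real) \<Rightarrow> ('i \<Rightarrow>\<^sub>0 real) \<Rightarrow> 'i \<Rightarrow>\<^sub>0 real" where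
  "rank_op n I b W x = (\<Sum>s<n. (\<Sum>i\<in>I. b s i * Poly_Mapping.lookup x i) *\<^sub>R W s)"

lemma rank_op_admissible:
  assumes W: "\<And>s. W s \<in> lmk_space m k" and p: "p > 0" and q: "q > 0"
  defines "I \<equiv> {1..m} \<times> {1..k}"
  shows "linear_operator_on (lmk_space m k) (rank_op n I b W)"
    and "norm_continuous_on (lmk_space m k) (lmk_norm p q m k) (rank_op n I b W)"
    and "rank_at_most n (lmk_space m k) (rank_op n I b W)"
proof -
  let ?V = "lmk_space m k" and ?A = "rank_op n I b W"
  have add: "?A (x + y) = ?A x + ?A y" for x y
    by (simp add: rank_op_def lookup_add distrib_left sum.distrib scaleR_add_left)
  have scale: "?A (c *\<^sub>R x) = c *\<^sub>R ?A x" for c x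
    by (simp add: rank_op_def lookup_scaleR scaleR_sum_right sum_distrib_left mult_ac)
  have diff: "?A x - ?A y = ?A (x - y)" for x y
    using add[of "x - y" y] by simp
  show lin: "linear_operator_on ?V ?A"
    unfolding linear_operator_on_def
  proof (intro conjI ballI allI add scale)
    show "?A ` ?V \<subseteq> ?V"
      using W unfolding rank_op_def
      by (intro image_subsetI subspace_sum subspace_scale subspace_lmk_space)
  qed
  show "rank_at_most n ?V ?A"
  proof (rule rank_at_mostI[OF subspace_lmk_space lin])
    show "finite (W ` {..<n})" by simp
    show "card (W ` {..<n}) \<le> n" using card_image_le[of "{..<n}" W] by simp
    show "?A ` ?V \<subseteq> span (W ` {..<n})"
      unfolding rank_op_def by (intro image_subsetI span_sum span_scale span_base) auto
  qed
  define M where "M = (\<Sum>s<n. (\<Sum>i\<in>I. \<bar>b s i\<bar>) * (\<Sum>i\<in>I. \<bar>Poly_Mapping.lookup (W s) i\<bar>))"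
  \<comment> \<open>The added 1 keeps the Lipschitz constant positive, so that it may be divided
    by.\<close>
  define L where "L = M * mnorm p q m k (\<lambda>_. 1) + 1"
  have M0: "M \<ge> 0" unfolding M_def by (intro sum_nonneg mult_nonneg_nonneg) auto
  have L: "L > 0" using M0 by (simp add: L_def add_nonneg_pos)
  have bound: "lmk_norm p q m k (?A z) \<le> L * lmk_norm p q m k z" for z
  proof -
    let ?N = "lmk_norm p q m k z"
    have N0: "?N \<ge> 0" by (simp add: lmk_norm_eq_mnorm)
    have "\<bar>Poly_Mapping.lookup (?A z) i\<bar> \<le> M * ?N" if i: "i \<in> I" for i
    proof -
      have "\<bar>Poly_Mapping.lookup (?A z) i\<bar>
          = \<bar>\<Sum>s<n. (\<Sum>j\<in>I. b s j * Poly_Mapping.lookup z j) * Poly_Mapping.lookup (W s) i\<bar>"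
        by (simp add: rank_op_def lookup_sum lookup_scaleR)
      also have "\<dots> \<le> (\<Sum>s<n. ((\<Sum>j\<in>I. \<bar>b s j\<bar>) * ?N) * (\<Sum>i\<in>I. \<bar>Poly_Mapping.lookup (W s) i\<bar>))"
      proof (rule order_trans[OF sum_abs sum_mono])
        fix s
        have "\<bar>\<Sum>j\<in>I. b s j * Poly_Mapping.lookup z j\<bar> \<le> (\<Sum>j\<in>I. \<bar>b s j\<bar> * ?N)"
        proof (rule order_trans[OF sum_abs sum_mono])
          fix j assume "j \<in> I"
          then have "\<bar>Poly_Mapping.lookup z j\<bar> \<le> ?N"
            unfolding lmk_norm_eq_mnorm I_def using p q by (cases j) (auto intro!: mnorm_coord_le)
          then show "\<bar>b s j * Poly_Mapping.lookup z j\<bar> \<le> \<bar>b s j\<bar> * ?N"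
            by (simp add: abs_mult mult_left_mono)
        qed
        moreover have "\<bar>Poly_Mapping.lookup (W s) i\<bar> \<le> (\<Sum>i\<in>I. \<bar>Poly_Mapping.lookup (W s) i\<bar>)"
          using i by (intro member_le_sum) (auto simp: I_def)
        ultimately show "\<bar>(\<Sum>j\<in>I. b s j * Poly_Mapping.lookup z j) * Poly_Mapping.lookup (W s) i\<bar>
          \<le> ((\<Sum>j\<in>I. \<bar>b s j\<bar>) * ?N) * (\<Sum>i\<in>I. \<bar>Poly_Mapping.lookup (W s) i\<bar>)"
          unfolding abs_mult sum_distrib_right[symmetric]
          using N0 by (intro mult_mono) (auto intro!: mult_nonneg_nonneg sum_nonneg)
      qed
      also have "\<dots> = (\<Sum>s<n. ((\<Sum>j\<in>I. \<bar>b s j\<bar>) * (\<Sum>i\<in>I. \<bar>Poly_Mapping.lookup (W s) i\<bar>)) * ?N)"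
        by (intro sum.cong refl) (simp only: mult_ac)
      also have "\<dots> = M * ?N" unfolding M_def by (rule sum_distrib_right[symmetric])
      finally show ?thesis .
    qed
    then have "lmk_norm p q m k (?A z) \<le> (M * ?N) * mnorm p q m k (\<lambda>_. 1)"
      unfolding lmk_norm_eq_mnorm[of p q m k "?A z"] using p q M0 N0
      by (intro mnorm_le_const) (auto simp: I_def)
    also have "\<dots> \<le> L * ?N" using N0 by (simp add: L_def algebra_simps)
    finally show ?thesis .
  qed
  show "norm_continuous_on ?V (lmk_norm p q m k) ?A"
    unfolding norm_continuous_on_def
  proof (intro ballI allI impI)
    fix x and \<epsilon> :: real assume \<epsilon>: "\<epsilon> > 0"
    show "\<exists>d>0. \<forall>y\<in>?V. lmk_norm p q m k (y - x) < d \<longrightarrow> lmk_norm p q m k (?A y - ?A x) < \<epsilon>"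
    proof (intro exI[of _ "\<epsilon> / L"] conjI ballI impI)
      show "\<epsilon> / L > 0" using \<epsilon> L by simp
      fix y assume "lmk_norm p q m k (y - x) < \<epsilon> / L"
      then have "L * lmk_norm p q m k (y - x) < \<epsilon>" using L by (simp add: field_simps)
      then show "lmk_norm p q m k (?A y - ?A x) < \<epsilon>"
        unfolding diff using bound[of "y - x"] by linarith
    qed
  qed
qed

lemma lmk_width_le:
  assumes W: "\<And>s. W s \<in> lmk_space m k" and "p\<^sub>2 > 0" "q\<^sub>2 > 0"
    and B: "\<And>x. x \<in> lmk_ball p\<^sub>1 q\<^sub>1 m k \<Longrightarrow>
      lmk_norm p\<^sub>2 q\<^sub>2 m k (x - rank_op n ({1..m} \<times> {1..k}) b W x) \<le> B"
  shows "lmk_width n p\<^sub>1 q\<^sub>1 p\<^sub>2 q\<^sub>2 m k \<le> ereal B"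
  unfolding lmk_width_def linear_width_def
proof (rule INF_lower2)
  show "rank_op n ({1..m} \<times> {1..k}) b W \<in> {A. linear_operator_on (lmk_space m k) A \<and>
      norm_continuous_on (lmk_space m k) (lmk_norm p\<^sub>2 q\<^sub>2 m k) A \<and> rank_at_most n (lmk_space m k) A}"
    using rank_op_admissible[OF assms(1-3), of n b] by simp
  show "(SUP x\<in>lmk_ball p\<^sub>1 q\<^sub>1 m k. ereal (lmk_norm p\<^sub>2 q\<^sub>2 m k (x - rank_op n ({1..m} \<times> {1..k}) b W x))) \<le> ereal B"
    using B by (intro SUP_least) simp
qed

text \<open>Passing to conjugate exponents is two applications of \<open>mnorm_antimono\<close>: the
  ball becomes larger and the error norm becomes larger. By duality the larger error is the
  off-diagonal form divided by n.\<close>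

lemma lmk_width_le_signs:
  assumes p: "1 < p" "p \<le> p\<^sub>2" "0 < p\<^sub>1" "p\<^sub>1 \<le> p / (p - 1)" and q: "1 < q" "q \<le> q\<^sub>2" "0 < q\<^sub>1" "q\<^sub>1 \<le> q / (q - 1)"
    and n: "n \<ge> 1" and B: "B \<ge> 0"
    and e: "\<And>x y. x \<in> mixed_ball (p / (p - 1)) (q / (q - 1)) m k \<Longrightarrow>
      y \<in> mixed_ball (p / (p - 1)) (q / (q - 1)) m k \<Longrightarrow> \<bar>offdiag n ({1..m} \<times> {1..k}) e x y\<bar> \<le> B"
  shows "lmk_width n p\<^sub>1 q\<^sub>1 p\<^sub>2 q\<^sub>2 m k \<le> ereal (B / n)"
proof -
  let ?I = "{1..m} \<times> {1..k}"
  define W :: "nat \<Rightarrow> (nat \<times> nat) \<Rightarrow>\<^sub>0 real" where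
    "W s = Abs_poly_mapping (\<lambda>i. if i \<in> ?I then rsign (e s) i else 0)" for s
  have W: "Poly_Mapping.lookup (W s) i = (if i \<in> ?I then rsign (e s) i else 0)" for s i
  proof -
    have "finite {i. (if i \<in> ?I then rsign (e s) i else 0) \<noteq> 0}"
      by (rule finite_subset[of _ ?I]) auto
    then show ?thesis by (simp add: W_def)
  qed
  define b where "b s i = rsign (e s) i / n" for s i
  show ?thesis
  proof (rule lmk_width_le[where b = b and W = W])
    show "W s \<in> lmk_space m k" for s by (simp add: lmk_space_iff W)
    show "p\<^sub>2 > 0" "q\<^sub>2 > 0" using p q by auto
    fix x assume "x \<in> lmk_ball p\<^sub>1 q\<^sub>1 m k"
    then have "mnorm p\<^sub>1 q\<^sub>1 m k (Poly_Mapping.lookup x) \<le> 1" by (simp add: lmk_ball_def lmk_norm_eq_mnorm)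
    then have "mnorm (p / (p - 1)) (q / (q - 1)) m k (Poly_Mapping.lookup x) \<le> 1"
      using mnorm_antimono[of p\<^sub>1 "p / (p - 1)" q\<^sub>1 "q / (q - 1)" m k "Poly_Mapping.lookup x"] p q by linarith
    then have x: "Poly_Mapping.lookup x \<in> mixed_ball (p / (p - 1)) (q / (q - 1)) m k"
      using q by (subst mixed_ball_iff) auto
    define w where "w = Poly_Mapping.lookup (x - rank_op n ?I b W x)"
    have w: "w i = - (\<Sum>s<n. \<Sum>j\<in>?I - {i}. rsign (e s) i * (rsign (e s) j * Poly_Mapping.lookup x j)) / n"
      if i: "i \<in> ?I" for i
    proof -
      let ?x = "Poly_Mapping.lookup x"
      have "Poly_Mapping.lookup (rank_op n ?I b W x) i = (\<Sum>s<n. (\<Sum>j\<in>?I. b s j * ?x j) * rsign (e s) i)"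
        using i by (simp add: rank_op_def lookup_sum lookup_scaleR W)
      \<comment> \<open>The square of the sign at i is 1, so each of the n rows returns x i / n from
        the diagonal; together they cancel x in \<open>w\<close>.\<close>
      also have "\<dots> = (\<Sum>s<n. ?x i / n + (\<Sum>j\<in>?I - {i}. rsign (e s) i * (rsign (e s) j * ?x j)) / n)"
      proof (rule sum.cong[OF refl])
        fix s
        have "(\<Sum>j\<in>?I. b s j * ?x j) = b s i * ?x i + (\<Sum>j\<in>?I - {i}. b s j * ?x j)"
          using i by (intro sum.remove) auto
        moreover have "b s i * ?x i * rsign (e s) i = ?x i / n" by (simp add: b_def rsign_def)
        moreover have "(\<Sum>j\<in>?I - {i}. b s j * ?x j) * rsign (e s) i
            = (\<Sum>j\<in>?I - {i}. rsign (e s) i * (rsign (e s) j * ?x j)) / n"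
          unfolding sum_distrib_right sum_divide_distrib by (intro sum.cong refl) (simp add: b_def)
        ultimately show "(\<Sum>j\<in>?I. b s j * ?x j) * rsign (e s) i
          = ?x i / n + (\<Sum>j\<in>?I - {i}. rsign (e s) i * (rsign (e s) j * ?x j)) / n"
          by (simp only: distrib_right)
      qed
      also have "\<dots> = ?x i + (\<Sum>s<n. \<Sum>j\<in>?I - {i}. rsign (e s) i * (rsign (e s) j * ?x j)) / n"
        using n by (simp add: sum.distrib sum_divide_distrib)
      finally show ?thesis by (simp add: w_def lookup_minus)
    qed
    have "mnorm p q m k w \<le> B / n"
    proof (rule mnorm_le_of_dual)
      fix y assume y: "y \<in> mixed_ball (p / (p - 1)) (q / (q - 1)) m k"
      have "(\<Sum>i\<in>?I. w i * y i) = - offdiag n ?I e y (Poly_Mapping.lookup x) / n"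
      proof -
        have "(\<Sum>i\<in>?I. w i * y i)
          = (\<Sum>i\<in>?I. - ((\<Sum>s<n. \<Sum>j\<in>?I - {i}. rsign (e s) i * (rsign (e s) j * Poly_Mapping.lookup x j)) * y i) / n)"
          by (intro sum.cong refl) (simp add: w)
        then show ?thesis by (simp only: offdiag_linear sum_divide_distrib[symmetric] sum_negf)
      qed
      also have "\<dots> \<le> \<bar>offdiag n ?I e y (Poly_Mapping.lookup x)\<bar> / n" by (intro divide_right_mono) auto
      also have "\<dots> \<le> B / n" using e[OF y x] by (intro divide_right_mono) auto
      finally show "(\<Sum>i\<in>?I. w i * y i) \<le> B / n" .
    qed (use p q B in auto)
    moreover have "mnorm p\<^sub>2 q\<^sub>2 m k w \<le> mnorm p q m k w" using p q by (intro mnorm_antimono) auto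
    ultimately show "lmk_norm p\<^sub>2 q\<^sub>2 m k (x - rank_op n ?I b W x) \<le> B / n"
      by (simp add: lmk_norm_eq_mnorm w_def)
  qed
qed

lemma lmk_width_le_1:
  assumes "0 < p\<^sub>1" "p\<^sub>1 \<le> p\<^sub>2" "0 < q\<^sub>1" "q\<^sub>1 \<le> q\<^sub>2"
  shows "lmk_width n p\<^sub>1 q\<^sub>1 p\<^sub>2 q\<^sub>2 m k \<le> ereal 1"
proof (rule lmk_width_le[where b = "\<lambda>_ _. 0" and W = "\<lambda>_. 0"])
  fix x assume "x \<in> lmk_ball p\<^sub>1 q\<^sub>1 m k"
  then show "lmk_norm p\<^sub>2 q\<^sub>2 m k (x - rank_op n ({1..m} \<times> {1..k}) (\<lambda>_ _. 0) (\<lambda>_. 0) x) \<le> 1"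
    using mnorm_antimono[OF assms, of m k "Poly_Mapping.lookup x"]
    by (simp add: rank_op_def lmk_ball_def lmk_norm_eq_mnorm)
qed (use assms in \<open>auto simp: lmk_space_iff\<close>)

lemma lmk_width_upper:
  assumes p: "1 < p\<^sub>1" "p\<^sub>1 \<le> 2" "2 \<le> p\<^sub>2" and q: "1 < q\<^sub>1" "q\<^sub>1 \<le> 2" "2 \<le> q\<^sub>2"
  shows "\<exists>C>0. \<forall>m\<ge>1. \<forall>k\<ge>1. \<forall>n\<ge>1. lmk_width n p\<^sub>1 q\<^sub>1 p\<^sub>2 q\<^sub>2 m k
             \<le> ereal (C * min (real n powr (-1/2)
                              * real m powr (max (1 / p\<^sub>2) (1 / conj_exponent p\<^sub>1))
                              * real k powr (max (1 / q\<^sub>2) (1 / conj_exponent q\<^sub>1))) 1)"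
proof -
  \<comment> \<open>The smaller of the target exponent and the conjugate of the source exponent
    works for both sides: conjugation reverses order, so its own conjugate is at least s, and its
    reciprocal is the maximum in the theorem.\<close>
  have exponent: "2 \<le> min P (conj_exponent s) \<and> min P (conj_exponent s) \<le> P \<and>
      s \<le> min P (conj_exponent s) / (min P (conj_exponent s) - 1) \<and>
      max (1 / P) (1 / conj_exponent s) = 1 / min P (conj_exponent s)"
    if s: "1 < s" "s \<le> 2" "2 \<le> P" for s P :: real
  proof -
    have c: "2 \<le> conj_exponent s" using s by (simp add: conj_exponent_def field_simps)
    have conj: "s = conj_exponent s / (conj_exponent s - 1)" using s by (simp add: conj_exponent_def field_simps)
    define t where "t = min P (conj_exponent s)"
    have t: "2 \<le> t" "t \<le> conj_exponent s" using s c by (auto simp: t_def)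
    have "conj_exponent s / (conj_exponent s - 1) \<le> t / (t - 1)" using t by (simp add: field_simps)
    then have "s \<le> t / (t - 1)" using conj by simp
    moreover have "max (1 / P) (1 / conj_exponent s) = 1 / t"
    proof (cases "P \<le> conj_exponent s")
      case True
      then have "1 / conj_exponent s \<le> 1 / P" using s by (intro divide_left_mono) auto
      then show ?thesis using True by (simp add: t_def max_def)
    next
      case False
      then have "1 / P \<le> 1 / conj_exponent s" using c by (intro divide_left_mono) auto
      then show ?thesis using False by (simp add: t_def max_def)
    qed
    ultimately show ?thesis using t by (simp add: t_def)
  qed
  define P where "P = min p\<^sub>2 (conj_exponent p\<^sub>1)"
  define Q where "Q = min q\<^sub>2 (conj_exponent q\<^sub>1)"
  have P: "2 \<le> P" "P \<le> p\<^sub>2" "p\<^sub>1 \<le> P / (P - 1)" "max (1 / p\<^sub>2) (1 / conj_exponent p\<^sub>1) = 1 / P"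
    using exponent[OF p] by (simp_all add: P_def)
  have Q: "2 \<le> Q" "Q \<le> q\<^sub>2" "q\<^sub>1 \<le> Q / (Q - 1)" "max (1 / q\<^sub>2) (1 / conj_exponent q\<^sub>1) = 1 / Q"
    using exponent[OF q] by (simp_all add: Q_def)
  obtain C where C: "C > 0" "\<And>m k n. m \<ge> 1 \<Longrightarrow> k \<ge> 1 \<Longrightarrow> real m powr (1/P) * real k powr (1/Q) \<le> sqrt n \<Longrightarrow>
    \<exists>e. \<forall>x\<in>mixed_ball (P / (P - 1)) (Q / (Q - 1)) m k. \<forall>y\<in>mixed_ball (P / (P - 1)) (Q / (Q - 1)) m k.
      \<bar>offdiag n ({1..m} \<times> {1..k}) e x y\<bar> \<le> C * sqrt n * (real m powr (1/P) * real k powr (1/Q))"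
    using ex_signs_mixed_le[OF P(1) Q(1)] by blast
  show ?thesis
    unfolding P(4) Q(4)
  proof (intro exI[of _ "max C 1"] conjI allI impI)
    show "max C 1 > 0" by simp
    fix m k n :: nat assume m: "m \<ge> 1" and k: "k \<ge> 1" and n: "n \<ge> 1"
    define D where "D = real m powr (1/P) * real k powr (1/Q)"
    have n0: "real n > 0" using n by simp
    have half: "real n powr (-1/2) = 1 / sqrt n" using n0 by (simp add: powr_minus_divide powr_half_sqrt)
    show "lmk_width n p\<^sub>1 q\<^sub>1 p\<^sub>2 q\<^sub>2 m k
        \<le> ereal (max C 1 * min (real n powr (-1/2) * real m powr (1/P) * real k powr (1/Q)) 1)"
    proof (cases "D \<le> sqrt n")
      case True
      then obtain e where e: "\<forall>x\<in>mixed_ball (P / (P - 1)) (Q / (Q - 1)) m k. \<forall>y\<in>mixed_ball (P / (P - 1)) (Q / (Q - 1)) m k.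
          \<bar>offdiag n ({1..m} \<times> {1..k}) e x y\<bar> \<le> C * sqrt n * D"
        using C(2)[OF m k, of n] unfolding D_def by blast
      have "lmk_width n p\<^sub>1 q\<^sub>1 p\<^sub>2 q\<^sub>2 m k \<le> ereal (C * sqrt n * D / n)"
        using p q P Q n C(1) e by (intro lmk_width_le_signs[of P p\<^sub>2 p\<^sub>1 Q q\<^sub>2 q\<^sub>1 n _ m k e]) (auto simp: D_def)
      also have "C * sqrt n * D / n = C * (D / sqrt n)"
        using n0 by (simp add: field_simps)
      also have "ereal (C * (D / sqrt n)) \<le> ereal (max C 1 * (D / sqrt n))"
        unfolding ereal_less_eq by (intro mult_right_mono) (simp_all add: D_def)
      also have "D / sqrt n = min (real n powr (-1/2) * real m powr (1/P) * real k powr (1/Q)) 1"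
        using True n0 unfolding half by (simp add: D_def min_def field_simps)
      finally show ?thesis .
    next
      case False
      have "lmk_width n p\<^sub>1 q\<^sub>1 p\<^sub>2 q\<^sub>2 m k \<le> ereal 1" using p q by (intro lmk_width_le_1) auto
      also have "ereal 1 \<le> ereal (max C 1 * 1)" by simp
      moreover have "min (real n powr (-1/2) * real m powr (1/P) * real k powr (1/Q)) 1 = 1"
        using False n0 unfolding half by (simp add: D_def min_def field_simps)
      ultimately show ?thesis by (simp only:)
    qed
  qed
qed


subsection \<open>The lower bound\<close>

definition ip :: "'i set \<Rightarrow> ('i \<Rightarrow> real) \<Rightarrow> ('i \<Rightarrow> real) \<Rightarrow> real" where
  "ip I f g = (\<Sum>i\<in>I. f i * g i)"

lemma ip_commute: "ip I f g = ip I g f"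
  by (simp add: ip_def mult.commute)

lemma ip_cong: "(\<And>i. i \<in> I \<Longrightarrow> f i = f' i) \<Longrightarrow> (\<And>i. i \<in> I \<Longrightarrow> g i = g' i) \<Longrightarrow> ip I f g = ip I f' g'"
  by (simp add: ip_def)

lemma ip_sum_left: "ip I (\<lambda>i. \<Sum>b\<in>B. c b * f b i) g = (\<Sum>b\<in>B. c b * ip I (f b) g)"
  unfolding ip_def sum_distrib_left sum_distrib_right
  by (subst sum.swap) (simp only: mult.assoc)

lemma ip_diff_left: "ip I (\<lambda>i. f i - f' i) g = ip I f g - ip I f' g"
  by (simp add: ip_def left_diff_distrib sum_subtractf)

lemma ip_scale_right: "ip I f (\<lambda>i. c * g i) = c * ip I f g"
  by (simp add: ip_def sum_distrib_left mult_ac)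

lemma ip_scale_left: "ip I (\<lambda>i. c * f i) g = c * ip I f g"
  by (simp add: ip_def sum_distrib_left mult_ac)

lemma ip_self_eq_0: "finite I \<Longrightarrow> ip I f f = 0 \<Longrightarrow> i \<in> I \<Longrightarrow> f i = 0"
  unfolding ip_def by (subst (asm) sum_nonneg_eq_0_iff) auto

text \<open>Gram--Schmidt, with zero vectors in place of the dependent ones.\<close>

lemma ex_orthonormal:
  assumes I: "finite I" and "finite B"
  shows "\<exists>u. (\<forall>b\<in>B. \<forall>b'\<in>B. b \<noteq> b' \<longrightarrow> ip I (u b) (u b') = 0) \<and>
    (\<forall>b\<in>B. ip I (u b) (u b) = 0 \<or> ip I (u b) (u b) = 1) \<and>
    (\<forall>b\<in>B. \<forall>i\<in>I. W b i = (\<Sum>l\<in>B. ip I (W b) (u l) * u l i))"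
  using \<open>finite B\<close>
proof (induction B rule: finite_induct)
  case empty
  show ?case by simp
next
  case (insert x B)
  obtain u where u: "\<forall>b\<in>B. \<forall>b'\<in>B. b \<noteq> b' \<longrightarrow> ip I (u b) (u b') = 0"
    "\<forall>b\<in>B. ip I (u b) (u b) = 0 \<or> ip I (u b) (u b) = 1"
    "\<forall>b\<in>B. \<forall>i\<in>I. W b i = (\<Sum>l\<in>B. ip I (W b) (u l) * u l i)"
    using insert.IH by (elim exE conjE) (rule that, assumption+)
  have orth: "ip I (u b) (u b') = 0" if "b \<in> B" "b' \<in> B" "b \<noteq> b'" for b b' using u(1) that by blast
  have norm: "ip I (u b) (u b) = 0 \<or> ip I (u b) (u b) = 1" if "b \<in> B" for b using u(2) that by blast
  have expand: "W b i = (\<Sum>l\<in>B. ip I (W b) (u l) * u l i)" if "b \<in> B" "i \<in> I" for b i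
    using u(3) that by blast
  define v where "v i = W x i - (\<Sum>l\<in>B. ip I (W x) (u l) * u l i)" for i
  have vu: "ip I v (u b) = 0" if b: "b \<in> B" for b
  proof -
    have "ip I v (u b) = ip I (W x) (u b) - (\<Sum>l\<in>B. ip I (W x) (u l) * ip I (u l) (u b))"
      unfolding v_def by (simp only: ip_diff_left ip_sum_left)
    also have "(\<Sum>l\<in>B. ip I (W x) (u l) * ip I (u l) (u b)) = ip I (W x) (u b) * ip I (u b) (u b)"
    proof -
      have "(\<Sum>l\<in>B. ip I (W x) (u l) * ip I (u l) (u b))
          = (\<Sum>l\<in>B. if l = b then ip I (W x) (u b) * ip I (u b) (u b) else 0)"
        using orth b by (intro sum.cong) auto
      then show ?thesis using insert.hyps b by simp
    qed
    also have "\<dots> = ip I (W x) (u b)"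
      using norm[OF b]
    proof
      assume "ip I (u b) (u b) = 0"
      then have "\<forall>i\<in>I. u b i = 0" using ip_self_eq_0[OF I] by blast
      then have "ip I (W x) (u b) = 0" by (simp add: ip_def)
      then show ?thesis by simp
    qed simp
    finally show ?thesis by simp
  qed
  have vW: "ip I (W x) v = ip I v v"
  proof -
    have "ip I v v = ip I (W x) v - (\<Sum>l\<in>B. ip I (W x) (u l) * ip I (u l) v)"
      unfolding v_def[abs_def] ip_diff_left[of I "W x"] by (simp only: ip_sum_left)
    moreover have "ip I (u l) v = 0" if "l \<in> B" for l
      using vu[OF that] ip_commute[of I "u l" v] by simp
    ultimately show ?thesis by simp
  qed
  \<comment> \<open>A vanishing residual is kept as the zero vector, which explains the alternative
    0 or 1 for the norms.\<close>
  define \<gamma> where "\<gamma> = (if ip I v v = 0 then 0 else 1 / sqrt (ip I v v))"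
  define z where "z i = \<gamma> * v i" for i
  have vv: "ip I v v \<ge> 0" unfolding ip_def by (intro sum_nonneg) auto
  have zz: "ip I z z = 0 \<or> ip I z z = 1"
    using vv by (auto simp: z_def[abs_def] ip_scale_left ip_scale_right \<gamma>_def)
  have zu: "ip I z (u b) = 0" if "b \<in> B" for b
    using vu[OF that] by (simp add: z_def[abs_def] ip_scale_left)
  have uz: "ip I (u b) z = 0" if "b \<in> B" for b
    using zu[OF that] ip_commute[of I "u b" z] by simp
  have Wz: "ip I (W x) z * z i = v i" if i: "i \<in> I" for i
  proof (cases "ip I v v = 0")
    case True
    then show ?thesis using ip_self_eq_0[OF I True i] by (simp add: z_def)
  next
    case False
    then have "\<gamma> * \<gamma> * ip I v v = 1" using vv by (simp add: \<gamma>_def)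
    then show ?thesis by (simp add: z_def[abs_def] ip_scale_right vW mult_ac)
  qed
  define u' where "u' = u(x := z)"
  have u': "u' x = z" "\<And>b. b \<in> B \<Longrightarrow> u' b = u b" using insert.hyps by (auto simp: u'_def)
  have sum': "(\<Sum>l\<in>insert x B. ip I f (u' l) * u' l i) = ip I f z * z i + (\<Sum>l\<in>B. ip I f (u l) * u l i)" for f i
    using insert.hyps u' by simp
  show ?case
  proof (intro exI[of _ u'] conjI ballI impI)
    fix b b' assume "b \<in> insert x B" "b' \<in> insert x B" "b \<noteq> b'"
    then show "ip I (u' b) (u' b') = 0"
      using u' orth zu uz by auto
  next
    fix b assume b: "b \<in> insert x B"
    show "ip I (u' b) (u' b) = 0 \<or> ip I (u' b) (u' b) = 1"
    proof (cases "b = x")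
      case True
      then show ?thesis using zz u'(1) by simp
    next
      case False
      with b have "b \<in> B" by simp
      then show ?thesis using norm[of b] u'(2)[of b] by simp
    qed
  next
    fix b i assume b: "b \<in> insert x B" and i: "i \<in> I"
    show "W b i = (\<Sum>l\<in>insert x B. ip I (W b) (u' l) * u' l i)"
    proof (cases "b = x")
      case True
      then show ?thesis unfolding sum' using Wz[OF i] by (simp add: v_def)
    next
      case False
      with b have b: "b \<in> B" by simp
      have "ip I (W b) z = ip I (\<lambda>i. \<Sum>l\<in>B. ip I (W b) (u l) * u l i) z"
        using expand[OF b] by (intro ip_cong) auto
      also have "\<dots> = 0" unfolding ip_sum_left using uz by simp
      finally show ?thesis unfolding sum' using expand[OF b i] by simp
    qed
  qed
qed

text \<open>The trace pairs the matrix with the orthogonal projection onto its range, whose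
  Hilbert--Schmidt norm is the square root of the rank.\<close>

lemma trace_power2_le:
  assumes I: "finite I" and B: "finite B" "card B \<le> n"
    and a: "\<And>i j. i \<in> I \<Longrightarrow> j \<in> I \<Longrightarrow> a j i = (\<Sum>b\<in>B. c b i * W b j)"
  shows "(\<Sum>i\<in>I. a i i)\<^sup>2 \<le> real n * (\<Sum>i\<in>I. \<Sum>j\<in>I. (a j i)\<^sup>2)"
proof -
  obtain u where u: "\<forall>b\<in>B. \<forall>b'\<in>B. b \<noteq> b' \<longrightarrow> ip I (u b) (u b') = 0"
    "\<forall>b\<in>B. ip I (u b) (u b) = 0 \<or> ip I (u b) (u b) = 1"
    "\<forall>b\<in>B. \<forall>i\<in>I. W b i = (\<Sum>l\<in>B. ip I (W b) (u l) * u l i)"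
    using ex_orthonormal[OF I B(1), of W] by (elim exE conjE) (rule that, assumption+)
  have orth: "ip I (u b) (u b') = 0" if "b \<in> B" "b' \<in> B" "b \<noteq> b'" for b b' using u(1) that by blast
  have norm: "ip I (u b) (u b) = 0 \<or> ip I (u b) (u b) = 1" if "b \<in> B" for b using u(2) that by blast
  have expand: "W b i = (\<Sum>l\<in>B. ip I (W b) (u l) * u l i)" if "b \<in> B" "i \<in> I" for b i
    using u(3) that by blast
  have col: "a j i = (\<Sum>l\<in>B. ip I (\<lambda>j. a j i) (u l) * u l j)" if i: "i \<in> I" and j: "j \<in> I" for i j
  proof -
    have "a j i = (\<Sum>b\<in>B. c b i * (\<Sum>l\<in>B. ip I (W b) (u l) * u l j))"
      unfolding a[OF i j] using expand j by (intro sum.cong refl) auto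
    also have "\<dots> = (\<Sum>l\<in>B. (\<Sum>b\<in>B. c b i * ip I (W b) (u l)) * u l j)"
      unfolding sum_distrib_left sum_distrib_right by (subst sum.swap) (simp only: mult.assoc)
    also have "\<dots> = (\<Sum>l\<in>B. ip I (\<lambda>j. \<Sum>b\<in>B. c b i * W b j) (u l) * u l j)" by (simp only: ip_sum_left)
    also have "\<dots> = (\<Sum>l\<in>B. ip I (\<lambda>j. a j i) (u l) * u l j)"
      using a[OF i] by (intro sum.cong refl arg_cong2[where f = "(*)"] ip_cong) auto
    finally show ?thesis .
  qed
  define K where "K = (\<lambda>(i, j). \<Sum>l\<in>B. u l i * u l j)"
  have "(\<Sum>i\<in>I. a i i) = (\<Sum>i\<in>I. \<Sum>l\<in>B. ip I (\<lambda>j. a j i) (u l) * u l i)"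
    using col by (intro sum.cong refl) auto
  also have "\<dots> = (\<Sum>i\<in>I. \<Sum>j\<in>I. a j i * K (i, j))"
    unfolding ip_def K_def prod.case sum_distrib_left sum_distrib_right
    by (intro sum.cong refl, subst sum.swap) (simp only: mult_ac)
  also have "\<dots> = (\<Sum>(i, j)\<in>I \<times> I. a j i * K (i, j))" by (simp only: sum.cartesian_product)
  also have "\<dots> = (\<Sum>ij\<in>I \<times> I. (case ij of (i, j) \<Rightarrow> a j i) * K ij)"
    by (intro sum.cong) auto
  finally have "(\<Sum>i\<in>I. a i i)\<^sup>2 \<le> (\<Sum>ij\<in>I \<times> I. (case ij of (i, j) \<Rightarrow> a j i)\<^sup>2) * (\<Sum>ij\<in>I \<times> I. (K ij)\<^sup>2)"
    using Cauchy_Schwarz_ineq_sum[of "\<lambda>ij. case ij of (i, j) \<Rightarrow> a j i" K "I \<times> I"] by simp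
  also have "(\<Sum>ij\<in>I \<times> I. (case ij of (i, j) \<Rightarrow> a j i)\<^sup>2) = (\<Sum>i\<in>I. \<Sum>j\<in>I. (a j i)\<^sup>2)"
    unfolding sum.cartesian_product by (intro sum.cong) auto
  also have "(\<Sum>ij\<in>I \<times> I. (K ij)\<^sup>2) \<le> real n"
  proof -
    have "(\<Sum>ij\<in>I \<times> I. (K ij)\<^sup>2) = (\<Sum>i\<in>I. \<Sum>j\<in>I. (K (i, j))\<^sup>2)" 
      unfolding sum.cartesian_product by (intro sum.cong) auto
    also have "\<dots> = (\<Sum>i\<in>I. \<Sum>j\<in>I. \<Sum>l\<in>B. \<Sum>l'\<in>B. (u l i * u l' i) * (u l j * u l' j))"
      unfolding K_def prod.case power2_eq_square sum_product by (intro sum.cong refl) (simp only: mult_ac)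
    also have "\<dots> = (\<Sum>l\<in>B. \<Sum>l'\<in>B. \<Sum>i\<in>I. \<Sum>j\<in>I. (u l i * u l' i) * (u l j * u l' j))"
    proof -
      have "(\<Sum>i\<in>I. \<Sum>j\<in>I. \<Sum>l\<in>B. \<Sum>l'\<in>B. t i j l l') = (\<Sum>l\<in>B. \<Sum>l'\<in>B. \<Sum>i\<in>I. \<Sum>j\<in>I. t i j l l')" for t :: "_ \<Rightarrow> _ \<Rightarrow> _ \<Rightarrow> _ \<Rightarrow> real"
      proof -
        have "(\<Sum>i\<in>I. \<Sum>j\<in>I. \<Sum>l\<in>B. \<Sum>l'\<in>B. t i j l l') = (\<Sum>i\<in>I. \<Sum>l\<in>B. \<Sum>j\<in>I. \<Sum>l'\<in>B. t i j l l')"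
          by (rule sum.cong[OF refl]) (rule sum.swap)
        also have "\<dots> = (\<Sum>l\<in>B. \<Sum>i\<in>I. \<Sum>j\<in>I. \<Sum>l'\<in>B. t i j l l')" by (rule sum.swap)
        also have "\<dots> = (\<Sum>l\<in>B. \<Sum>i\<in>I. \<Sum>l'\<in>B. \<Sum>j\<in>I. t i j l l')"
          by (rule sum.cong[OF refl], rule sum.cong[OF refl]) (rule sum.swap)
        also have "\<dots> = (\<Sum>l\<in>B. \<Sum>l'\<in>B. \<Sum>i\<in>I. \<Sum>j\<in>I. t i j l l')"
          by (rule sum.cong[OF refl]) (rule sum.swap)
        finally show ?thesis .
      qed
      then show ?thesis .
    qed
    also have "\<dots> = (\<Sum>l\<in>B. \<Sum>l'\<in>B. (ip I (u l) (u l'))\<^sup>2)"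
      by (simp only: ip_def power2_eq_square sum_product)
    \<comment> \<open>Only the diagonal terms survive orthogonality; zero vectors among the
      \<open>u l\<close> make this an inequality.\<close>
    also have "\<dots> \<le> (\<Sum>l\<in>B. \<Sum>l'\<in>B. if l' = l then 1 else 0)"
    proof (intro sum_mono)
      fix l l' assume "l \<in> B" "l' \<in> B"
      then show "(ip I (u l) (u l'))\<^sup>2 \<le> (if l' = l then 1 else 0)" using orth[of l l'] norm[of l] by auto
    qed
    also have "\<dots> = real (card B)" using B by simp
    finally show ?thesis using B(2) by linarith
  qed
  finally show ?thesis by (simp add: mult.commute mult_right_mono sum_nonneg)
qed

section \<open>From the trace to the approximation error\<close>

text \<open>With s = sqrt (N / n) the trace inequality becomes s \<le> 2 + 2 \<theta> \<epsilon>. If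
  \<theta> \<epsilon> < s / 4, this forces s < 4, whereas 16 n \<le> N gives s \<ge> 4. The
  parameter \<theta> stands for the cost of passing to the Euclidean norm and lets rows and columns
  share the argument.\<close>

lemma trace_lower_bound:
  assumes I: "finite I" "card I = N" and n: "n \<ge> 1" "16 * n \<le> N" and B: "finite B" "card B \<le> n"
    and a: "\<And>i j. i \<in> I \<Longrightarrow> j \<in> I \<Longrightarrow> a j i = (\<Sum>b\<in>B. c b i * W b j)"
    and diag: "\<And>i. i \<in> I \<Longrightarrow> \<bar>1 - a i i\<bar> \<le> \<epsilon>"
    and HS: "(\<Sum>i\<in>I. \<Sum>j\<in>I. (a j i)\<^sup>2) \<le> N * (1 + \<theta> * \<epsilon>)\<^sup>2"
    and \<theta>: "\<theta> > 0" and \<epsilon>: "\<epsilon> \<ge> 0"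
  shows "1/4 * min (sqrt (N / n) / \<theta>) 1 \<le> \<epsilon>"
proof (rule ccontr)
  assume "\<not> ?thesis"
  then have less: "\<epsilon> < 1/4" "\<epsilon> < sqrt (N / n) / \<theta> / 4" by auto
  define s where "s = sqrt (N / n)"
  have n0: "real n > 0" using n by simp
  have "real (16 * n) \<le> real N" using n(2) by (simp only: of_nat_le_iff)
  then have nN: "16 * real n \<le> real N" by simp
  have N0: "real N > 0" using nN n0 by linarith
  have "sqrt (4\<^sup>2) \<le> s" unfolding s_def using nN n0 by (intro real_sqrt_le_mono) (simp add: field_simps)
  then have s: "4 \<le> s" by simp
  have s2: "s\<^sup>2 * n = N" using n0 by (simp add: s_def)
  have "(\<Sum>i\<in>I. 1/2) \<le> (\<Sum>i\<in>I. a i i)"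
  proof (rule sum_mono)
    fix i assume "i \<in> I"
    then show "1/2 \<le> a i i" using diag[of i] less(1) by (simp add: abs_le_iff)
  qed
  then have "N / 2 \<le> (\<Sum>i\<in>I. a i i)" using I by simp
  then have "(N / 2)\<^sup>2 \<le> (\<Sum>i\<in>I. a i i)\<^sup>2" by (intro power_mono) auto
  also have "\<dots> \<le> n * (\<Sum>i\<in>I. \<Sum>j\<in>I. (a j i)\<^sup>2)" by (rule trace_power2_le[OF I(1) B a])
  also have "\<dots> \<le> n * (N * (1 + \<theta> * \<epsilon>)\<^sup>2)" by (intro mult_left_mono HS) auto
  finally have "real N * real N \<le> real N * (4 * real n * (1 + \<theta> * \<epsilon>)\<^sup>2)"
    by (simp add: power2_eq_square field_simps)
  then have "real N \<le> 4 * real n * (1 + \<theta> * \<epsilon>)\<^sup>2" using N0 by (simp only: mult_le_cancel_left_pos)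
  also have "\<dots> = real n * (2 * (1 + \<theta> * \<epsilon>))\<^sup>2" by (simp only: power_mult_distrib) simp
  finally have "real n * s\<^sup>2 \<le> real n * (2 * (1 + \<theta> * \<epsilon>))\<^sup>2"
    unfolding s2[symmetric] by (simp only: mult.commute)
  then have "s\<^sup>2 \<le> (2 * (1 + \<theta> * \<epsilon>))\<^sup>2" using n0 by (simp only: mult_le_cancel_left_pos)
  moreover have "0 \<le> 2 * (1 + \<theta> * \<epsilon>)"
    using \<theta> \<epsilon> by (intro mult_nonneg_nonneg add_nonneg_nonneg) auto
  ultimately have "s \<le> 2 * (1 + \<theta> * \<epsilon>)" by (rule power2_le_imp_le)
  moreover have "\<theta> * \<epsilon> < s / 4"
  proof -
    have "\<epsilon> < s / (\<theta> * 4)" using less(2) by (simp add: s_def)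
    then have "\<theta> * \<epsilon> < \<theta> * (s / (\<theta> * 4))" using \<theta> by (intro mult_strict_left_mono) auto
    then show ?thesis using \<theta> by simp
  qed
  ultimately show False using s unfolding distrib_left by linarith
qed

lemma lp_indicator:
  assumes "r > 0" "finite I" "i \<in> I"
  shows "lp r I (\<lambda>j. if j = i then 1 else 0) = 1"
proof -
  have "(\<Sum>j\<in>I. \<bar>if j = i then 1 else 0 :: real\<bar> powr r) = (\<Sum>j\<in>I. if j = i then 1 else 0)"
    by (intro sum.cong) auto
  then show ?thesis using assms by (simp add: lp_def)
qed

lemma mnorm_single:
  assumes "p > 0" "q > 0" and i: "i \<in> {1..m} \<times> {1..k}"
  shows "mnorm p q m k (Poly_Mapping.lookup (Poly_Mapping.single i 1)) = 1"
proof -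
  obtain i1 i2 where i12: "i = (i1, i2)" "i1 \<in> {1..m}" "i2 \<in> {1..k}" using i by blast
  have "lp p {1..m} (\<lambda>a. Poly_Mapping.lookup (Poly_Mapping.single i (1::real)) (a, b)) = (if b = i2 then 1 else 0)" for b
  proof (cases "b = i2")
    case True
    then have "(\<lambda>a. Poly_Mapping.lookup (Poly_Mapping.single i (1::real)) (a, b)) = (\<lambda>a. if a = i1 then 1 else 0)"
      by (auto simp: i12 lookup_single when_def)
    then show ?thesis using True lp_indicator[OF assms(1) _ i12(2)] by simp
  next
    case False
    then have "(\<lambda>a. Poly_Mapping.lookup (Poly_Mapping.single i (1::real)) (a, b)) = (\<lambda>a. 0)"
      by (auto simp: i12 lookup_single when_def)
    then show ?thesis using False by (simp add: lp_def)
  qed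
  then show ?thesis unfolding mnorm_def using lp_indicator[OF assms(2) _ i12(3)] by simp
qed

lemma mnorm_2_2_diff: "mnorm 2 2 m k (\<lambda>i. f i - g i) \<le> mnorm 2 2 m k f + mnorm 2 2 m k g"
  using L2_set_triangle_ineq[of f "\<lambda>i. - g i" "{1..m} \<times> {1..k}"]
  by (simp add: mnorm_2_2 L2_set_def)

lemma linear_operator_on_sum:
  assumes A: "linear_operator_on V A" and V: "subspace V" and S: "finite S" and f: "\<And>i. i \<in> S \<Longrightarrow> f i \<in> V"
  shows "A (\<Sum>i\<in>S. c i *\<^sub>R f i) = (\<Sum>i\<in>S. c i *\<^sub>R A (f i))"
  using S f
proof (induction S rule: finite_induct)
  case empty
  have "0 \<in> V" using V by (rule subspace_0)
  then have "A (0 *\<^sub>R 0) = 0 *\<^sub>R A 0" using A unfolding linear_operator_on_def by blast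
  then show ?case by simp
next
  case (insert x S)
  have "c x *\<^sub>R f x \<in> V" using V insert.prems by (intro subspace_scale) auto
  moreover have "(\<Sum>i\<in>S. c i *\<^sub>R f i) \<in> V" using V insert.prems by (intro subspace_sum subspace_scale) auto
  ultimately have "A (c x *\<^sub>R f x + (\<Sum>i\<in>S. c i *\<^sub>R f i)) = A (c x *\<^sub>R f x) + A (\<Sum>i\<in>S. c i *\<^sub>R f i)"
    using A unfolding linear_operator_on_def by blast
  moreover have "A (c x *\<^sub>R f x) = c x *\<^sub>R A (f x)"
    using A insert.prems unfolding linear_operator_on_def by blast
  ultimately show ?case using insert by simp
qed

text \<open>Fixes one competitor in the infimum together with a uniform error bound, so that lower
  bounds for the width become lower bounds for the number \<epsilon>.\<close>

locale approximation_error =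
  fixes m k n :: nat and p\<^sub>1 q\<^sub>1 p\<^sub>2 q\<^sub>2 \<epsilon> :: real and A :: "((nat \<times> nat) \<Rightarrow>\<^sub>0 real) \<Rightarrow> ((nat \<times> nat) \<Rightarrow>\<^sub>0 real)"
  assumes pos: "p\<^sub>1 > 0" "q\<^sub>1 > 0" "p\<^sub>2 > 0" "q\<^sub>2 > 0" and mk: "m \<ge> 1" "k \<ge> 1" and n: "n \<ge> 1" "16 * n \<le> m * k"
    and A: "linear_operator_on (lmk_space m k) A" "rank_at_most n (lmk_space m k) A"
    and err: "\<And>x. x \<in> lmk_ball p\<^sub>1 q\<^sub>1 m k \<Longrightarrow> lmk_norm p\<^sub>2 q\<^sub>2 m k (x - A x) \<le> \<epsilon>"
begin

abbreviation "I \<equiv> {1..m} \<times> {1..k}"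
abbreviation e :: "nat \<times> nat \<Rightarrow> ((nat \<times> nat) \<Rightarrow>\<^sub>0 real)" where "e i \<equiv> Poly_Mapping.single i 1"

text \<open>The row index comes before the column index, here and in \<open>d\<close>.\<close>

definition a :: "nat \<times> nat \<Rightarrow> nat \<times> nat \<Rightarrow> real" where "a j i = Poly_Mapping.lookup (A (e i)) j"
definition d :: "nat \<times> nat \<Rightarrow> nat \<times> nat \<Rightarrow> real" where "d j i = Poly_Mapping.lookup (e i - A (e i)) j"

lemma a_eq: "a j i = Poly_Mapping.lookup (e i) j - d j i"
  by (simp add: a_def d_def lookup_minus)

lemma e_space: "i \<in> I \<Longrightarrow> e i \<in> lmk_space m k"
  by (auto simp: lmk_space_iff lookup_single when_def)

lemma e_ball: "i \<in> I \<Longrightarrow> e i \<in> lmk_ball p\<^sub>1 q\<^sub>1 m k"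
  using e_space mnorm_single[OF pos(1,2)] by (simp add: lmk_ball_def lmk_norm_eq_mnorm)

lemma lookup_le: "i \<in> I \<Longrightarrow> \<bar>Poly_Mapping.lookup x i\<bar> \<le> lmk_norm p\<^sub>2 q\<^sub>2 m k x"
  unfolding lmk_norm_eq_mnorm using pos by (cases i) (auto intro!: mnorm_coord_le)

lemma d_le: "i \<in> I \<Longrightarrow> j \<in> I \<Longrightarrow> \<bar>d j i\<bar> \<le> \<epsilon>"
  unfolding d_def using lookup_le[of j "e i - A (e i)"] err[OF e_ball[of i]] by linarith

lemma \<epsilon>_nonneg: "\<epsilon> \<ge> 0"
proof -
  have "(1, 1) \<in> I" using mk by simp
  then show ?thesis using d_le[of "(1, 1)" "(1, 1)"] by linarith
qed

lemma lower_bound: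
  assumes \<theta>: "\<theta> > 0" and HS: "(\<Sum>i\<in>I. \<Sum>j\<in>I. (a j i)\<^sup>2) \<le> real (m * k) * (1 + \<theta> * \<epsilon>)\<^sup>2"
  shows "1/4 * min (sqrt (real (m * k) / n) / \<theta>) 1 \<le> \<epsilon>"
proof -
  obtain B where B: "finite B" "card B \<le> n" "span B = A ` lmk_space m k"
    using A(2) unfolding rank_at_most_def by blast
  have "\<forall>i\<in>I. \<exists>c. A (e i) = (\<Sum>b\<in>B. c b *\<^sub>R b)"
  proof
    fix i assume "i \<in> I"
    then have "A (e i) \<in> span B" using B(3) e_space by blast
    then show "\<exists>c. A (e i) = (\<Sum>b\<in>B. c b *\<^sub>R b)" unfolding span_finite[OF B(1)] by blast
  qed
  from bchoice[OF this] obtain c where c: "\<forall>i\<in>I. A (e i) = (\<Sum>b\<in>B. c i b *\<^sub>R b)" by blast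
  show ?thesis
  proof (rule trace_lower_bound[where I = I and B = B and a = a and c = "\<lambda>b i. c i b" and W = Poly_Mapping.lookup])
    fix i j assume "i \<in> I" "j \<in> I"
    then have "A (e i) = (\<Sum>b\<in>B. c i b *\<^sub>R b)" using c by blast
    then show "a j i = (\<Sum>b\<in>B. c i b * Poly_Mapping.lookup b j)"
      by (simp add: a_def lookup_sum lookup_scaleR)
  next
    fix i assume "i \<in> I"
    then show "\<bar>1 - a i i\<bar> \<le> \<epsilon>" using d_le[of i i] by (simp add: a_eq)
  qed (use B n \<theta> HS \<epsilon>_nonneg in \<open>auto simp: card_cartesian_product\<close>)
qed

text \<open>Here \<theta> is the Hoelder constant from the (\<open>p\<^sub>2\<close>,
  \<open>q\<^sub>2\<close>) norm to the Euclidean one. It is applied to a column of 1 - A, the error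
  at a unit vector; the triangle inequality with that unit vector gives 1 + \<theta>
  \<epsilon>.\<close>

lemma lower_bound_columns:
  assumes "2 \<le> p\<^sub>2" "2 \<le> q\<^sub>2"
  defines "\<theta> \<equiv> real m powr (1/2 - 1/p\<^sub>2) * real k powr (1/2 - 1/q\<^sub>2)"
  shows "1/4 * min (sqrt (real (m * k) / n) / \<theta>) 1 \<le> \<epsilon>"
proof (rule lower_bound)
  show \<theta>: "\<theta> > 0" using mk by (simp add: \<theta>_def)
  have "(\<Sum>j\<in>I. (a j i)\<^sup>2) \<le> (1 + \<theta> * \<epsilon>)\<^sup>2" if i: "i \<in> I" for i
  proof -
    have "mnorm 2 2 m k (\<lambda>j. d j i) \<le> \<theta> * mnorm p\<^sub>2 q\<^sub>2 m k (\<lambda>j. d j i)"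
      unfolding \<theta>_def using assms(1,2) mk by (intro mnorm_le_mnorm) auto
    also have "\<dots> \<le> \<theta> * \<epsilon>"
      using err[OF e_ball[OF i]] \<theta> by (intro mult_left_mono) (simp_all add: lmk_norm_eq_mnorm d_def[abs_def])
    finally have "mnorm 2 2 m k (\<lambda>j. a j i) \<le> 1 + \<theta> * \<epsilon>"
      using mnorm_2_2_diff[of m k "Poly_Mapping.lookup (e i)" "\<lambda>j. d j i"] mnorm_single[OF _ _ i, of 2 2]
      by (simp add: a_eq)
    then have "(mnorm 2 2 m k (\<lambda>j. a j i))\<^sup>2 \<le> (1 + \<theta> * \<epsilon>)\<^sup>2" by (rule power_mono) simp
    then show ?thesis by (simp add: mnorm_2_2 sum_nonneg)
  qed
  then have "(\<Sum>i\<in>I. \<Sum>j\<in>I. (a j i)\<^sup>2) \<le> (\<Sum>i\<in>I. (1 + \<theta> * \<epsilon>)\<^sup>2)" by (intro sum_mono)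
  then show "(\<Sum>i\<in>I. \<Sum>j\<in>I. (a j i)\<^sup>2) \<le> real (m * k) * (1 + \<theta> * \<epsilon>)\<^sup>2"
    by (simp add: card_cartesian_product)
qed

text \<open>Testing the approximation on the \<open>j\<close>-th row of \<open>1 - A\<close> bounds the norm of that row.\<close>

lemma row_sum_le:
  assumes j: "j \<in> I"
  shows "(\<Sum>i\<in>I. (d j i)\<^sup>2) \<le> \<epsilon> * mnorm p\<^sub>1 q\<^sub>1 m k (d j)"
proof -
  define \<rho> where "\<rho> = mnorm p\<^sub>1 q\<^sub>1 m k (d j)"
  show ?thesis
  proof (cases "\<rho> = 0")
    case True
    have "d j i = 0" if "i \<in> I" for i
      using that pos mnorm_coord_le[of p\<^sub>1 q\<^sub>1 "fst i" m "snd i" k "d j"] True by (cases i) (auto simp: \<rho>_def)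
    then show ?thesis using True by (simp add: \<rho>_def)
  next
    case False
    then have \<rho>: "\<rho> > 0" using mnorm_nonneg[of p\<^sub>1 q\<^sub>1 m k "d j"] unfolding \<rho>_def by linarith
    define y where "y = (\<Sum>i\<in>I. (d j i / \<rho>) *\<^sub>R e i)"
    have look: "Poly_Mapping.lookup y i = d j i / \<rho>" if "i \<in> I" for i
    proof -
      have "Poly_Mapping.lookup y i = (\<Sum>i'\<in>I. if i' = i then d j i / \<rho> else 0)"
        unfolding y_def lookup_sum by (intro sum.cong) (auto simp: lookup_scaleR lookup_single when_def)
      then show ?thesis using that by simp
    qed
    have space: "y \<in> lmk_space m k"
      unfolding y_def by (intro subspace_sum subspace_scale subspace_lmk_space e_space)
    have "mnorm p\<^sub>1 q\<^sub>1 m k (Poly_Mapping.lookup y) \<le> mnorm p\<^sub>1 q\<^sub>1 m k (\<lambda>i. (1 / \<rho>) * d j i)"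
      using pos look by (intro mnorm_mono) auto
    also have "\<dots> = (1 / \<rho>) * \<rho>"
      using \<rho> pos by (subst mnorm_cmult) (auto simp: \<rho>_def)
    finally have "mnorm p\<^sub>1 q\<^sub>1 m k (Poly_Mapping.lookup y) \<le> 1" using \<rho> by simp
    then have "y \<in> lmk_ball p\<^sub>1 q\<^sub>1 m k" using space by (simp add: lmk_ball_def lmk_norm_eq_mnorm)
    then have "\<bar>Poly_Mapping.lookup (y - A y) j\<bar> \<le> \<epsilon>" using lookup_le[OF j, of "y - A y"] err by fastforce
    moreover have "y - A y = (\<Sum>i\<in>I. (d j i / \<rho>) *\<^sub>R (e i - A (e i)))"
      unfolding y_def using linear_operator_on_sum[OF A(1) subspace_lmk_space, of I e] e_space
      by (simp add: scaleR_diff_right sum_subtractf)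
    then have "Poly_Mapping.lookup (y - A y) j = (\<Sum>i\<in>I. (d j i)\<^sup>2) / \<rho>"
      by (simp add: lookup_sum lookup_scaleR d_def[symmetric] power2_eq_square sum_divide_distrib)
    ultimately have "(\<Sum>i\<in>I. (d j i)\<^sup>2) / \<rho> \<le> \<epsilon>" by linarith
    then show ?thesis using \<rho> by (simp add: \<rho>_def[symmetric] field_simps)
  qed
qed

text \<open>The row test bounds the squared Euclidean norm S^2 of a row of 1 - A by \<epsilon> times
  its (\<open>p\<^sub>1\<close>, \<open>q\<^sub>1\<close>) norm, hence by \<epsilon> \<theta> S.
  Cancelling one factor S gives the estimate S \<le> \<theta> \<epsilon> that the columns satisfy in
  the other case.\<close>

lemma lower_bound_rows:
  assumes "p\<^sub>1 \<le> 2" "q\<^sub>1 \<le> 2"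
  defines "\<theta> \<equiv> real m powr (1/p\<^sub>1 - 1/2) * real k powr (1/q\<^sub>1 - 1/2)"
  shows "1/4 * min (sqrt (real (m * k) / n) / \<theta>) 1 \<le> \<epsilon>"
proof (rule lower_bound)
  show \<theta>: "\<theta> > 0" using mk by (simp add: \<theta>_def)
  have "(\<Sum>i\<in>I. (a j i)\<^sup>2) \<le> (1 + \<theta> * \<epsilon>)\<^sup>2" if j: "j \<in> I" for j
  proof -
    define S where "S = mnorm 2 2 m k (d j)"
    have S0: "S \<ge> 0" by (simp add: S_def)
    have "S * S = (\<Sum>i\<in>I. (d j i)\<^sup>2)" by (simp add: S_def mnorm_2_2 sum_nonneg)
    also have "\<dots> \<le> \<epsilon> * mnorm p\<^sub>1 q\<^sub>1 m k (d j)" by (rule row_sum_le[OF j])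
    also have "\<dots> \<le> \<epsilon> * (\<theta> * S)"
      unfolding \<theta>_def S_def using assms(1,2) pos mk \<epsilon>_nonneg by (intro mult_left_mono mnorm_le_mnorm) auto
    finally have "S * S \<le> (\<theta> * \<epsilon>) * S" by (simp only: mult_ac)
    then have "S \<le> \<theta> * \<epsilon>"
      using S0 \<theta> \<epsilon>_nonneg by (cases "S = 0") (auto simp: mult_le_cancel_right)
    moreover have "(\<lambda>i. a j i) = (\<lambda>i. Poly_Mapping.lookup (e j) i - d j i)"
      by (simp add: a_eq lookup_single when_def eq_commute)
    ultimately have "mnorm 2 2 m k (\<lambda>i. a j i) \<le> 1 + \<theta> * \<epsilon>"
      using mnorm_2_2_diff[of m k "Poly_Mapping.lookup (e j)" "d j"] mnorm_single[OF _ _ j, of 2 2]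
      by (simp add: S_def)
    then have "(mnorm 2 2 m k (\<lambda>i. a j i))\<^sup>2 \<le> (1 + \<theta> * \<epsilon>)\<^sup>2" by (rule power_mono) simp
    then show ?thesis by (simp add: mnorm_2_2 sum_nonneg)
  qed
  then have "(\<Sum>j\<in>I. \<Sum>i\<in>I. (a j i)\<^sup>2) \<le> (\<Sum>j\<in>I. (1 + \<theta> * \<epsilon>)\<^sup>2)" by (intro sum_mono)
  then show "(\<Sum>i\<in>I. \<Sum>j\<in>I. (a j i)\<^sup>2) \<le> real (m * k) * (1 + \<theta> * \<epsilon>)\<^sup>2"
    by (subst sum.swap) (simp add: card_cartesian_product)
qed

end

text \<open>Lets the estimates work with a real error bound although the supremum is extended real:
  if the supremum were below v, a real number strictly between the two would be an admissible
  \<epsilon>.\<close>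

lemma lmk_width_geI:
  assumes "\<And>A \<epsilon>. linear_operator_on (lmk_space m k) A \<Longrightarrow> rank_at_most n (lmk_space m k) A \<Longrightarrow>
      (\<And>x. x \<in> lmk_ball p\<^sub>1 q\<^sub>1 m k \<Longrightarrow> lmk_norm p\<^sub>2 q\<^sub>2 m k (x - A x) \<le> \<epsilon>) \<Longrightarrow> v \<le> \<epsilon>"
  shows "ereal v \<le> lmk_width n p\<^sub>1 q\<^sub>1 p\<^sub>2 q\<^sub>2 m k"
  unfolding lmk_width_def linear_width_def
proof (rule INF_greatest)
  fix A assume A: "A \<in> {A. linear_operator_on (lmk_space m k) A \<and>
      norm_continuous_on (lmk_space m k) (lmk_norm p\<^sub>2 q\<^sub>2 m k) A \<and> rank_at_most n (lmk_space m k) A}"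
  show "ereal v \<le> (SUP x\<in>lmk_ball p\<^sub>1 q\<^sub>1 m k. ereal (lmk_norm p\<^sub>2 q\<^sub>2 m k (x - A x)))"
  proof (rule ccontr)
    assume "\<not> ?thesis"
    then have "(SUP x\<in>lmk_ball p\<^sub>1 q\<^sub>1 m k. ereal (lmk_norm p\<^sub>2 q\<^sub>2 m k (x - A x))) < ereal v"
      by (simp only: not_le)
    from ereal_dense2[OF this]
    obtain z where z: "(SUP x\<in>lmk_ball p\<^sub>1 q\<^sub>1 m k. ereal (lmk_norm p\<^sub>2 q\<^sub>2 m k (x - A x))) < ereal z" "ereal z < ereal v"
      by blast
    have "lmk_norm p\<^sub>2 q\<^sub>2 m k (x - A x) \<le> z" if "x \<in> lmk_ball p\<^sub>1 q\<^sub>1 m k" for x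
    proof -
      have "ereal (lmk_norm p\<^sub>2 q\<^sub>2 m k (x - A x)) \<le> (SUP x\<in>lmk_ball p\<^sub>1 q\<^sub>1 m k. ereal (lmk_norm p\<^sub>2 q\<^sub>2 m k (x - A x)))"
        using that by (rule SUP_upper)
      also note z(1)
      finally show ?thesis by simp
    qed
    then have "v \<le> z" using A by (intro assms[of A z]) auto
    then show False using z(2) by simp
  qed
qed

text \<open>The exponents of \<theta> and those of the final bound add up to 1/2 in both m and k,
  which converts the quotient from the trace argument into the form of the theorem.\<close>

lemma width_exponents:
  assumes "m \<ge> 1" "k \<ge> 1" "n \<ge> 1" and "\<alpha> + s = 1/2" "\<beta> + t = 1/2"
  shows "sqrt (real (m * k) / real n) / (real m powr \<alpha> * real k powr \<beta>) = real n powr (-1/2) * real m powr s * real k powr t"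
proof -
  have n: "real n powr (-1/2) = 1 / sqrt n" using assms by (simp add: powr_minus_divide powr_half_sqrt)
  have m: "sqrt m = real m powr \<alpha> * real m powr s" 
    unfolding powr_add[symmetric] assms(4) by (simp add: powr_half_sqrt)
  have k: "sqrt k = real k powr \<beta> * real k powr t" 
    unfolding powr_add[symmetric] assms(5) by (simp add: powr_half_sqrt)
  have "sqrt (real (m * k) / real n) = sqrt m * sqrt k / sqrt n" by (simp add: real_sqrt_divide real_sqrt_mult)
  then show ?thesis unfolding n m k using assms by simp
qed

theorem theorem3:
  fixes p\<^sub>2 q\<^sub>2 :: real
  assumes "2 \<le> p\<^sub>2" and "2 \<le> q\<^sub>2"
  shows
    "(\<forall>p\<^sub>1 q\<^sub>1. 1 < p\<^sub>1 \<and> p\<^sub>1 \<le> 2 \<and> 1 < q\<^sub>1 \<and> q\<^sub>1 \<le> 2 \<longrightarrow>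
        (\<exists>C>0. \<forall>m\<ge>1. \<forall>k\<ge>1. \<forall>n\<ge>1.
           lmk_width n p\<^sub>1 q\<^sub>1 p\<^sub>2 q\<^sub>2 m k
             \<le> ereal (C * min (real n powr (-1/2)
                              * real m powr (max (1 / p\<^sub>2) (1 / conj_exponent p\<^sub>1))
                              * real k powr (max (1 / q\<^sub>2) (1 / conj_exponent q\<^sub>1))) 1)))
     \<and>
     (\<exists>a>0. \<forall>p\<^sub>1 q\<^sub>1. 1 < p\<^sub>1 \<and> p\<^sub>1 \<le> 2 \<and> 1 < q\<^sub>1 \<and> q\<^sub>1 \<le> 2 \<longrightarrow>
        (1 / p\<^sub>1 + 1 / p\<^sub>2 \<ge> 1 \<and> 1 / q\<^sub>1 + 1 / q\<^sub>2 \<ge> 1 \<longrightarrow>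
           (\<exists>c>0. \<forall>m\<ge>1. \<forall>k\<ge>1. \<forall>n\<ge>1. real n \<le> a * real m * real k \<longrightarrow>
              lmk_width n p\<^sub>1 q\<^sub>1 p\<^sub>2 q\<^sub>2 m k
                \<ge> ereal (c * min (real n powr (-1/2)
                                 * real m powr (1 / p\<^sub>2) * real k powr (1 / q\<^sub>2)) 1))) \<and>
        (1 / p\<^sub>1 + 1 / p\<^sub>2 \<le> 1 \<and> 1 / q\<^sub>1 + 1 / q\<^sub>2 \<le> 1 \<longrightarrow>
           (\<exists>c>0. \<forall>m\<ge>1. \<forall>k\<ge>1. \<forall>n\<ge>1. real n \<le> a * real m * real k \<longrightarrow>
              lmk_width n p\<^sub>1 q\<^sub>1 p\<^sub>2 q\<^sub>2 m k
                \<ge> ereal (c * min (real n powr (-1/2)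
                                 * real m powr (1 / conj_exponent p\<^sub>1)
                                 * real k powr (1 / conj_exponent q\<^sub>1)) 1))))"
proof (intro conjI allI impI)
  fix p\<^sub>1 q\<^sub>1 :: real
  assume "1 < p\<^sub>1 \<and> p\<^sub>1 \<le> 2 \<and> 1 < q\<^sub>1 \<and> q\<^sub>1 \<le> 2"
  then show "\<exists>C>0. \<forall>m\<ge>1. \<forall>k\<ge>1. \<forall>n\<ge>1.
      lmk_width n p\<^sub>1 q\<^sub>1 p\<^sub>2 q\<^sub>2 m k
        \<le> ereal (C * min (real n powr (-1/2)
                         * real m powr (max (1 / p\<^sub>2) (1 / conj_exponent p\<^sub>1))
                         * real k powr (max (1 / q\<^sub>2) (1 / conj_exponent q\<^sub>1))) 1)"
    using assms by (intro lmk_width_upper) auto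
next
  have card: "16 * n \<le> m * k" if "real n \<le> 1/16 * real m * real k" for m k n :: nat
  proof -
    have "real (16 * n) \<le> real (m * k)" using that by simp
    then show ?thesis by (simp only: of_nat_le_iff)
  qed
  have columns: "ereal (1/4 * min (real n powr (-1/2) * real m powr (1 / p\<^sub>2) * real k powr (1 / q\<^sub>2)) 1)
      \<le> lmk_width n p\<^sub>1 q\<^sub>1 p\<^sub>2 q\<^sub>2 m k"
    if "1 < p\<^sub>1 \<and> p\<^sub>1 \<le> 2 \<and> 1 < q\<^sub>1 \<and> q\<^sub>1 \<le> 2" "m \<ge> 1" "k \<ge> 1" "n \<ge> 1" "16 * n \<le> m * k" for p\<^sub>1 q\<^sub>1 and m k n :: nat
  proof (rule lmk_width_geI)
    fix A \<epsilon>
    assume "linear_operator_on (lmk_space m k) A" "rank_at_most n (lmk_space m k) A"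
      "\<And>x. x \<in> lmk_ball p\<^sub>1 q\<^sub>1 m k \<Longrightarrow> lmk_norm p\<^sub>2 q\<^sub>2 m k (x - A x) \<le> \<epsilon>"
    then interpret approximation_error m k n p\<^sub>1 q\<^sub>1 p\<^sub>2 q\<^sub>2 \<epsilon> A
      using that assms by unfold_locales auto
    show "1/4 * min (real n powr (-1/2) * real m powr (1 / p\<^sub>2) * real k powr (1 / q\<^sub>2)) 1 \<le> \<epsilon>"
      using lower_bound_columns[OF assms]
        width_exponents[OF that(2-4), of "1/2 - 1/p\<^sub>2" "1/p\<^sub>2" "1/2 - 1/q\<^sub>2" "1/q\<^sub>2"] by simp
  qed
  have rows: "ereal (1/4 * min (real n powr (-1/2) * real m powr (1 / conj_exponent p\<^sub>1) * real k powr (1 / conj_exponent q\<^sub>1)) 1)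
      \<le> lmk_width n p\<^sub>1 q\<^sub>1 p\<^sub>2 q\<^sub>2 m k"
    if pq: "1 < p\<^sub>1 \<and> p\<^sub>1 \<le> 2 \<and> 1 < q\<^sub>1 \<and> q\<^sub>1 \<le> 2" and "m \<ge> 1" "k \<ge> 1" "n \<ge> 1" "16 * n \<le> m * k" for p\<^sub>1 q\<^sub>1 and m k n :: nat
  proof (rule lmk_width_geI)
    fix A \<epsilon>
    assume "linear_operator_on (lmk_space m k) A" "rank_at_most n (lmk_space m k) A"
      "\<And>x. x \<in> lmk_ball p\<^sub>1 q\<^sub>1 m k \<Longrightarrow> lmk_norm p\<^sub>2 q\<^sub>2 m k (x - A x) \<le> \<epsilon>"
    then interpret approximation_error m k n p\<^sub>1 q\<^sub>1 p\<^sub>2 q\<^sub>2 \<epsilon> A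
      using that assms by unfold_locales auto
    have "1 / p\<^sub>1 - 1/2 + 1 / conj_exponent p\<^sub>1 = 1/2" "1 / q\<^sub>1 - 1/2 + 1 / conj_exponent q\<^sub>1 = 1/2"
      using pq by (simp_all add: conj_exponent_def field_simps)
    then show "1/4 * min (real n powr (-1/2) * real m powr (1 / conj_exponent p\<^sub>1) * real k powr (1 / conj_exponent q\<^sub>1)) 1 \<le> \<epsilon>"
      using lower_bound_rows pq
        width_exponents[OF that(2-4), of "1/p\<^sub>1 - 1/2" "1 / conj_exponent p\<^sub>1" "1/q\<^sub>1 - 1/2" "1 / conj_exponent q\<^sub>1"] by simp
  qed
  show "\<exists>a>0. \<forall>p\<^sub>1 q\<^sub>1. 1 < p\<^sub>1 \<and> p\<^sub>1 \<le> 2 \<and> 1 < q\<^sub>1 \<and> q\<^sub>1 \<le> 2 \<longrightarrow>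
        (1 / p\<^sub>1 + 1 / p\<^sub>2 \<ge> 1 \<and> 1 / q\<^sub>1 + 1 / q\<^sub>2 \<ge> 1 \<longrightarrow>
           (\<exists>c>0. \<forall>m\<ge>1. \<forall>k\<ge>1. \<forall>n\<ge>1. real n \<le> a * real m * real k \<longrightarrow>
              lmk_width n p\<^sub>1 q\<^sub>1 p\<^sub>2 q\<^sub>2 m k
                \<ge> ereal (c * min (real n powr (-1/2)
                                 * real m powr (1 / p\<^sub>2) * real k powr (1 / q\<^sub>2)) 1))) \<and>
        (1 / p\<^sub>1 + 1 / p\<^sub>2 \<le> 1 \<and> 1 / q\<^sub>1 + 1 / q\<^sub>2 \<le> 1 \<longrightarrow>
           (\<exists>c>0. \<forall>m\<ge>1. \<forall>k\<ge>1. \<forall>n\<ge>1. real n \<le> a * real m * real k \<longrightarrow>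
              lmk_width n p\<^sub>1 q\<^sub>1 p\<^sub>2 q\<^sub>2 m k
                \<ge> ereal (c * min (real n powr (-1/2)
                                 * real m powr (1 / conj_exponent p\<^sub>1)
                                 * real k powr (1 / conj_exponent q\<^sub>1)) 1)))"
  \<comment> \<open>The proportion 1/16 is the condition 16 n \<le> m k of the trace
    argument.\<close>
  proof (rule exI[of _ "1/16"], intro conjI allI impI)
    fix p\<^sub>1 q\<^sub>1 :: real
    assume pq: "1 < p\<^sub>1 \<and> p\<^sub>1 \<le> 2 \<and> 1 < q\<^sub>1 \<and> q\<^sub>1 \<le> 2"
    show "\<exists>c>0. \<forall>m\<ge>1. \<forall>k\<ge>1. \<forall>n\<ge>1. real n \<le> 1/16 * real m * real k \<longrightarrow>
              ereal (c * min (real n powr (-1/2) * real m powr (1 / p\<^sub>2) * real k powr (1 / q\<^sub>2)) 1)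
                \<le> lmk_width n p\<^sub>1 q\<^sub>1 p\<^sub>2 q\<^sub>2 m k"
      using columns[OF pq] card by (intro exI[of _ "1/4"]) auto
    show "\<exists>c>0. \<forall>m\<ge>1. \<forall>k\<ge>1. \<forall>n\<ge>1. real n \<le> 1/16 * real m * real k \<longrightarrow>
              ereal (c * min (real n powr (-1/2) * real m powr (1 / conj_exponent p\<^sub>1) * real k powr (1 / conj_exponent q\<^sub>1)) 1)
                \<le> lmk_width n p\<^sub>1 q\<^sub>1 p\<^sub>2 q\<^sub>2 m k"
      using rows[OF pq] card by (intro exI[of _ "1/4"]) auto
  qed simp
qed

end
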